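(* Let $\mathfrak M,\mathfrak N$ be separable Hilbert spaces, let $\Theta(\lambda)\in\mathbf S(\mathfrak M,\mathfrak N)$, and let $Z(\lambda)$ be the Möbius parameter of $\Theta(\lambda)$. Then $$\varphi_\Theta(\lambda)=0\iff\varphi_Z(\lambda)=0,\qquad \psi_\Theta(\lambda)=0\iff\psi_Z(\lambda)=0.$$
   Context: $\mathbb D$ is the open unit disk, $\mathbb T$ the unit circle. $\mathbf S(\mathfrak M,\mathfrak N)$ is the Schur class of holomorphic functions on $\mathbb D$ with contractive values in $\mathbf L(\mathfrak M,\mathfrak N)$ (bounded operators); such functions have non-tangential strong limit values $\Theta(\xi)$ for almost every $\xi\in\mathbb T$. For a contraction $T$, $D_T=(I-T^*T)^{1/2}$ and $\mathfrak D_T=\overline{\mathrm{ran}}\,D_T$; $\Theta^*(0)$ means $\Theta(0)^*$. Möbius parameter: the unique $Z\in\mathbf S(\mathfrak D_{\Theta(0)},\mathfrak D_{\Theta^*(0)})$ with $\Theta(\lambda)=\Theta(0)+D_{\Theta^*(0)}Z(\lambda)(I_{\mathfrak D_{\Theta(0)}}+\Theta^*(0)Z(\lambda))^{-1}D_{\Theta(0)}$, $\lambda\in\mathbb D$. Defect functions: for a Schur class function $\Theta\in\mathbf S(\mathfrak M,\mathfrak N)$, $\varphi_\Theta$ (resp. $\psi_\Theta$) denotes the outer (resp. co-outer) Schur class function, with domain $\mathfrak M$ (resp. with values in $\mathfrak N$), such that (i) $\varphi_\Theta^*(\xi)\varphi_\Theta(\xi)\le I_{\mathfrak M}-\Theta^*(\xi)\Theta(\xi)$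 (resp. $\psi_\Theta(\xi)\psi_\Theta^*(\xi)\le I_{\mathfrak N}-\Theta(\xi)\Theta^*(\xi)$) a.e. on $\mathbb T$; (ii) if $\widetilde\varphi$ (resp. $\widetilde\psi$) is any Schur class function with $\widetilde\varphi^*(\xi)\widetilde\varphi(\xi)\le I_{\mathfrak M}-\Theta^*(\xi)\Theta(\xi)$ (resp. $\widetilde\psi(\xi)\widetilde\psi^*(\xi)\le I_{\mathfrak N}-\Theta(\xi)\Theta^*(\xi)$) a.e. on $\mathbb T$, then $\widetilde\varphi^*(\xi)\widetilde\varphi(\xi)\le\varphi_\Theta^*(\xi)\varphi_\Theta(\xi)$ (resp. $\widetilde\psi(\xi)\widetilde\psi^*(\xi)\le\psi_\Theta(\xi)\psi_\Theta^*(\xi)$) a.e. on $\mathbb T$. These functions exist and are unique up to a left (resp. right) constant unitary factor. The functions $\varphi_Z,\psi_Z$ are defined in the same way for $Z$. *)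

theory Defs
  imports "HOL-Analysis.Analysis"
begin

section \<open>Complex Hilbert spaces\<close>

text \<open>The distribution has real inner product spaces only. The complex inner product is linear in
  its first argument. Separable Hilbert spaces are the types of sort
  \<open>{complex_hilbert, second_countable_topology}\<close>. Zero-dimensional spaces are allowed.\<close>

class complex_hilbert = real_inner + complete_space +
  fixes scaleC :: "complex \<Rightarrow> 'a \<Rightarrow> 'a"  (infixr "*\<^sub>C" 75)
    and cinner :: "'a \<Rightarrow> 'a \<Rightarrow> complex"
  assumes scaleC_add_right: "a *\<^sub>C (x + y) = a *\<^sub>C x + a *\<^sub>C y"
    and scaleC_add_left: "(a + b) *\<^sub>C x = a *\<^sub>C x + b *\<^sub>C x"
    and scaleC_scaleC: "a *\<^sub>C (b *\<^sub>C x) = (a * b) *\<^sub>C x"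
    and scaleR_scaleC: "r *\<^sub>R x = complex_of_real r *\<^sub>C x"
    and cinner_add_left: "cinner (x + y) z = cinner x z + cinner y z"
    and cinner_scaleC_left: "cinner (a *\<^sub>C x) y = a * cinner x y"
    and cinner_commute: "cinner x y = cnj (cinner y x)"
    and inner_eq_Re_cinner: "x \<bullet> y = Re (cinner x y)"

definition closed_csubspace :: "'a::complex_hilbert set \<Rightarrow> bool" where
  "closed_csubspace U \<longleftrightarrow>
     0 \<in> U \<and> (\<forall>x\<in>U. \<forall>y\<in>U. x + y \<in> U) \<and> (\<forall>a. \<forall>x\<in>U. a *\<^sub>C x \<in> U) \<and> closed U"

subsection \<open>The space of square-summable sequences\<close>

text \<open>The defect functions are maximal among Schur class functions with values in operators
  to (or from) an arbitrary separable Hilbert space. HOL cannot quantify over types inside a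
  formula; since every separable Hilbert space is unitarily equivalent to a closed subspace of
  \<open>\<ell>\<^sup>2\<close>, we quantify over these subspaces.\<close>

typedef ell2 = "{f :: nat \<Rightarrow> complex. summable (\<lambda>n. (cmod (f n))\<^sup>2)}"
  by (rule exI[of _ "\<lambda>_. 0"]) simp

setup_lifting type_definition_ell2

lemma ell2_summable_add:
  assumes "summable (\<lambda>n. (cmod (f n))\<^sup>2)" "summable (\<lambda>n. (cmod (g n))\<^sup>2)"
  shows "summable (\<lambda>n. (cmod (f n + g n))\<^sup>2)"
proof (rule summable_comparison_test')
  show "summable (\<lambda>n. 2 * (cmod (f n))\<^sup>2 + 2 * (cmod (g n))\<^sup>2)"
    using assms by (intro summable_add summable_mult)
  fix n
  have "(cmod (f n + g n))\<^sup>2 \<le> (cmod (f n) + cmod (g n))\<^sup>2"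
    by (intro power_mono norm_triangle_ineq) auto
  also have "\<dots> \<le> 2 * (cmod (f n))\<^sup>2 + 2 * (cmod (g n))\<^sup>2"
    using sum_squares_bound[of "cmod (f n)" "cmod (g n)"] by (simp add: power2_sum)
  finally show "norm ((cmod (f n + g n))\<^sup>2) \<le> 2 * (cmod (f n))\<^sup>2 + 2 * (cmod (g n))\<^sup>2"
    by simp
qed

lemma ell2_summable_scale:
  assumes "summable (\<lambda>n. (cmod (f n))\<^sup>2)"
  shows "summable (\<lambda>n. (cmod (a * f n))\<^sup>2)"
  using summable_mult[OF assms, of "(cmod a)\<^sup>2"] by (simp add: norm_mult power_mult_distrib)

lemma ell2_summable_prod:
  assumes "summable (\<lambda>n. (cmod (f n))\<^sup>2)" "summable (\<lambda>n. (cmod (g n))\<^sup>2)"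
  shows "summable (\<lambda>n. f n * cnj (g n))"
proof (rule summable_comparison_test')
  show "summable (\<lambda>n. (cmod (f n))\<^sup>2 + (cmod (g n))\<^sup>2)"
    using assms by (intro summable_add)
  fix n
  show "norm (f n * cnj (g n)) \<le> (cmod (f n))\<^sup>2 + (cmod (g n))\<^sup>2"
    using sum_squares_bound[of "cmod (f n)" "cmod (g n)"]
      mult_nonneg_nonneg[of "cmod (f n)" "cmod (g n)"]
    by (simp add: norm_mult del: mult_nonneg_nonneg)
qed

instantiation ell2 :: real_vector
begin

lift_definition zero_ell2 :: ell2 is "\<lambda>_. 0" by simp
lift_definition plus_ell2 :: "ell2 \<Rightarrow> ell2 \<Rightarrow> ell2" is "\<lambda>f g n. f n + g n"
  by (rule ell2_summable_add)
lift_definition uminus_ell2 :: "ell2 \<Rightarrow> ell2" is "\<lambda>f n. - f n" by simp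
lift_definition minus_ell2 :: "ell2 \<Rightarrow> ell2 \<Rightarrow> ell2" is "\<lambda>f g n. f n - g n"
  using ell2_summable_add[of _ "\<lambda>n. - _ n"] by simp
lift_definition scaleR_ell2 :: "real \<Rightarrow> ell2 \<Rightarrow> ell2" is "\<lambda>r f n. complex_of_real r * f n"
  by (rule ell2_summable_scale)

instance
  by standard (transfer; simp add: algebra_simps fun_eq_iff)+

end

instantiation ell2 :: real_inner
begin

definition inner_ell2 :: "ell2 \<Rightarrow> ell2 \<Rightarrow> real" where
  "inner_ell2 f g = Re (\<Sum>n. Rep_ell2 f n * cnj (Rep_ell2 g n))"
definition norm_ell2 :: "ell2 \<Rightarrow> real" where "norm_ell2 f = sqrt (f \<bullet> f)"
definition dist_ell2 :: "ell2 \<Rightarrow> ell2 \<Rightarrow> real" where "dist_ell2 f g = norm (f - g)"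
definition sgn_ell2 :: "ell2 \<Rightarrow> ell2" where "sgn_ell2 f = f /\<^sub>R norm f"
definition uniformity_ell2 :: "(ell2 \<times> ell2) filter" where
  "uniformity_ell2 = (INF e\<in>{0<..}. principal {(x, y). dist x y < e})"
definition open_ell2 :: "ell2 set \<Rightarrow> bool" where
  "open_ell2 U \<longleftrightarrow> (\<forall>x\<in>U. \<forall>\<^sub>F (x', y) in uniformity. x' = x \<longrightarrow> y \<in> U)"

lemma ell2_summable_Rep: "summable (\<lambda>n. (cmod (Rep_ell2 f n))\<^sup>2)"
  using Rep_ell2[of f] by simp

lemma ell2_summable_Rep_prod: "summable (\<lambda>n. Rep_ell2 f n * cnj (Rep_ell2 g n))"
  by (intro ell2_summable_prod ell2_summable_Rep)

lemma ell2_inner_self: "f \<bullet> f = (\<Sum>n. (cmod (Rep_ell2 f n))\<^sup>2)" for f :: ell2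
proof -
  have "(\<Sum>n. Rep_ell2 f n * cnj (Rep_ell2 f n)) = (\<Sum>n. complex_of_real ((cmod (Rep_ell2 f n))\<^sup>2))"
    by (simp only: complex_norm_square)
  also have "\<dots> = complex_of_real (\<Sum>n. (cmod (Rep_ell2 f n))\<^sup>2)"
    by (rule suminf_of_real[symmetric, OF ell2_summable_Rep])
  finally show ?thesis by (simp add: inner_ell2_def)
qed

instance
proof
  fix x y z :: ell2 and r :: real
  show "dist x y = norm (x - y)" by (rule dist_ell2_def)
  show "sgn x = x /\<^sub>R norm x" by (rule sgn_ell2_def)
  show "uniformity = (INF e\<in>{0<..}. principal {(x, y :: ell2). dist x y < e})"
    by (rule uniformity_ell2_def)
  show "open U \<longleftrightarrow> (\<forall>x\<in>U. \<forall>\<^sub>F (x', y) in uniformity. x' = x \<longrightarrow> y \<in> U)" for U :: "ell2 set"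
    by (rule open_ell2_def)
  show "x \<bullet> y = y \<bullet> x"
  proof -
    have "(\<Sum>n. Rep_ell2 x n * cnj (Rep_ell2 y n)) = (\<Sum>n. cnj (Rep_ell2 y n * cnj (Rep_ell2 x n)))"
      by (simp add: mult.commute)
    also have "\<dots> = cnj (\<Sum>n. Rep_ell2 y n * cnj (Rep_ell2 x n))"
      using sums_cnj[of "\<lambda>n. Rep_ell2 y n * cnj (Rep_ell2 x n)"] ell2_summable_Rep_prod[of y x]
      by (metis sums_unique summable_sums)
    finally show ?thesis by (simp add: inner_ell2_def)
  qed
  show "(x + y) \<bullet> z = x \<bullet> z + y \<bullet> z"
    unfolding inner_ell2_def plus_ell2.rep_eq distrib_right
      suminf_add[OF ell2_summable_Rep_prod[of x z] ell2_summable_Rep_prod[of y z], symmetric]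
    by simp
  show "r *\<^sub>R x \<bullet> y = r * (x \<bullet> y)"
    using suminf_mult[OF ell2_summable_Rep_prod[of x y], of "complex_of_real r"]
    by (simp add: inner_ell2_def scaleR_ell2.rep_eq mult.assoc)
  show "0 \<le> x \<bullet> x"
    by (simp add: ell2_inner_self suminf_nonneg ell2_summable_Rep)
  show "x \<bullet> x = 0 \<longleftrightarrow> x = 0"
    using suminf_eq_zero_iff[OF ell2_summable_Rep[of x]]
    by (simp add: ell2_inner_self Rep_ell2_inject[symmetric] zero_ell2.rep_eq fun_eq_iff)
  show "norm x = sqrt (x \<bullet> x)" by (rule norm_ell2_def)
qed

end

lemma ell2_norm_sq: "(norm f)\<^sup>2 = (\<Sum>n. (cmod (Rep_ell2 f n))\<^sup>2)" for f :: ell2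
  by (metis ell2_inner_self power2_norm_eq_inner)

lemma ell2_partial_le: "(\<Sum>n<k. (cmod (Rep_ell2 f n))\<^sup>2) \<le> (norm f)\<^sup>2"
  unfolding ell2_norm_sq by (rule sum_le_suminf[OF ell2_summable_Rep]) auto

lemma ell2_coord_le: "cmod (Rep_ell2 f n) \<le> norm f"
proof -
  have "(cmod (Rep_ell2 f n))\<^sup>2 \<le> (\<Sum>i<Suc n. (cmod (Rep_ell2 f i))\<^sup>2)"
    by (simp add: sum_nonneg)
  also have "\<dots> \<le> (norm f)\<^sup>2" by (rule ell2_partial_le)
  finally show ?thesis by (rule power2_le_imp_le) simp
qed

instance ell2 :: complete_space
proof
  fix X :: "nat \<Rightarrow> ell2"
  assume X: "Cauchy X"
  have "Cauchy (\<lambda>m. Rep_ell2 (X m) n)" for n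
  proof (rule CauchyI)
    fix e :: real assume "0 < e"
    then obtain M where M: "\<forall>m\<ge>M. \<forall>k\<ge>M. norm (X m - X k) < e" using CauchyD[OF X] by blast
    have "norm (Rep_ell2 (X m) n - Rep_ell2 (X k) n) \<le> norm (X m - X k)" for m k
      using ell2_coord_le[of "X m - X k" n] by (simp add: minus_ell2.rep_eq)
    then show "\<exists>M. \<forall>m\<ge>M. \<forall>k\<ge>M. norm (Rep_ell2 (X m) n - Rep_ell2 (X k) n) < e"
      using M by (meson le_less_trans)
  qed
  then have "\<exists>l. (\<lambda>m. Rep_ell2 (X m) n) \<longlonglongrightarrow> l" for n
    using Cauchy_convergent unfolding convergent_def by blast
  then obtain f where f: "\<And>n. (\<lambda>m. Rep_ell2 (X m) n) \<longlonglongrightarrow> f n" by metis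
  have partial: "\<exists>M. \<forall>m\<ge>M. \<forall>K. (\<Sum>n<K. (cmod (Rep_ell2 (X m) n - f n))\<^sup>2) \<le> e\<^sup>2" if e: "0 < e" for e
  proof -
    obtain M where M: "\<forall>m\<ge>M. \<forall>k\<ge>M. norm (X m - X k) < e" using CauchyD[OF X e] by blast
    have "(\<Sum>n<K. (cmod (Rep_ell2 (X m) n - f n))\<^sup>2) \<le> e\<^sup>2" if "M \<le> m" for m K
    proof (rule LIMSEQ_le_const2)
      show "(\<lambda>k. \<Sum>n<K. (cmod (Rep_ell2 (X m) n - Rep_ell2 (X k) n))\<^sup>2)
              \<longlonglongrightarrow> (\<Sum>n<K. (cmod (Rep_ell2 (X m) n - f n))\<^sup>2)"
        by (intro tendsto_intros f)
      have "(\<Sum>n<K. (cmod (Rep_ell2 (X m) n - Rep_ell2 (X k) n))\<^sup>2) \<le> e\<^sup>2" if "M \<le> k" for k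
      proof -
        have "(\<Sum>n<K. (cmod (Rep_ell2 (X m) n - Rep_ell2 (X k) n))\<^sup>2) \<le> (norm (X m - X k))\<^sup>2"
          using ell2_partial_le[of "X m - X k" K] by (simp add: minus_ell2.rep_eq)
        also have "\<dots> \<le> e\<^sup>2"
          using M \<open>M \<le> m\<close> that by (intro power_mono) (auto simp: less_imp_le)
        finally show ?thesis .
      qed
      then show "\<exists>N. \<forall>k\<ge>N. (\<Sum>n<K. (cmod (Rep_ell2 (X m) n - Rep_ell2 (X k) n))\<^sup>2) \<le> e\<^sup>2"
        by blast
    qed
    then show ?thesis by blast
  qed
  obtain M1 where M1: "\<And>K. (\<Sum>n<K. (cmod (Rep_ell2 (X M1) n - f n))\<^sup>2) \<le> 1\<^sup>2"
    using partial[of 1] by auto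
  have "summable (\<lambda>n. (cmod (Rep_ell2 (X M1) n - f n))\<^sup>2)"
    by (rule summableI_nonneg_bounded[OF _ M1]) simp
  then have "summable (\<lambda>n. (cmod (f n - Rep_ell2 (X M1) n))\<^sup>2)" by (simp add: norm_minus_commute)
  from ell2_summable_add[OF this ell2_summable_Rep[of "X M1"]]
  have sf: "summable (\<lambda>n. (cmod (f n))\<^sup>2)" by simp
  define F where "F = Abs_ell2 f"
  have RF: "Rep_ell2 F = f" unfolding F_def using sf by (simp add: Abs_ell2_inverse)
  have "X \<longlonglongrightarrow> F"
  proof (rule LIMSEQ_I)
    fix r :: real assume "0 < r"
    then obtain M where M: "\<And>m K. M \<le> m \<Longrightarrow> (\<Sum>n<K. (cmod (Rep_ell2 (X m) n - f n))\<^sup>2) \<le> (r/2)\<^sup>2"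
      using partial[of "r/2"] by auto
    have "norm (X m - F) < r" if "M \<le> m" for m
    proof -
      have "(norm (X m - F))\<^sup>2 \<le> (r/2)\<^sup>2"
        unfolding ell2_norm_sq
        by (rule suminf_le_const[OF ell2_summable_Rep]) (use M[OF that] in \<open>simp add: minus_ell2.rep_eq RF\<close>)
      then have "norm (X m - F) \<le> r/2" by (rule power2_le_imp_le) (use \<open>0 < r\<close> in simp)
      then show ?thesis using \<open>0 < r\<close> by simp
    qed
    then show "\<exists>M. \<forall>m\<ge>M. norm (X m - F) < r" by blast
  qed
  then show "convergent X" by (rule convergentI)
qed

instantiation ell2 :: complex_hilbert
begin

lift_definition scaleC_ell2 :: "complex \<Rightarrow> ell2 \<Rightarrow> ell2" is "\<lambda>a f n. a * f n"
  by (rule ell2_summable_scale)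
definition cinner_ell2 :: "ell2 \<Rightarrow> ell2 \<Rightarrow> complex" where
  "cinner_ell2 f g = (\<Sum>n. Rep_ell2 f n * cnj (Rep_ell2 g n))"

instance
proof
  fix x y z :: ell2 and a b :: complex and r :: real
  show "a *\<^sub>C (x + y) = a *\<^sub>C x + a *\<^sub>C y" by transfer (simp add: algebra_simps)
  show "(a + b) *\<^sub>C x = a *\<^sub>C x + b *\<^sub>C x" by transfer (simp add: algebra_simps)
  show "a *\<^sub>C (b *\<^sub>C x) = (a * b) *\<^sub>C x" by transfer (simp add: algebra_simps)
  show "r *\<^sub>R x = complex_of_real r *\<^sub>C x" by transfer simp
  show "cinner (x + y) z = cinner x z + cinner y z"
    unfolding cinner_ell2_def plus_ell2.rep_eq distrib_right
    by (rule suminf_add[OF ell2_summable_Rep_prod ell2_summable_Rep_prod, symmetric])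
  show "cinner (a *\<^sub>C x) y = a * cinner x y"
    using suminf_mult[OF ell2_summable_Rep_prod[of x y], of a]
    by (simp add: cinner_ell2_def scaleC_ell2.rep_eq mult.assoc)
  show "cinner x y = cnj (cinner y x)"
  proof -
    have "(\<Sum>n. Rep_ell2 x n * cnj (Rep_ell2 y n)) = (\<Sum>n. cnj (Rep_ell2 y n * cnj (Rep_ell2 x n)))"
      by (simp add: mult.commute)
    also have "\<dots> = cnj (\<Sum>n. Rep_ell2 y n * cnj (Rep_ell2 x n))"
      using sums_cnj[of "\<lambda>n. Rep_ell2 y n * cnj (Rep_ell2 x n)"] ell2_summable_Rep_prod[of y x]
      by (metis sums_unique summable_sums)
    finally show ?thesis by (simp add: cinner_ell2_def)
  qed
  show "x \<bullet> y = Re (cinner x y)" by (simp add: inner_ell2_def cinner_ell2_def)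
qed

end

section \<open>Bounded operators between closed subspaces\<close>

text \<open>The Moebius parameter acts between the defect subspaces of \<open>\<Theta> 0\<close>, which depend on a term,
  so operators are HOL functions relative to carriers: \<open>A \<in> bounded_ops U V\<close> constrains \<open>A\<close> on \<open>U\<close>
  only, and every notion below ignores the values of \<open>A\<close> outside \<open>U\<close>. The adjoint \<open>adj U A\<close> of
  such an \<open>A\<close> is an operator from \<open>V\<close> to \<open>U\<close>; its values on \<open>V\<close> do not depend on \<open>V\<close>.\<close>

definition bounded_ops ::
    "'a::complex_hilbert set \<Rightarrow> 'b::complex_hilbert set \<Rightarrow> ('a \<Rightarrow> 'b) set" where
  "bounded_ops U V = {A. (\<forall>x\<in>U. A x \<in> V) \<and> (\<forall>x\<in>U. \<forall>y\<in>U. A (x + y) = A x + A y) \<and>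
               (\<forall>c. \<forall>x\<in>U. A (c *\<^sub>C x) = c *\<^sub>C A x) \<and> (\<exists>K. \<forall>x\<in>U. norm (A x) \<le> K * norm x)}"

definition op_norm :: "'a::complex_hilbert set \<Rightarrow> ('a \<Rightarrow> 'b::complex_hilbert) \<Rightarrow> real" where
  "op_norm U A = (SUP x\<in>U. norm (A x) / norm x)"

definition adj ::
    "'a::complex_hilbert set \<Rightarrow> ('a \<Rightarrow> 'b::complex_hilbert) \<Rightarrow> 'b \<Rightarrow> 'a" where
  "adj U A y = (THE x. x \<in> U \<and> (\<forall>u\<in>U. cinner (A u) y = cinner u x))"

definition op_le :: "'a::complex_hilbert set \<Rightarrow> ('a \<Rightarrow> 'a) \<Rightarrow> ('a \<Rightarrow> 'a) \<Rightarrow> bool" where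
  "op_le U A B \<longleftrightarrow> (\<forall>x\<in>U. cinner (B x - A x) x \<in> \<real>\<^sub>\<ge>\<^sub>0)"

definition op_sqrt :: "('a::complex_hilbert \<Rightarrow> 'a) \<Rightarrow> 'a \<Rightarrow> 'a" where
  "op_sqrt B = (THE C. C \<in> bounded_ops UNIV UNIV \<and> op_le UNIV (\<lambda>_. 0) C \<and> (\<forall>x. C (C x) = B x))"

definition defect_op :: "('a::complex_hilbert \<Rightarrow> 'b::complex_hilbert) \<Rightarrow> 'a \<Rightarrow> 'a" where
  "defect_op T = op_sqrt (\<lambda>x. x - adj UNIV T (T x))"

definition defect_space :: "('a::complex_hilbert \<Rightarrow> 'b::complex_hilbert) \<Rightarrow> 'a set" where
  "defect_space T = closure (range (defect_op T))"

section \<open>Schur class, Moebius parameter\<close>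

abbreviation unit_disk :: "complex set" where "unit_disk \<equiv> ball 0 1"

definition op_holomorphic ::
    "'a::complex_hilbert set \<Rightarrow> 'b::complex_hilbert set \<Rightarrow> (complex \<Rightarrow> 'a \<Rightarrow> 'b) \<Rightarrow> bool" where
  "op_holomorphic U V F \<longleftrightarrow>
     (\<forall>z\<in>unit_disk. F z \<in> bounded_ops U V) \<and>
     (\<forall>z\<in>unit_disk. \<exists>A\<in>bounded_ops U V.
        ((\<lambda>w. op_norm U (\<lambda>x. inverse (w - z) *\<^sub>C (F w x - F z x) - A x)) \<longlongrightarrow> 0) (at z))"

definition schur_class ::
    "'a::complex_hilbert set \<Rightarrow> 'b::complex_hilbert set \<Rightarrow> (complex \<Rightarrow> 'a \<Rightarrow> 'b) set" where
  "schur_class U V =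
     {F. op_holomorphic U V F \<and> (\<forall>z\<in>unit_disk. \<forall>x\<in>U. norm (F z x) \<le> norm x)}"

definition moebius_parameter ::
    "(complex \<Rightarrow> 'm::complex_hilbert \<Rightarrow> 'n::complex_hilbert) \<Rightarrow> (complex \<Rightarrow> 'm \<Rightarrow> 'n) \<Rightarrow> bool" where
  "moebius_parameter \<Theta> Z \<longleftrightarrow>
     (let T = \<Theta> 0; T' = adj UNIV T; U = defect_space T; V = defect_space T' in
       Z \<in> schur_class U V \<and>
       (\<forall>z\<in>unit_disk. bij_betw (\<lambda>u. u + T' (Z z u)) U U \<and>
          (\<forall>x. \<Theta> z x =
             T x + defect_op T' (Z z (inv_into U (\<lambda>u. u + T' (Z z u)) (defect_op T x))))))"

section \<open>Outer and co-outer functions\<close>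

definition circle_mean :: "(complex \<Rightarrow> 'a::complex_hilbert) \<Rightarrow> real \<Rightarrow> real" where
  "circle_mean f r = integral {0..2*pi} (\<lambda>t. (norm (f (of_real r * cis t)))\<^sup>2) / (2*pi)"

definition hardy2 :: "'a::complex_hilbert set \<Rightarrow> (complex \<Rightarrow> 'a) set" where
  "hardy2 U =
     {f. (\<forall>z\<in>unit_disk. f z \<in> U) \<and>
         (\<forall>z\<in>unit_disk. \<exists>f'. (f has_derivative (\<lambda>h. h *\<^sub>C f')) (at z)) \<and>
         bdd_above (circle_mean f ` {0..<1})}"

definition hardy2_norm :: "(complex \<Rightarrow> 'a::complex_hilbert) \<Rightarrow> real" where
  "hardy2_norm f = sqrt (SUP r\<in>{0..<1}. circle_mean f r)"

text \<open>\<open>F\<close> is outer if \<open>F H\<^sup>2(U)\<close> is dense in \<open>H\<^sup>2(V)\<close>, and co-outer if \<open>z \<mapsto> F(cnj z)\<^sup>*\<close> is outer.\<close>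

definition outer ::
    "'a::complex_hilbert set \<Rightarrow> 'b::complex_hilbert set \<Rightarrow> (complex \<Rightarrow> 'a \<Rightarrow> 'b) \<Rightarrow> bool" where
  "outer U V F \<longleftrightarrow>
     (\<forall>g\<in>hardy2 V. \<forall>e>0. \<exists>f\<in>hardy2 U. hardy2_norm (\<lambda>z. g z - F z (f z)) < e)"

definition co_outer ::
    "'a::complex_hilbert set \<Rightarrow> 'b::complex_hilbert set \<Rightarrow> (complex \<Rightarrow> 'a \<Rightarrow> 'b) \<Rightarrow> bool" where
  "co_outer U V F \<longleftrightarrow> outer V U (\<lambda>z. adj U (F (cnj z)))"

section \<open>Boundary values\<close>

definition stolz_region :: "real \<Rightarrow> complex \<Rightarrow> complex set" where
  "stolz_region a \<xi> = {z \<in> unit_disk. dist z \<xi> < a * (1 - norm z)}"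

definition has_nt_limit :: "(complex \<Rightarrow> 'a::complex_hilbert) \<Rightarrow> complex \<Rightarrow> 'a \<Rightarrow> bool" where
  "has_nt_limit f \<xi> l \<longleftrightarrow> (\<forall>a>1. (f \<longlongrightarrow> l) (at \<xi> within stolz_region a \<xi>))"

text \<open>The strong non-tangential limit of \<open>F\<close> at \<open>\<xi>\<close>. For a Schur class function (on a separable
  space) it exists for almost every \<open>\<xi>\<close>; elsewhere the value is irrelevant, as boundary values
  occur below \<open>ae_circle\<close> only.\<close>

definition bdry :: "(complex \<Rightarrow> 'a \<Rightarrow> 'b::complex_hilbert) \<Rightarrow> complex \<Rightarrow> 'a \<Rightarrow> 'b" where
  "bdry F \<xi> x = (THE y. has_nt_limit (\<lambda>z. F z x) \<xi> y)"

definition ae_circle :: "(complex \<Rightarrow> bool) \<Rightarrow> bool" where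
  "ae_circle P \<longleftrightarrow> (AE t in lebesgue_on {0..2*pi}. P (cis t))"

section \<open>Defect functions\<close>

definition gram ::
    "'a::complex_hilbert set \<Rightarrow> (complex \<Rightarrow> 'a \<Rightarrow> 'b::complex_hilbert) \<Rightarrow> complex \<Rightarrow> 'a \<Rightarrow> 'a" where
  "gram U F \<xi> x = adj U (bdry F \<xi>) (bdry F \<xi> x)"

definition cogram ::
    "'a::complex_hilbert set \<Rightarrow> (complex \<Rightarrow> 'a \<Rightarrow> 'b::complex_hilbert) \<Rightarrow> complex \<Rightarrow> 'b \<Rightarrow> 'b" where
  "cogram U F \<xi> y = bdry F \<xi> (adj U (bdry F \<xi>) y)"

text \<open>\<open>right_defect_function U F K \<phi>\<close>: \<open>\<phi> \<in> S(U, K)\<close> is the function \<open>\<phi>\<^sub>F\<close> of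
  \<open>F \<in> S(U, V)\<close> (whatever \<open>V\<close> is);
  \<open>left_defect_function U V F K \<psi>\<close>: \<open>\<psi> \<in> S(K, V)\<close> is the function \<open>\<psi>\<^sub>F\<close>. They are determined
  only up to a constant unitary factor, hence predicates; the auxiliary space \<open>K\<close> is part of
  the data.\<close>

definition right_defect_function ::
    "'a::complex_hilbert set \<Rightarrow> (complex \<Rightarrow> 'a \<Rightarrow> 'b::complex_hilbert) \<Rightarrow>
     'k::complex_hilbert set \<Rightarrow> (complex \<Rightarrow> 'a \<Rightarrow> 'k) \<Rightarrow> bool" where
  "right_defect_function U F K \<phi> \<longleftrightarrow>
     closed_csubspace K \<and> \<phi> \<in> schur_class U K \<and> outer U K \<phi> \<and>
     ae_circle (\<lambda>\<xi>. op_le U (gram U \<phi> \<xi>) (\<lambda>x. x - gram U F \<xi> x)) \<and>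
     (\<forall>(K' :: ell2 set) \<phi>'. closed_csubspace K' \<and> \<phi>' \<in> schur_class U K' \<and>
        ae_circle (\<lambda>\<xi>. op_le U (gram U \<phi>' \<xi>) (\<lambda>x. x - gram U F \<xi> x)) \<longrightarrow>
        ae_circle (\<lambda>\<xi>. op_le U (gram U \<phi>' \<xi>) (gram U \<phi> \<xi>)))"

definition left_defect_function ::
    "'a::complex_hilbert set \<Rightarrow> 'b::complex_hilbert set \<Rightarrow> (complex \<Rightarrow> 'a \<Rightarrow> 'b) \<Rightarrow>
     'k::complex_hilbert set \<Rightarrow> (complex \<Rightarrow> 'k \<Rightarrow> 'b) \<Rightarrow> bool" where
  "left_defect_function U V F K \<psi> \<longleftrightarrow>
     closed_csubspace K \<and> \<psi> \<in> schur_class K V \<and> co_outer K V \<psi> \<and>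
     ae_circle (\<lambda>\<xi>. op_le V (cogram K \<psi> \<xi>) (\<lambda>y. y - cogram U F \<xi> y)) \<and>
     (\<forall>(K' :: ell2 set) \<psi>'. closed_csubspace K' \<and> \<psi>' \<in> schur_class K' V \<and>
        ae_circle (\<lambda>\<xi>. op_le V (cogram K' \<psi>' \<xi>) (\<lambda>y. y - cogram U F \<xi> y)) \<longrightarrow>
        ae_circle (\<lambda>\<xi>. op_le V (cogram K' \<psi>' \<xi>) (cogram K \<psi> \<xi>)))"

end

(* If [Theta; phi] is contractive then for every functional k so is [Theta; <phi(.), k>], so a
   defect function vanishes iff no nonzero scalar row p satisfies |p x|^2 + |Theta x|^2 <= |x|^2. By
   Fatou's theorem and the Poisson integral this inequality may be read inside the disk instead of on
   the circle. There, with T = Theta(0) and u = (I + T* Z(z))^{-1} D_T x, the Moebius formula gives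
   |x|^2 - |Theta(z) x|^2 = |u|^2 - |Z(z) u|^2, so rows for Z and rows for Theta correspond through
   x = D_T^{-1} (I + T* Z(z)) u; the inverse of D_T is harmless because p(z) x is bounded by
   |D_T x| / (1 - |z|) and hence factors through D_T. The left defect functions are treated by passing
   to the adjoints Theta(cnj z)* and Z(cnj z)*. *)

theory Submission
  imports Defs "HOL-Complex_Analysis.Complex_Analysis"
begin

section \<open>Complex inner products, closed subspaces, and factorization of bounded
  functionals\<close>

section \<open>Complex Hilbert spaces\<close>

text \<open>The transfer has to take place inside the disk: on the circle \<open>Z\<close> may have
  norm one, and \<open>I + T* Z\<close> need not be invertible there. Inside,
  \<open>Z(0) = 0\<close> (evaluate the Moebius formula at 0 and use that the defect operator of
  \<open>T*\<close> is injective on its defect space), so the Schwarz lemma bounds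
  \<open>Z(z)\<close> by |z| and \<open>I + T* Z(z)\<close> from below by 1 - |z|; every factor 1/(1
  - |z|) comes from this. Scalar rows also settle a formal obstacle: competitors take values in
  subspaces of \<open>ell2\<close>, while the auxiliary spaces of the defect functions lie in
  arbitrary types, and a row is embedded in \<open>ell2\<close> along one basis vector. Those types
  carry no countability, yet strong boundary values are built on a countable dense subset of the
  domain; on the left, where the auxiliary space is the domain, co-outerness provides one. Adjoints
  of strong limits need not be strong limits of adjoints, so left inequalities are rewritten for the
  row operator \<open>(u, k)\<close> to \<open>F u + G k\<close>. Fatou's theorem comes from a weak
  type bound for the nontangential maximal function of Taylor remainders.\<close>

instance complex_hilbert \<subseteq> banach ..

lemma cinner_add_right: "cinner x (y + z) = cinner x y + cinner x z"
  by (metis cinner_add_left cinner_commute complex_cnj_add)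

lemma cinner_scaleC_right: "cinner x (a *\<^sub>C y) = cnj a * cinner x y"
  by (metis cinner_commute cinner_scaleC_left complex_cnj_mult)

lemma scaleC_one [simp]: "1 *\<^sub>C x = x"
  using scaleR_scaleC[of 1 x] by simp

lemma scaleC_minus_one: "(-1) *\<^sub>C x = - x"
  using scaleR_scaleC[of "-1" x] by simp

lemma scaleC_zero_left [simp]: "0 *\<^sub>C x = 0"
  using scaleR_scaleC[of 0 x] by simp

lemma scaleC_zero_right [simp]: "a *\<^sub>C 0 = 0"
  using scaleC_add_right[of a 0 0] by simp

lemma scaleC_minus_right: "a *\<^sub>C (- x) = - (a *\<^sub>C x)"
  by (metis mult.commute scaleC_minus_one scaleC_scaleC)

lemma scaleC_diff_right: "a *\<^sub>C (x - y) = a *\<^sub>C x - a *\<^sub>C y"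
  by (simp add: diff_conv_add_uminus scaleC_add_right scaleC_minus_right del: add_uminus_conv_diff)

lemma cinner_zero_left [simp]: "cinner 0 y = 0"
  using cinner_add_left[of 0 0 y] by simp

lemma cinner_zero_right [simp]: "cinner x 0 = 0"
  using cinner_add_right[of x 0 0] by simp

lemma cinner_minus_left: "cinner (- x) y = - cinner x y"
  by (metis cinner_scaleC_left mult_minus1 scaleC_minus_one)

lemma cinner_minus_right: "cinner x (- y) = - cinner x y"
  by (metis cinner_commute cinner_minus_left complex_cnj_minus)

lemma cinner_diff_left: "cinner (x - y) z = cinner x z - cinner y z"
  by (simp add: diff_conv_add_uminus cinner_add_left cinner_minus_left del: add_uminus_conv_diff)

lemma cinner_diff_right: "cinner x (y - z) = cinner x y - cinner x z"
  by (simp add: diff_conv_add_uminus cinner_add_right cinner_minus_right del: add_uminus_conv_diff)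

lemma cinner_sum_left: "cinner (\<Sum>i\<in>I. f i) y = (\<Sum>i\<in>I. cinner (f i) y)"
  by (induction I rule: infinite_finite_induct) (auto simp: cinner_add_left)

lemma cinner_sum_right: "cinner x (\<Sum>i\<in>I. f i) = (\<Sum>i\<in>I. cinner x (f i))"
  by (induction I rule: infinite_finite_induct) (auto simp: cinner_add_right)

lemma cinner_self: "cinner x x = complex_of_real ((norm x)\<^sup>2)"
proof -
  have "Im (cinner x x) = 0"
    using cinner_commute[of x x] by (metis complex_cnj_cancel_iff Reals_cnj_iff complex_is_Real_iff)
  moreover have "Re (cinner x x) = (norm x)\<^sup>2"
    by (simp add: inner_eq_Re_cinner[symmetric] power2_norm_eq_inner)
  ultimately show ?thesis by (simp add: complex_eq_iff)
qed

lemma norm_scaleC: "norm (a *\<^sub>C x) = cmod a * norm x"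
proof -
  have "complex_of_real ((norm (a *\<^sub>C x))\<^sup>2) = a * cnj a * complex_of_real ((norm x)\<^sup>2)"
    by (simp only: cinner_self[symmetric] cinner_scaleC_left cinner_scaleC_right mult.assoc)
      (simp only: mult.commute mult.left_commute)
  also have "\<dots> = complex_of_real ((cmod a * norm x)\<^sup>2)"
    by (simp only: complex_norm_square[symmetric] power_mult_distrib of_real_mult)
  finally have "(norm (a *\<^sub>C x))\<^sup>2 = (cmod a * norm x)\<^sup>2"
    using of_real_eq_iff by blast
  then show ?thesis by (simp add: power2_eq_iff_nonneg)
qed

lemma cinner_cauchy_schwarz: "cmod (cinner x y) \<le> norm x * norm y"
proof (cases "cinner x y = 0")
  case False
  \<comment> \<open>The unimodular factor \<open>a\<close> rotates \<open>x\<close> until the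
    pairing with \<open>y\<close> is real and nonnegative, so that the real Cauchy-Schwarz
    inequality applies without loss.\<close>
  define a where "a = cnj (cinner x y) / cmod (cinner x y)"
  have a: "cmod a = 1" using False by (simp add: a_def norm_divide)
  have "a * cinner x y = complex_of_real ((cmod (cinner x y))\<^sup>2 / cmod (cinner x y))"
    unfolding a_def of_real_divide complex_norm_square by (simp add: mult.commute)
  then have "a * cinner x y = complex_of_real (cmod (cinner x y))"
    by (simp add: power2_eq_square)
  then have "cmod (cinner x y) = (a *\<^sub>C x) \<bullet> y"
    by (simp add: inner_eq_Re_cinner cinner_scaleC_left)
  also have "\<dots> \<le> norm (a *\<^sub>C x) * norm y" by (rule norm_cauchy_schwarz)
  finally show ?thesis by (simp add: norm_scaleC a)
qed simp

lemma bounded_bilinear_cinner: "bounded_bilinear (cinner :: 'a::complex_hilbert \<Rightarrow> 'a \<Rightarrow> complex)"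
proof
  fix x y :: 'a and r :: real
  show "cinner (r *\<^sub>R x) y = r *\<^sub>R cinner x y"
    by (simp add: scaleR_scaleC cinner_scaleC_left scaleR_conv_of_real)
  show "cinner x (r *\<^sub>R y) = r *\<^sub>R cinner x y"
    by (simp add: scaleR_scaleC cinner_scaleC_right scaleR_conv_of_real)
  show "\<exists>K. \<forall>a b::'a. cmod (cinner a b) \<le> norm a * norm b * K"
    using cinner_cauchy_schwarz by (metis mult.right_neutral)
qed (auto simp: cinner_add_left cinner_add_right)

lemma bounded_bilinear_scaleC:
  "bounded_bilinear (scaleC :: complex \<Rightarrow> 'a::complex_hilbert \<Rightarrow> 'a)"
proof
  fix a :: complex and x y :: 'a and r :: real
  show "(r *\<^sub>R a) *\<^sub>C x = r *\<^sub>R (a *\<^sub>C x)"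
    by (simp add: scaleR_scaleC scaleC_scaleC scaleR_conv_of_real)
  show "a *\<^sub>C (r *\<^sub>R x) = r *\<^sub>R (a *\<^sub>C x)"
    by (simp add: scaleR_scaleC scaleC_scaleC mult.commute)
  show "\<exists>K. \<forall>a (b::'a). norm (a *\<^sub>C b) \<le> norm a * norm b * K"
    using norm_scaleC by (metis mult.right_neutral order_refl)
qed (auto simp: scaleC_add_left scaleC_add_right)

lemmas tendsto_cinner [tendsto_intros] = bounded_bilinear.tendsto[OF bounded_bilinear_cinner]
lemmas tendsto_scaleC [tendsto_intros] = bounded_bilinear.tendsto[OF bounded_bilinear_scaleC]
lemmas continuous_on_cinner [continuous_intros] =
  bounded_bilinear.continuous_on[OF bounded_bilinear_cinner]
lemmas continuous_on_scaleC [continuous_intros] =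
  bounded_bilinear.continuous_on[OF bounded_bilinear_scaleC]

lemma cinner_eqI:
  assumes "closed_csubspace V" "x \<in> V" "y \<in> V" "\<And>v. v \<in> V \<Longrightarrow> cinner v x = cinner v y"
  shows "x = y"
proof -
  have "x - y \<in> V"
    using assms(1-3) scaleC_minus_one[of y] unfolding closed_csubspace_def
    by (metis diff_conv_add_uminus)
  then have "cinner (x - y) (x - y) = 0"
    using assms(4) by (simp add: cinner_diff_right)
  then show ?thesis by (simp add: cinner_self)
qed

text \<open>The choice \<open>y = x\<close> suffices. Through this duality, estimates for scalar
  holomorphic functions that are uniform in \<open>y\<close> become norm estimates.\<close>

lemma norm_le_of_cinner:
  assumes "\<And>y. cmod (cinner x y) \<le> c * norm y" "0 \<le> c"
  shows "norm x \<le> c"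
proof (cases "x = 0")
  case False
  have "(norm x)\<^sup>2 \<le> c * norm x"
    using assms(1)[of x] by (simp add: cinner_self norm_power)
  then show ?thesis using False by (simp add: power2_eq_square)
qed (use assms in simp)

lemma norm_plus_sq: "(norm (x + y))\<^sup>2 = (norm x)\<^sup>2 + 2 * Re (cinner x y) + (norm y)\<^sup>2"
  for x y :: "'a::complex_hilbert"
  by (simp add: power2_norm_eq_inner inner_add_left inner_add_right inner_commute
      inner_eq_Re_cinner[symmetric])

subsection \<open>Closed subspaces\<close>

lemma csubspaceD:
  assumes "closed_csubspace U"
  shows csubspace_zero: "0 \<in> U"
    and csubspace_add: "x \<in> U \<Longrightarrow> y \<in> U \<Longrightarrow> x + y \<in> U"
    and csubspace_scaleC: "x \<in> U \<Longrightarrow> a *\<^sub>C x \<in> U"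
    and csubspace_closed: "closed U"
  using assms unfolding closed_csubspace_def by auto

lemma csubspace_minus: "closed_csubspace U \<Longrightarrow> x \<in> U \<Longrightarrow> - x \<in> U"
  using csubspace_scaleC[of U x "-1"] by (simp add: scaleC_minus_one)

lemma csubspace_diff: "closed_csubspace U \<Longrightarrow> x \<in> U \<Longrightarrow> y \<in> U \<Longrightarrow> x - y \<in> U"
  using csubspace_add[of U x "-y"] csubspace_minus[of U y] by simp

lemma closed_csubspace_UNIV [simp]: "closed_csubspace UNIV"
  by (simp add: closed_csubspace_def)

lemma csubspace_lim:
  assumes "closed_csubspace U" "(f \<longlongrightarrow> l) F" "F \<noteq> bot" "\<forall>\<^sub>F x in F. f x \<in> U"
  shows "l \<in> U"
  using Lim_in_closed_set[OF csubspace_closed[OF assms(1)] assms(4,3,2)] .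

text \<open>The point \<open>w\<close> is the limit of \<open>D x\<^sub>n\<close> along a minimizing sequence \<open>x\<^sub>n\<close> of
  \<open>\<parallel>D x\<parallel>\<^sup>2 - 2 Re (p x)\<close>. For \<open>D\<close> the identity this is the Riesz representation theorem; in general
  it is Douglas' factorization of a functional through \<open>D\<close>.\<close>

lemma functional_factorization:
  fixes X :: "'a::complex_hilbert set" and D :: "'a \<Rightarrow> 'b::complex_hilbert"
    and p :: "'a \<Rightarrow> complex"
  assumes X: "0 \<in> X" "\<And>x y. x \<in> X \<Longrightarrow> y \<in> X \<Longrightarrow> x + y \<in> X" "\<And>a x. x \<in> X \<Longrightarrow> a *\<^sub>C x \<in> X"
    and D: "\<And>x y. x \<in> X \<Longrightarrow> y \<in> X \<Longrightarrow> D (x + y) = D x + D y"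
      "\<And>a x. x \<in> X \<Longrightarrow> D (a *\<^sub>C x) = a *\<^sub>C D x"
    and p: "\<And>x y. x \<in> X \<Longrightarrow> y \<in> X \<Longrightarrow> p (x + y) = p x + p y"
      "\<And>a x. x \<in> X \<Longrightarrow> p (a *\<^sub>C x) = a * p x"
    and C: "\<And>x. x \<in> X \<Longrightarrow> cmod (p x) \<le> C * norm (D x)"
  obtains w where "w \<in> closure (D ` X)" "\<And>x. x \<in> X \<Longrightarrow> p x = cinner (D x) w"
proof -
  define J where "J x = (norm (D x))\<^sup>2 - 2 * Re (p x)" for x
  \<comment> \<open>Completing the square: \<open>(norm (D x) - C)\<^sup>2\<close> is
    nonnegative.\<close>
  have low: "- C\<^sup>2 \<le> J x" if "x \<in> X" for x
  proof -
    have "Re (p x) \<le> C * norm (D x)" using C[OF that] complex_Re_le_cmod order_trans by blast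
    moreover have "0 \<le> (norm (D x) - C)\<^sup>2" by simp
    ultimately show ?thesis unfolding J_def by (simp add: power2_diff algebra_simps)
  qed
  define I where "I = (INF x\<in>X. J x)"
  have bdd: "bdd_below (J ` X)" by (rule bdd_belowI2) (rule low)
  have IJ: "I \<le> J x" if "x \<in> X" for x unfolding I_def by (rule cINF_lower[OF bdd that])
  have "\<exists>x\<in>X. J x < I + e" if "e > 0" for e
  proof (rule ccontr)
    assume "\<not> ?thesis"
    then have "I + e \<le> I" unfolding I_def
      by (intro cINF_greatest) (use X(1) in \<open>auto simp: I_def not_less\<close>)
    then show False using that by simp
  qed
  then have "\<forall>n. \<exists>x\<in>X. J x < I + inverse (real (Suc n))" by simp
  then obtain x where x: "\<And>n. x n \<in> X" "\<And>n. J (x n) < I + inverse (real (Suc n))" by metis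
  have neg: "- y \<in> X" "D (- y) = - D y" "p (- y) = - p y" if "y \<in> X" for y
    using X(3)[OF that, of "-1"] D(2)[OF that, of "-1"] p(2)[OF that, of "-1"]
    by (simp_all add: scaleC_minus_one)
  \<comment> \<open>Parallelogram law at the midpoint \<open>m\<close>, where
    \<open>J m \<ge> I\<close>: almost minimizers have images under \<open>D\<close> close to each
    other. Only the images converge; the points \<open>x n\<close> themselves need not.\<close>
  have par: "(norm (D u - D v))\<^sup>2 \<le> 2 * (J u - I) + 2 * (J v - I)" if "u \<in> X" "v \<in> X" for u v
  proof -
    define m where "m = (1/2) *\<^sub>C (u + v)"
    have m: "m \<in> X" unfolding m_def using X that by auto
    have h: "(1/2 :: complex) *\<^sub>C y = (1/2 :: real) *\<^sub>R y" for y :: 'b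
      using scaleR_scaleC[of "1/2" y] by simp
    have Dm: "D m = (1/2::real) *\<^sub>R (D u + D v)" unfolding m_def using that D X by (simp add: h)
    have pm: "p m = (1/2) * (p u + p v)" unfolding m_def using that p X by simp
    have "4 * (norm (D m))\<^sup>2 = (norm (D u + D v))\<^sup>2"
      unfolding Dm by (simp add: power_mult_distrib power2_eq_square)
    moreover have "(norm (D u - D v))\<^sup>2 + (norm (D u + D v))\<^sup>2 = 2 * (norm (D u))\<^sup>2 + 2 * (norm (D v))\<^sup>2"
      by (simp add: power2_norm_eq_inner algebra_simps inner_commute)
    ultimately have "(norm (D u - D v))\<^sup>2 = 2 * J u + 2 * J v - 4 * J m"
      unfolding J_def pm by (simp add: field_simps)
    then show ?thesis using IJ[OF m] by simp
  qed
  have "Cauchy (\<lambda>n. D (x n))"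
  proof (rule CauchyI)
    fix e :: real assume e: "0 < e"
    obtain N where N: "inverse (real (Suc N)) < e\<^sup>2 / 4"
      using reals_Archimedean[of "e\<^sup>2/4"] e by auto
    have "norm (D (x m) - D (x n)) < e" if "m \<ge> N" "n \<ge> N" for m n
    proof -
      have small: "J (x k) < I + e\<^sup>2 / 4" if "k \<ge> N" for k
      proof -
        have "inverse (real (Suc k)) \<le> inverse (real (Suc N))"
          using that by (intro le_imp_inverse_le) auto
        then show ?thesis using x(2)[of k] N by (meson add_left_mono le_less_trans less_le_trans less_imp_le)
      qed
      have "(norm (D (x m) - D (x n)))\<^sup>2 < e\<^sup>2"
        using par[OF x(1) x(1), of m n] small[OF that(1)] small[OF that(2)] by simp
      then show ?thesis using e by (simp add: power_less_imp_less_base)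
    qed
    then show "\<exists>M. \<forall>m\<ge>M. \<forall>n\<ge>M. norm (D (x m) - D (x n)) < e" by blast
  qed
  then obtain w where w: "(\<lambda>n. D (x n)) \<longlonglongrightarrow> w" using Cauchy_convergent convergent_def by blast
  have wc: "w \<in> closure (D ` X)" unfolding closure_sequential using w x(1)
    by (intro exI[of _ "\<lambda>n. D (x n)"]) auto
  have Jlim: "(\<lambda>n. J (x n)) \<longlonglongrightarrow> I"
  proof (rule tendsto_sandwich[of "\<lambda>_. I" _ _ "\<lambda>n. I + inverse (real (Suc n))"])
    have "(\<lambda>n. I + inverse (real (Suc n))) \<longlonglongrightarrow> I + 0"
      by (intro tendsto_intros LIMSEQ_inverse_real_of_nat)
    then show "(\<lambda>n. I + inverse (real (Suc n))) \<longlonglongrightarrow> I" by simp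
    show "\<forall>\<^sub>F n in sequentially. I \<le> J (x n)" by (intro always_eventually allI IJ x(1))
    show "\<forall>\<^sub>F n in sequentially. J (x n) \<le> I + inverse (real (Suc n))"
      by (intro always_eventually allI less_imp_le x(2))
  qed simp
  \<comment> \<open>Minimality against the perturbation of \<open>x n\<close> by \<open>s\<close>
    times \<open>h\<close>, after the limit in \<open>n\<close>. The vanishing first variation in
    \<open>s\<close> identifies the functional.\<close>
  have quad: "0 \<le> 2 * s * (Re (cinner (D h) w) - Re (p h)) + s\<^sup>2 * (norm (D h))\<^sup>2"
    if h: "h \<in> X" for h and s :: real
  proof (rule LIMSEQ_le)
    show "(\<lambda>n. I - J (x n)) \<longlonglongrightarrow> 0"
      using tendsto_diff[OF tendsto_const[of I] Jlim] by simp
    show "(\<lambda>n. 2 * s * (Re (cinner (D h) (D (x n))) - Re (p h)) + s\<^sup>2 * (norm (D h))\<^sup>2)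
       \<longlonglongrightarrow> 2 * s * (Re (cinner (D h) w) - Re (p h)) + s\<^sup>2 * (norm (D h))\<^sup>2"
      by (intro tendsto_intros w)
    have "I - J (x n) \<le> 2 * s * (Re (cinner (D h) (D (x n))) - Re (p h)) + s\<^sup>2 * (norm (D h))\<^sup>2" for n
    proof -
      have sh: "complex_of_real s *\<^sub>C h \<in> X" using X(3) h by blast
      have "I \<le> J (x n + complex_of_real s *\<^sub>C h)" using IJ X(2) x(1) sh by blast
      also have "\<dots> = (norm (D (x n) + s *\<^sub>R D h))\<^sup>2 - 2 * Re (p (x n) + s * p h)"
        unfolding J_def using D p x(1) sh h by (simp add: scaleR_scaleC)
      also have "\<dots> = J (x n) + 2 * s * (Re (cinner (D h) (D (x n))) - Re (p h)) + s\<^sup>2 * (norm (D h))\<^sup>2"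
        unfolding J_def inner_eq_Re_cinner[symmetric] power2_norm_eq_inner
        by (simp add: inner_commute algebra_simps power2_eq_square)
      finally show ?thesis by simp
    qed
    then show "\<exists>N. \<forall>n\<ge>N. I - J (x n) \<le> 2 * s * (Re (cinner (D h) (D (x n))) - Re (p h)) + s\<^sup>2 * (norm (D h))\<^sup>2"
      by blast
  qed
  have Re_eq: "Re (p h) = Re (cinner (D h) w)" if h: "h \<in> X" for h
  proof (rule ccontr)
    assume ne: "\<not> ?thesis"
    define d where "d = Re (cinner (D h) w) - Re (p h)"
    \<comment> \<open>The summand 1 keeps \<open>N\<close> positive when \<open>D h = 0\<close>; the
      choice \<open>s = - d / N\<close> then makes the quadratic negative unless
      \<open>d = 0\<close>.\<close>
    define N where "N = (norm (D h))\<^sup>2 + 1"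
    have N: "N > 0" "(norm (D h))\<^sup>2 \<le> N" unfolding N_def by (auto simp: add_nonneg_pos)
    have d: "d\<^sup>2 > 0" using ne unfolding d_def by simp
    have "0 \<le> 2 * (- d / N) * d + (- d / N)\<^sup>2 * (norm (D h))\<^sup>2"
      using quad[OF h, of "- d / N"] unfolding d_def .
    also have "\<dots> \<le> 2 * (- d / N) * d + (- d / N)\<^sup>2 * N"
      by (intro add_left_mono mult_left_mono N) simp
    also have "\<dots> = - d\<^sup>2 / N" using N by (simp add: field_simps power2_eq_square)
    finally have "d\<^sup>2 / N \<le> 0" by simp
    moreover have "d\<^sup>2 / N > 0" using d N by simp
    ultimately show False by linarith
  qed
  have "p h = cinner (D h) w" if h: "h \<in> X" for h
  proof (rule complex_eqI)
    \<comment> \<open>Imaginary parts are real parts evaluated at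
      \<open>\<i> *\<^sub>C h\<close>.\<close>
    have "\<i> *\<^sub>C h \<in> X" using X(3) h by blast
    from Re_eq[OF this] show "Im (p h) = Im (cinner (D h) w)"
      using D p h by (simp add: cinner_scaleC_left)
  qed (rule Re_eq[OF h])
  then show ?thesis using that wc by blast
qed

section \<open>Riesz representation, adjoints, positive square roots and defect operators\<close>

section \<open>Bounded operators, adjoints and defect operators\<close>

lemma bounded_opsI:
  assumes "\<And>x. x \<in> U \<Longrightarrow> A x \<in> V" "\<And>x y. x \<in> U \<Longrightarrow> y \<in> U \<Longrightarrow> A (x + y) = A x + A y"
    "\<And>c x. x \<in> U \<Longrightarrow> A (c *\<^sub>C x) = c *\<^sub>C A x" "\<And>x. x \<in> U \<Longrightarrow> norm (A x) \<le> K * norm x"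
  shows "A \<in> bounded_ops U V"
  using assms unfolding bounded_ops_def by blast

lemma bounded_opsD:
  assumes "A \<in> bounded_ops U V"
  shows bounded_ops_mem: "x \<in> U \<Longrightarrow> A x \<in> V"
    and bounded_ops_add: "x \<in> U \<Longrightarrow> y \<in> U \<Longrightarrow> A (x + y) = A x + A y"
    and bounded_ops_scaleC: "x \<in> U \<Longrightarrow> A (c *\<^sub>C x) = c *\<^sub>C A x"
  using assms unfolding bounded_ops_def by auto

lemma bounded_ops_bound:
  assumes "A \<in> bounded_ops U V"
  obtains K where "K \<ge> 0" "\<And>x. x \<in> U \<Longrightarrow> norm (A x) \<le> K * norm x"
proof -
  obtain K where K: "\<forall>x\<in>U. norm (A x) \<le> K * norm x" using assms unfolding bounded_ops_def by auto
  have "norm (A x) \<le> \<bar>K\<bar> * norm x" if "x \<in> U" for x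
    using K that by (meson abs_ge_self mult_right_mono norm_ge_zero order_trans)
  then show ?thesis using that[of "\<bar>K\<bar>"] by simp
qed

lemma bounded_ops_minus: "A \<in> bounded_ops U V \<Longrightarrow> x \<in> U \<Longrightarrow> A (- x) = - A x"
  using bounded_ops_scaleC[of A U V x "-1"] by (simp add: scaleC_minus_one)

lemma bounded_ops_diff:
  "closed_csubspace U \<Longrightarrow> A \<in> bounded_ops U V \<Longrightarrow> x \<in> U \<Longrightarrow> y \<in> U \<Longrightarrow> A (x - y) = A x - A y"
  using bounded_ops_add[of A U V x "-y"] bounded_ops_minus[of A U V y] csubspace_minus[of U y] by simp

lemma bounded_ops_zero: "closed_csubspace U \<Longrightarrow> A \<in> bounded_ops U V \<Longrightarrow> A 0 = 0"
  using bounded_ops_scaleC[of A U V 0 0] csubspace_zero by auto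

lemma bounded_ops_linear:
  assumes "A \<in> bounded_ops UNIV V"
  shows "bounded_linear A"
proof -
  obtain K where "\<And>x. norm (A x) \<le> K * norm x" using bounded_ops_bound[OF assms] by auto
  then show ?thesis
    using assms by (intro bounded_linear_intro[of A K])
      (auto simp: mult.commute scaleR_scaleC bounded_ops_add bounded_ops_scaleC)
qed

lemma bounded_ops_continuous_on:
  assumes "closed_csubspace U" "A \<in> bounded_ops U V"
  shows "continuous_on U A"
proof -
  obtain K where K: "K \<ge> 0" "\<And>x. x \<in> U \<Longrightarrow> norm (A x) \<le> K * norm x"
    using bounded_ops_bound[OF assms(2)] by blast
  have "K-lipschitz_on U A"
    using K assms csubspace_diff[OF assms(1)]
    by (intro lipschitz_onI) (auto simp: dist_norm bounded_ops_diff[symmetric])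
  then show ?thesis by (rule lipschitz_on_continuous_on)
qed

lemma bounded_ops_weaken: "A \<in> bounded_ops U V \<Longrightarrow> (\<And>x. x \<in> U \<Longrightarrow> A x \<in> W) \<Longrightarrow> A \<in> bounded_ops U W"
  unfolding bounded_ops_def by blast

subsection \<open>Adjoints\<close>

text \<open>Riesz representation on \<open>U\<close>: \<open>functional_factorization\<close> with
  \<open>D\<close> the identity puts the representing vector in the closure of \<open>U\<close>,
  which is \<open>U\<close>. This makes the definite description in \<open>adj\<close>
  meaningful.\<close>

lemma adj_ex1:
  assumes "closed_csubspace U" "A \<in> bounded_ops U V"
  shows "\<exists>!x. x \<in> U \<and> (\<forall>u\<in>U. cinner (A u) y = cinner u x)"
proof -
  obtain K where K: "K \<ge> 0" "\<And>x. x \<in> U \<Longrightarrow> norm (A x) \<le> K * norm x"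
    using bounded_ops_bound[OF assms(2)] by blast
  have b: "cmod (cinner (A x) y) \<le> (K * norm y) * norm x" if "x \<in> U" for x
  proof -
    have "cmod (cinner (A x) y) \<le> norm (A x) * norm y" by (rule cinner_cauchy_schwarz)
    also have "\<dots> \<le> (K * norm x) * norm y" by (intro mult_right_mono K that) simp
    finally show ?thesis by (simp add: mult_ac)
  qed
  obtain w where "w \<in> closure ((\<lambda>x. x) ` U)" "\<And>x. x \<in> U \<Longrightarrow> cinner (A x) y = cinner x w"
    by (rule functional_factorization[of U "\<lambda>x. x" "\<lambda>x. cinner (A x) y" "K * norm y"])
      (use assms b in \<open>auto simp: csubspaceD bounded_opsD cinner_add_left cinner_scaleC_left\<close>)
  then show ?thesis
    using csubspace_closed[OF assms(1)] cinner_eqI[OF assms(1)]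
    by (intro ex_ex1I exI[of _ w]) auto
qed

lemma adj_props:
  assumes "closed_csubspace U" "A \<in> bounded_ops U V"
  shows adj_mem: "adj U A y \<in> U"
    and cinner_adj: "u \<in> U \<Longrightarrow> cinner (A u) y = cinner u (adj U A y)"
  using theI'[OF adj_ex1[OF assms, of y]] unfolding adj_def by auto

lemma cinner_adj':
  assumes "closed_csubspace U" "A \<in> bounded_ops U V" "u \<in> U"
  shows "cinner y (A u) = cinner (adj U A y) u"
  using cinner_adj[OF assms, of y] by (metis cinner_commute)

lemma adj_eqI:
  assumes "closed_csubspace U" "A \<in> bounded_ops U V" "x \<in> U"
    "\<And>u. u \<in> U \<Longrightarrow> cinner (A u) y = cinner u x"
  shows "adj U A y = x"
  by (rule cinner_eqI[OF assms(1) adj_mem[OF assms(1,2)] assms(3)])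
    (use assms cinner_adj[OF assms(1,2)] in metis)

lemma norm_adj_le:
  assumes "closed_csubspace U" "A \<in> bounded_ops U V" "K \<ge> 0"
    "\<And>x. x \<in> U \<Longrightarrow> norm (A x) \<le> K * norm x"
  shows "norm (adj U A y) \<le> K * norm y"
proof -
  let ?a = "adj U A y"
  have a: "?a \<in> U" by (rule adj_mem[OF assms(1,2)])
  have "(norm ?a)\<^sup>2 = cmod (cinner (A ?a) y)"
    by (simp only: cinner_adj[OF assms(1,2) a] cinner_self norm_of_real abs_power2)
  also have "\<dots> \<le> norm (A ?a) * norm y" by (rule cinner_cauchy_schwarz)
  also have "\<dots> \<le> (K * norm ?a) * norm y" by (intro mult_right_mono assms a) simp
  finally have *: "norm ?a * norm ?a \<le> (K * norm y) * norm ?a"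
    by (simp add: power2_eq_square mult_ac)
  show ?thesis
  proof (cases "norm ?a = 0")
    case True then show ?thesis using assms(3) by simp
  next
    case False
    then show ?thesis using * by simp
  qed
qed

text \<open>The domain \<open>W\<close> is arbitrary because \<open>adj U A\<close> is defined on
  the whole ambient type, and the bound of \<open>A\<close> on \<open>U\<close> controls it
  everywhere.\<close>

lemma adj_bounded_ops:
  assumes U: "closed_csubspace U" and A: "A \<in> bounded_ops U V"
  shows "adj U A \<in> bounded_ops W U"
proof -
  obtain K where K: "K \<ge> 0" "\<And>x. x \<in> U \<Longrightarrow> norm (A x) \<le> K * norm x"
    using bounded_ops_bound[OF A] by blast
  show ?thesis
  proof (rule bounded_opsI[where K = K])
    fix x y c
    show "adj U A x \<in> U" by (rule adj_mem[OF U A])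
    show "adj U A (x + y) = adj U A x + adj U A y"
      by (rule adj_eqI[OF U A])
        (use U adj_mem[OF U A] cinner_adj[OF U A] in \<open>auto simp: csubspace_add cinner_add_right\<close>)
    show "adj U A (c *\<^sub>C x) = c *\<^sub>C adj U A x"
      by (rule adj_eqI[OF U A])
        (use U adj_mem[OF U A] cinner_adj[OF U A] in \<open>auto simp: csubspace_scaleC cinner_scaleC_right\<close>)
    show "norm (adj U A x) \<le> K * norm x" by (rule norm_adj_le[OF U A K])
  qed
qed

lemma adj_adj:
  assumes "closed_csubspace U" "closed_csubspace V" "A \<in> bounded_ops U V" "x \<in> U"
  shows "adj V (adj U A) x = A x"
  by (rule adj_eqI[OF assms(2) adj_bounded_ops[OF assms(1,3)]])
    (use assms cinner_adj'[OF assms(1,3,4)] in \<open>auto simp: bounded_ops_mem\<close>)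

subsection \<open>The square root of \<open>I - A\<close> for a self-adjoint contraction\<close>

text \<open>The square root is \<open>I - Y\<close>, where \<open>Y = (A + Y\<^sup>2)/2\<close> is the fixed point reached from \<open>0\<close>. The
  scalar iteration with \<open>A = 1\<close> majorizes the increments, so convergence is in norm.\<close>

primrec sqrt_iter :: "('a::real_normed_vector \<Rightarrow>\<^sub>L 'a) \<Rightarrow> nat \<Rightarrow> 'a \<Rightarrow>\<^sub>L 'a" where
  "sqrt_iter A 0 = 0"
| "sqrt_iter A (Suc n) = (1/2) *\<^sub>R (A + (sqrt_iter A n o\<^sub>L sqrt_iter A n))"

primrec sqrt_major :: "nat \<Rightarrow> real" where
  "sqrt_major 0 = 0"
| "sqrt_major (Suc n) = (1 + (sqrt_major n)\<^sup>2) / 2"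

definition sqrt_lim :: "('a::real_normed_vector \<Rightarrow>\<^sub>L 'a) \<Rightarrow> 'a \<Rightarrow>\<^sub>L 'a" where
  "sqrt_lim A = lim (sqrt_iter A)"

lemma sqrt_major_bounds: "0 \<le> sqrt_major n \<and> sqrt_major n \<le> 1"
proof (induction n)
  case (Suc n)
  then have "(sqrt_major n)\<^sup>2 \<le> 1" by (simp add: power_le_one)
  then show ?case by simp
qed simp

lemma sqrt_major_mono: "sqrt_major n \<le> sqrt_major (Suc n)"
proof -
  have "0 \<le> (1 - sqrt_major n)\<^sup>2" by simp
  then show ?thesis by (simp add: power2_diff)
qed

lemma blinfun_compose_assoc: "(X o\<^sub>L Y) o\<^sub>L Z = X o\<^sub>L (Y o\<^sub>L Z)"
  by (rule blinfun_eqI) simp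

text \<open>Iterates are polynomials in \<open>A\<close>, so an intertwining relation is inherited.
  The case \<open>A' = A\<close> gives commutation; two different operators occur when
  \<open>T\<close> intertwines its own gram operator with that of its adjoint.\<close>

lemma sqrt_iter_intertwine:
  assumes "X o\<^sub>L A = A' o\<^sub>L X"
  shows "X o\<^sub>L sqrt_iter A n = sqrt_iter A' n o\<^sub>L X"
proof (induction n)
  case (Suc n)
  have "X o\<^sub>L (sqrt_iter A n o\<^sub>L sqrt_iter A n) = (sqrt_iter A' n o\<^sub>L sqrt_iter A' n) o\<^sub>L X"
    by (metis Suc blinfun_compose_assoc)
  then show ?case
    using assms by (simp add: bounded_bilinear.add_left[OF bounded_bilinear_blinfun_compose]
        bounded_bilinear.add_right[OF bounded_bilinear_blinfun_compose]
        bounded_bilinear.scaleR_left[OF bounded_bilinear_blinfun_compose]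
        bounded_bilinear.scaleR_right[OF bounded_bilinear_blinfun_compose])
qed (simp add: bounded_bilinear.zero_left[OF bounded_bilinear_blinfun_compose]
    bounded_bilinear.zero_right[OF bounded_bilinear_blinfun_compose])

lemma sqrt_iter_commute: "sqrt_iter A m o\<^sub>L sqrt_iter A n = sqrt_iter A n o\<^sub>L sqrt_iter A m"
  by (metis sqrt_iter_intertwine)

lemma sqrt_iter_norm:
  assumes "norm A \<le> 1"
  shows "norm (sqrt_iter A n) \<le> sqrt_major n"
proof (induction n)
  case (Suc n)
  have "norm (sqrt_iter A (Suc n)) \<le> (1/2) * (norm A + norm (sqrt_iter A n o\<^sub>L sqrt_iter A n))"
    using norm_triangle_ineq[of A "sqrt_iter A n o\<^sub>L sqrt_iter A n"] by simp
  also have "\<dots> \<le> (1/2) * (norm A + norm (sqrt_iter A n) * norm (sqrt_iter A n))"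
    using norm_blinfun_compose[of "sqrt_iter A n" "sqrt_iter A n"] by simp
  also have "\<dots> \<le> (1/2) * (1 + sqrt_major n * sqrt_major n)"
    using assms Suc by (intro mult_left_mono add_mono mult_mono) (auto simp: sqrt_major_bounds)
  finally show ?case by (simp add: power2_eq_square)
qed simp

text \<open>The iterates commute, so a difference of squares factors as
  \<open>(Y + X) (Y - X)\<close>; the same factorization of the scalar iteration gives exactly the
  majorant.\<close>

lemma sqrt_iter_step:
  assumes "norm A \<le> 1"
  shows "norm (sqrt_iter A (Suc n) - sqrt_iter A n) \<le> sqrt_major (Suc n) - sqrt_major n"
proof (induction n)
  case 0
  show ?case using assms by simp
next
  case (Suc n)
  let ?Y = "sqrt_iter A (Suc n)" and ?X = "sqrt_iter A n"
  interpret cmp: bounded_bilinear "blinfun_compose :: ('a \<Rightarrow>\<^sub>L 'a) \<Rightarrow> _ \<Rightarrow> 'a \<Rightarrow>\<^sub>L 'a"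
    by (rule bounded_bilinear_blinfun_compose)
  have "sqrt_iter A (Suc (Suc n)) - ?Y = (1/2) *\<^sub>R ((?Y o\<^sub>L ?Y) - (?X o\<^sub>L ?X))"
    unfolding sqrt_iter.simps(2)[of A "Suc n"] sqrt_iter.simps(2)[of A n]
    by (simp add: scaleR_diff_right[symmetric] del: sqrt_iter.simps)
  also have "(?Y o\<^sub>L ?Y) - (?X o\<^sub>L ?X) = (?Y + ?X) o\<^sub>L (?Y - ?X)"
    using sqrt_iter_commute[of A n "Suc n"]
    by (simp add: cmp.add_left cmp.diff_right algebra_simps del: sqrt_iter.simps)
  finally have "norm (sqrt_iter A (Suc (Suc n)) - ?Y) \<le> (1/2) * (norm (?Y + ?X) * norm (?Y - ?X))"
    using norm_blinfun_compose[of "?Y + ?X" "?Y - ?X"] by (simp del: sqrt_iter.simps)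
  also have "\<dots> \<le> (1/2) * ((sqrt_major (Suc n) + sqrt_major n) * (sqrt_major (Suc n) - sqrt_major n))"
    using sqrt_iter_norm[OF assms] sqrt_major_bounds
    by (intro mult_left_mono mult_mono Suc norm_triangle_mono add_nonneg_nonneg norm_ge_zero) (auto simp del: sqrt_iter.simps sqrt_major.simps)
  also have "\<dots> = sqrt_major (Suc (Suc n)) - sqrt_major (Suc n)"
    unfolding sqrt_major.simps(2)[of "Suc n"] sqrt_major.simps(2)[of n]
    by (simp add: field_simps power2_eq_square)
  finally show ?case .
qed

text \<open>Telescoping bounds the increments by those of \<open>sqrt_major\<close>, which increases
  and stays below or at 1, hence is Cauchy. The majorant has no geometric rate, so only its monotone
  convergence is used.\<close>

lemma sqrt_iter_tendsto:
  fixes A :: "'a::banach \<Rightarrow>\<^sub>L 'a"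
  assumes "norm A \<le> 1"
  shows "sqrt_iter A \<longlonglongrightarrow> sqrt_lim A"
proof -
  have inc: "incseq sqrt_major" by (rule incseq_SucI) (rule sqrt_major_mono)
  then have "convergent sqrt_major"
    by (intro Bseq_mono_convergent BseqI'[of _ 1]) (auto simp: sqrt_major_bounds incseq_def)
  then have C: "Cauchy sqrt_major" by (rule convergent_Cauchy)
  have diff: "norm (sqrt_iter A (n + k) - sqrt_iter A n) \<le> sqrt_major (n + k) - sqrt_major n" for n k
  proof (induction k)
    case (Suc k)
    have "norm (sqrt_iter A (n + Suc k) - sqrt_iter A n) \<le>
        norm (sqrt_iter A (Suc (n + k)) - sqrt_iter A (n + k)) + norm (sqrt_iter A (n + k) - sqrt_iter A n)"
      using norm_triangle_ineq[of "sqrt_iter A (Suc (n + k)) - sqrt_iter A (n + k)"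
          "sqrt_iter A (n + k) - sqrt_iter A n"] by (simp del: sqrt_iter.simps)
    then show ?case using Suc sqrt_iter_step[OF assms, of "n + k"]
      by (simp del: sqrt_iter.simps sqrt_major.simps)
  qed simp
  have "Cauchy (sqrt_iter A)"
  proof (rule CauchyI')
    fix e :: real assume "0 < e"
    then obtain M where M: "\<forall>m\<ge>M. \<forall>n\<ge>M. norm (sqrt_major m - sqrt_major n) < e"
      using CauchyD[OF C] by blast
    have "norm (sqrt_iter A m - sqrt_iter A n) < e" if "M \<le> m" "m < n" for m n
    proof -
      have "norm (sqrt_iter A n - sqrt_iter A m) \<le> sqrt_major n - sqrt_major m"
        using diff[of m "n - m"] that by simp
      also have "\<dots> < e" using M that by (metis abs_ge_self le_less_trans less_imp_le order_trans real_norm_def)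
      finally show ?thesis by (simp add: norm_minus_commute)
    qed
    then show "\<exists>M. \<forall>m\<ge>M. \<forall>n>m. dist (sqrt_iter A m) (sqrt_iter A n) < e" unfolding dist_norm by blast
  qed
  then show ?thesis unfolding sqrt_lim_def
    by (simp add: Cauchy_convergent_iff convergent_LIMSEQ_iff)
qed

lemma sqrt_lim_intertwine:
  fixes A :: "'a::banach \<Rightarrow>\<^sub>L 'a" and A' :: "'b::banach \<Rightarrow>\<^sub>L 'b"
  assumes "norm A \<le> 1" "norm A' \<le> 1" "X o\<^sub>L A = A' o\<^sub>L X"
  shows "X o\<^sub>L sqrt_lim A = sqrt_lim A' o\<^sub>L X"
proof (rule LIMSEQ_unique)
  show "(\<lambda>n. X o\<^sub>L sqrt_iter A n) \<longlonglongrightarrow> (X o\<^sub>L sqrt_lim A)"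
    by (intro bounded_bilinear.tendsto[OF bounded_bilinear_blinfun_compose] tendsto_const
        sqrt_iter_tendsto assms)
  show "(\<lambda>n. X o\<^sub>L sqrt_iter A n) \<longlonglongrightarrow> (sqrt_lim A' o\<^sub>L X)"
    unfolding sqrt_iter_intertwine[OF assms(3)]
    by (intro bounded_bilinear.tendsto[OF bounded_bilinear_blinfun_compose] tendsto_const
        sqrt_iter_tendsto assms)
qed

lemma sqrt_lim_fixpoint:
  fixes A :: "'a::banach \<Rightarrow>\<^sub>L 'a"
  assumes "norm A \<le> 1"
  shows "sqrt_lim A = (1/2) *\<^sub>R (A + (sqrt_lim A o\<^sub>L sqrt_lim A))"
proof (rule LIMSEQ_unique)
  show "(\<lambda>n. sqrt_iter A (Suc n)) \<longlonglongrightarrow> sqrt_lim A"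
    by (intro LIMSEQ_Suc sqrt_iter_tendsto assms)
  show "(\<lambda>n. sqrt_iter A (Suc n)) \<longlonglongrightarrow> (1/2) *\<^sub>R (A + (sqrt_lim A o\<^sub>L sqrt_lim A))"
    unfolding sqrt_iter.simps
    by (intro tendsto_intros bounded_bilinear.tendsto[OF bounded_bilinear_blinfun_compose]
        sqrt_iter_tendsto assms)
qed

lemma sqrt_lim_norm:
  fixes A :: "'a::banach \<Rightarrow>\<^sub>L 'a"
  assumes "norm A \<le> 1"
  shows "norm (sqrt_lim A) \<le> 1"
  by (rule LIMSEQ_le_const2[OF tendsto_norm[OF sqrt_iter_tendsto[OF assms]]])
    (use sqrt_iter_norm[OF assms] sqrt_major_bounds order_trans in blast)

lemma sqrt_lim_selfadjoint:
  fixes A :: "'a::{banach, real_inner} \<Rightarrow>\<^sub>L 'a"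
  assumes "norm A \<le> 1" "\<And>x y. A x \<bullet> y = x \<bullet> A y"
  shows "sqrt_lim A x \<bullet> y = x \<bullet> sqrt_lim A y"
proof -
  have it: "sqrt_iter A n x \<bullet> y = x \<bullet> sqrt_iter A n y" for n x y
  proof (induction n arbitrary: x y)
    case (Suc n)
    show ?case
      by (simp add: blinfun.scaleR_left blinfun.add_left inner_add_left inner_add_right assms(2) Suc)
  qed simp
  have "(\<lambda>n. sqrt_iter A n z) \<longlonglongrightarrow> sqrt_lim A z" for z
    by (intro blinfun.tendsto sqrt_iter_tendsto assms tendsto_const)
  then have "(\<lambda>n. sqrt_iter A n x \<bullet> y) \<longlonglongrightarrow> sqrt_lim A x \<bullet> y"
    "(\<lambda>n. x \<bullet> sqrt_iter A n y) \<longlonglongrightarrow> x \<bullet> sqrt_lim A y"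
    by (auto intro!: tendsto_inner)
  then show ?thesis unfolding it using LIMSEQ_unique by blast
qed

text \<open>Complex polarization: real values of the quadratic form at \<open>x + y\<close> and at
  \<open>x + \<i> y\<close> force symmetry.\<close>

lemma positive_op_selfadjoint:
  fixes C :: "'a::complex_hilbert \<Rightarrow> 'a"
  assumes C: "C \<in> bounded_ops UNIV UNIV" and pos: "op_le UNIV (\<lambda>_. 0) C"
  shows "cinner (C x) y = cinner x (C y)"
proof -
  have Im: "Im (cinner (C x) x) = 0" for x
    using pos unfolding op_le_def by (auto simp: complex_nonneg_Reals_iff)
  have add: "Im (cinner (C x) y) + Im (cinner (C y) x) = 0" for x y
    using Im[of "x + y"] Im[of x] Im[of y] C
    by (simp add: bounded_ops_add cinner_add_left cinner_add_right)
  have "Re (cinner (C y) x) = Re (cinner (C x) y)"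
    using add[of x "\<i> *\<^sub>C y"] C
    by (simp add: bounded_ops_scaleC cinner_scaleC_left cinner_scaleC_right)
  then have "cinner (C x) y = cnj (cinner (C y) x)"
    using add[of x y] by (simp add: complex_eq_iff)
  then show ?thesis by (metis cinner_commute)
qed

text \<open>The form \<open>Re (cinner (C x) x)\<close> attains its minimum 0 at \<open>y\<close>,
  so its derivative in the direction \<open>C y\<close> vanishes; that derivative is a multiple of
  the squared norm of \<open>C y\<close>.\<close>

lemma positive_op_kernel:
  fixes C :: "'a::complex_hilbert \<Rightarrow> 'a"
  assumes C: "C \<in> bounded_ops UNIV UNIV" and pos: "op_le UNIV (\<lambda>_. 0) C"
    and y: "Re (cinner (C y) y) = 0"
  shows "C y = 0"
proof (rule ccontr)
  assume ne: "C y \<noteq> 0"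
  have Re: "0 \<le> Re (cinner (C x) x)" for x
    using pos unfolding op_le_def by (auto simp: complex_nonneg_Reals_iff)
  define c where "c = Re (cinner (C (C y)) (C y)) + 1"
  define b where "b = (norm (C y))\<^sup>2"
  have c: "c > 0" "Re (cinner (C (C y)) (C y)) \<le> c" using Re[of "C y"] unfolding c_def by auto
  have b: "b > 0" using ne unfolding b_def by simp
  have "0 \<le> 2 * s * b + s\<^sup>2 * Re (cinner (C (C y)) (C y))" for s :: real
  proof -
    have "0 \<le> Re (cinner (C (y + complex_of_real s *\<^sub>C C y)) (y + complex_of_real s *\<^sub>C C y))" by (rule Re)
    also have "\<dots> = 2 * s * b + s\<^sup>2 * Re (cinner (C (C y)) (C y))"
      using C y positive_op_selfadjoint[OF C pos, of "C y" y] cinner_self[of "C y"]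
      by (simp add: bounded_ops_add bounded_ops_scaleC cinner_add_left cinner_add_right
          cinner_scaleC_left cinner_scaleC_right b_def power2_eq_square algebra_simps)
    finally show ?thesis .
  qed
  from this[of "- b / c"] have "0 \<le> 2 * (- b / c) * b + (- b / c)\<^sup>2 * Re (cinner (C (C y)) (C y))" .
  also have "\<dots> \<le> 2 * (- b / c) * b + (- b / c)\<^sup>2 * c"
    by (intro add_left_mono mult_left_mono c) simp
  also have "\<dots> = - b\<^sup>2 / c" using c by (simp add: field_simps power2_eq_square)
  finally have "b\<^sup>2 / c \<le> 0" by simp
  moreover have "b\<^sup>2 / c > 0" using b c by simp
  ultimately show False by linarith
qed

text \<open>The fixed point equation \<open>2 Y = A + Y\<^sup>2\<close> says that
  \<open>(I - Y)\<^sup>2 = I - A\<close>. Uniqueness is what evaluates the definite description in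
  \<open>op_sqrt\<close>: any positive root \<open>E\<close> commutes with \<open>A\<close>, hence
  with the limit of polynomials in \<open>A\<close>.\<close>

lemma op_sqrt_one_minus:
  fixes A :: "'a::complex_hilbert \<Rightarrow> 'a"
  assumes A: "A \<in> bounded_ops UNIV UNIV" and con: "\<And>x. norm (A x) \<le> norm x"
    and sa: "\<And>x y. cinner (A x) y = cinner x (A y)"
  defines "C \<equiv> \<lambda>x. x - sqrt_lim (Blinfun A) x"
  shows "op_sqrt (\<lambda>x. x - A x) = C" "C \<in> bounded_ops UNIV UNIV" "op_le UNIV (\<lambda>_. 0) C"
    "C (C x) = x - A x"
proof -
  define B where "B = Blinfun A"
  define L where "L = sqrt_lim B"
  have B: "blinfun_apply B = A" unfolding B_def
    by (rule bounded_linear_Blinfun_apply[OF bounded_ops_linear[OF A]])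
  have nB: "norm B \<le> 1" by (rule norm_blinfun_bound) (auto simp: B con)
  have com: "blinfun_apply X (L x) = L (blinfun_apply X x)" if "\<And>x. blinfun_apply X (A x) = A (blinfun_apply X x)" for X :: "'a \<Rightarrow>\<^sub>L 'a" and x
  proof -
    have "X o\<^sub>L B = B o\<^sub>L X" by (rule blinfun_eqI) (simp add: B that)
    from sqrt_lim_intertwine[OF nB nB this] show ?thesis
      unfolding L_def by (metis blinfun_apply_blinfun_compose)
  qed
  have Lc: "L (c *\<^sub>C x) = c *\<^sub>C L x" for c x
  proof -
    have bl: "blinfun_apply (Blinfun (\<lambda>x. c *\<^sub>C x)) = (\<lambda>x::'a. c *\<^sub>C x)"
      by (intro bounded_linear_Blinfun_apply bounded_bilinear.bounded_linear_right
          bounded_bilinear_scaleC)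
    show ?thesis using com[of "Blinfun (\<lambda>x. c *\<^sub>C x)" x] A by (simp add: bl bounded_ops_scaleC)
  qed
  have CL: "C x = x - L x" for x by (simp add: C_def L_def B_def)
  have nL: "norm (L x) \<le> norm x" for x
    using norm_blinfun[of L x] sqrt_lim_norm[OF nB]
    by (metis L_def mult.left_neutral mult_right_mono norm_ge_zero order_trans)
  show C: "C \<in> bounded_ops UNIV UNIV"
  proof (rule bounded_opsI[where K = 2])
    show "norm (C x) \<le> 2 * norm x" for x
      using nL[of x] norm_triangle_ineq4[of x "L x"] by (simp add: CL)
  qed (auto simp: CL blinfun.add_right Lc scaleC_diff_right)
  have "L x \<bullet> y = x \<bullet> L y" for x y
    unfolding L_def by (rule sqrt_lim_selfadjoint[OF nB]) (simp add: B inner_eq_Re_cinner sa)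
  then have LRe: "Re (cinner (L x) y) = Re (cinner x (L y))" for x y
    by (simp add: inner_eq_Re_cinner)
  have Lsa: "cinner (L x) y = cinner x (L y)" for x y
  proof (rule complex_eqI)
    show "Im (cinner (L x) y) = Im (cinner x (L y))"
      using LRe[of x "\<i> *\<^sub>C y"] by (simp add: Lc cinner_scaleC_right)
  qed (rule LRe)
  show Cpos: "op_le UNIV (\<lambda>_. 0) C"
    unfolding op_le_def
  proof (intro ballI)
    fix x
    have "Im (cinner (L x) x) = 0"
      using Lsa[of x x] cinner_commute[of "L x" x] by (metis Reals_cnj_iff complex_is_Real_iff)
    moreover have "Re (cinner (L x) x) \<le> norm (L x) * norm x"
      using cinner_cauchy_schwarz complex_Re_le_cmod order_trans by blast
    moreover have "norm (L x) * norm x \<le> norm x * norm x" by (rule mult_right_mono[OF nL]) simp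
    ultimately show "cinner (C x - 0) x \<in> \<real>\<^sub>\<ge>\<^sub>0"
      by (simp add: CL cinner_diff_left cinner_self complex_nonneg_Reals_iff power2_eq_square)
  qed
  show CC: "C (C x) = x - A x" for x
  proof -
    have "L x = (1/2) *\<^sub>R (A x + L (L x))"
      using arg_cong[OF sqrt_lim_fixpoint[OF nB], of "\<lambda>Y. blinfun_apply Y x"]
      by (simp add: L_def[symmetric] B blinfun.scaleR_left blinfun.add_left)
    then have "2 *\<^sub>R L x = A x + L (L x)" by (metis scaleR_half_double scaleR_2 field_sum_of_halves scaleR_left.add scaleR_one scaleR_right_distrib)
    then show ?thesis by (simp add: CL blinfun.diff_right scaleR_2 algebra_simps)
  qed
  show "op_sqrt (\<lambda>x. x - A x) = C"
    unfolding op_sqrt_def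
  proof (rule the_equality)
    show "C \<in> bounded_ops UNIV UNIV \<and> op_le UNIV (\<lambda>_. 0) C \<and> (\<forall>x. C (C x) = x - A x)"
      using C Cpos CC by blast
    fix E assume "E \<in> bounded_ops UNIV UNIV \<and> op_le UNIV (\<lambda>_. 0) E \<and> (\<forall>x. E (E x) = x - A x)"
    then have E: "E \<in> bounded_ops UNIV UNIV" and Epos: "op_le UNIV (\<lambda>_. 0) E"
      and EE: "E (E x) = x - A x" for x by auto
    have Ed: "E (x - y) = E x - E y" for x y using bounded_ops_diff[OF _ E] by simp
    have Cd: "C (x - y) = C x - C y" for x y using bounded_ops_diff[OF _ C] by simp
    have EA: "E (A x) = A (E x)" for x
      using EE[of x] EE[of "E x"] Ed[of x "E (E x)"] by (metis add_diff_cancel_left' diff_add_cancel)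
    have bE: "blinfun_apply (Blinfun E) = E"
      by (rule bounded_linear_Blinfun_apply[OF bounded_ops_linear[OF E]])
    have EC: "E (C x) = C (E x)" for x
      using com[of "Blinfun E" x] by (simp add: bE EA CL Ed)
    show "E = C"
    proof
      fix x
      \<comment> \<open>As \<open>E\<close> and \<open>C\<close> commute and have equal squares,
        \<open>C y + E y = 0\<close>. Both quadratic forms are nonnegative, so both vanish at
        \<open>y\<close> and \<open>positive_op_kernel\<close> applies to each.\<close>
      define y where "y = C x - E x"
      have "C y + E y = 0"
        unfolding y_def Ed Cd using EE CC EC by simp
      then have "cinner (C y) y + cinner (E y) y = 0" by (simp add: cinner_add_left[symmetric])
      moreover have "0 \<le> Re (cinner (C y) y)" "0 \<le> Re (cinner (E y) y)"
        using Cpos Epos unfolding op_le_def by (auto simp: complex_nonneg_Reals_iff)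
      ultimately have "Re (cinner (C y) y) = 0" "Re (cinner (E y) y) = 0"
        by (smt (verit) plus_complex.sel(1) zero_complex.sel(1))+
      then have "C y = 0" "E y = 0"
        using positive_op_kernel C Cpos E Epos by blast+
      moreover have "cinner y y = cinner x (C y) - cinner x (E y)"
        using positive_op_selfadjoint[OF C Cpos] positive_op_selfadjoint[OF E Epos]
        unfolding y_def by (metis cinner_diff_left)
      ultimately have "y = 0" by (simp add: cinner_self)
      then show "E x = C x" by (simp add: y_def)
    qed
  qed
qed

subsection \<open>Defect operators\<close>

lemma contraction_adj:
  assumes "T \<in> bounded_ops UNIV UNIV" "\<And>x. norm (T x) \<le> norm x"
  shows "adj UNIV T \<in> bounded_ops UNIV UNIV" "norm (adj UNIV T y) \<le> norm y"
    "cinner (T x) y = cinner x (adj UNIV T y)" "adj UNIV (adj UNIV T) = T"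
proof -
  show "adj UNIV T \<in> bounded_ops UNIV UNIV" by (rule adj_bounded_ops[OF _ assms(1)]) simp
  show "norm (adj UNIV T y) \<le> norm y" using norm_adj_le[OF _ assms(1), of 1 y] assms(2) by simp
  show "cinner (T x) y = cinner x (adj UNIV T y)" by (rule cinner_adj[OF _ assms(1)]) simp_all
  show "adj UNIV (adj UNIV T) = T"
    by (rule ext) (rule adj_adj[OF _ _ assms(1)], simp_all)
qed

context
  fixes T :: "'a::complex_hilbert \<Rightarrow> 'b::complex_hilbert"
  assumes T: "T \<in> bounded_ops UNIV UNIV" and con: "\<And>x. norm (T x) \<le> norm x"
begin

lemma gram_op_props:
  shows gram_op_bounded: "(\<lambda>x. adj UNIV T (T x)) \<in> bounded_ops UNIV UNIV"
    and gram_op_contraction: "norm (adj UNIV T (T x)) \<le> norm x"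
    and gram_op_selfadjoint: "cinner (adj UNIV T (T x)) y = cinner x (adj UNIV T (T y))"
proof -
  note a = contraction_adj[OF T con]
  show le: "norm (adj UNIV T (T x)) \<le> norm x" for x using a(2) con order_trans by blast
  show "(\<lambda>x. adj UNIV T (T x)) \<in> bounded_ops UNIV UNIV"
    by (rule bounded_opsI[where K = 1]) (use T a(1) le in \<open>auto simp: bounded_opsD\<close>)
  show "cinner (adj UNIV T (T x)) y = cinner x (adj UNIV T (T y))"
    by (metis a(3) cinner_commute)
qed

lemma defect_op_eq: "defect_op T x = x - sqrt_lim (Blinfun (\<lambda>x. adj UNIV T (T x))) x"
  unfolding defect_op_def by (subst op_sqrt_one_minus(1)[OF gram_op_props]) simp

lemma defect_op_props:
  shows defect_op_bounded: "defect_op T \<in> bounded_ops UNIV UNIV"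
    and defect_op_selfadjoint: "cinner (defect_op T x) y = cinner x (defect_op T y)"
    and defect_op_square: "defect_op T (defect_op T x) = x - adj UNIV T (T x)"
    and defect_op_norm: "(norm (defect_op T x))\<^sup>2 = (norm x)\<^sup>2 - (norm (T x))\<^sup>2"
proof -
  note s = op_sqrt_one_minus[OF gram_op_props, folded defect_op_def]
  show 1: "defect_op T \<in> bounded_ops UNIV UNIV" unfolding s(1) by (rule s(2))
  have 2: "op_le UNIV (\<lambda>_. 0) (defect_op T)" unfolding s(1) by (rule s(3))
  show 3: "cinner (defect_op T x) y = cinner x (defect_op T y)" for x y
    by (rule positive_op_selfadjoint[OF 1 2])
  show 4: "defect_op T (defect_op T x) = x - adj UNIV T (T x)" for x unfolding s(1) by (rule s(4))
  have "cinner (defect_op T x) (defect_op T x) = cinner x x - cinner (T x) (T x)"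
    by (simp add: 3 4 cinner_diff_right contraction_adj(3)[OF T con])
  then have "complex_of_real ((norm (defect_op T x))\<^sup>2) = complex_of_real ((norm x)\<^sup>2 - (norm (T x))\<^sup>2)"
    by (simp add: cinner_self)
  then show "(norm (defect_op T x))\<^sup>2 = (norm x)\<^sup>2 - (norm (T x))\<^sup>2" using of_real_eq_iff by blast
qed

lemma defect_space_csubspace: "closed_csubspace (defect_space T)"
  unfolding closed_csubspace_def
proof (intro conjI allI ballI)
  note D = defect_op_bounded
  have "defect_op T 0 = 0" by (rule bounded_ops_zero[OF _ D]) simp
  then show "0 \<in> defect_space T" unfolding defect_space_def
    by (metis closure_subset rangeI subsetD)
  show "closed (defect_space T)" unfolding defect_space_def by simp
  fix x y assume "x \<in> defect_space T" "y \<in> defect_space T"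
  then obtain f g where f: "\<And>n. f n \<in> range (defect_op T)" "f \<longlonglongrightarrow> x"
    and g: "\<And>n. g n \<in> range (defect_op T)" "g \<longlonglongrightarrow> y"
    unfolding defect_space_def closure_sequential by blast
  have "f n + g n \<in> range (defect_op T)" for n
    using f(1)[of n] g(1)[of n] by (auto simp: bounded_ops_add[OF D, symmetric])
  moreover have "(\<lambda>n. f n + g n) \<longlonglongrightarrow> x + y" by (intro tendsto_intros f g)
  ultimately show "x + y \<in> defect_space T" unfolding defect_space_def closure_sequential
    by (intro exI[of _ "\<lambda>n. f n + g n"]) auto
next
  fix a x assume "x \<in> defect_space T"
  then obtain f where f: "\<And>n. f n \<in> range (defect_op T)" "f \<longlonglongrightarrow> x"
    unfolding defect_space_def closure_sequential by blast
  have "a *\<^sub>C f n \<in> range (defect_op T)" for n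
    using f(1)[of n] by (auto simp: bounded_ops_scaleC[OF defect_op_bounded, symmetric])
  moreover have "(\<lambda>n. a *\<^sub>C f n) \<longlonglongrightarrow> a *\<^sub>C x" by (intro tendsto_intros f)
  ultimately show "a *\<^sub>C x \<in> defect_space T" unfolding defect_space_def closure_sequential
    by (intro exI[of _ "\<lambda>n. a *\<^sub>C f n"]) auto
qed

lemma defect_op_mem: "defect_op T x \<in> defect_space T"
  unfolding defect_space_def by (meson closure_subset rangeI subsetD)

end

text \<open>\<open>T\<close> intertwines the gram operators of \<open>T\<close> and of its adjoint,
  and \<open>sqrt_lim_intertwine\<close> carries this to their square roots.\<close>

lemma defect_op_intertwine:
  assumes T: "T \<in> bounded_ops UNIV UNIV" and con: "\<And>x. norm (T x) \<le> norm x"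
  shows "T (defect_op T x) = defect_op (adj UNIV T) (T x)"
proof -
  note a = contraction_adj[OF T con]
  let ?A = "\<lambda>x. adj UNIV T (T x)" and ?B = "\<lambda>x. adj UNIV (adj UNIV T) (adj UNIV T x)"
  have A: "blinfun_apply (Blinfun ?A) = ?A" "norm (Blinfun ?A) \<le> 1"
    using gram_op_props[OF T con]
    by (auto intro!: norm_blinfun_bound simp: bounded_linear_Blinfun_apply bounded_ops_linear)
  have B: "blinfun_apply (Blinfun ?B) = ?B" "norm (Blinfun ?B) \<le> 1"
    using gram_op_props[OF a(1,2)]
    by (auto intro!: norm_blinfun_bound simp: bounded_linear_Blinfun_apply bounded_ops_linear)
  have X: "blinfun_apply (Blinfun T) = T"
    by (rule bounded_linear_Blinfun_apply[OF bounded_ops_linear[OF T]])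
  have "Blinfun T o\<^sub>L Blinfun ?A = Blinfun ?B o\<^sub>L Blinfun T"
    by (rule blinfun_eqI) (simp only: blinfun_apply_blinfun_compose A B X, simp only: a(4))
  from sqrt_lim_intertwine[OF A(2) B(2) this]
  have "T (sqrt_lim (Blinfun ?A) x) = sqrt_lim (Blinfun ?B) (T x)"
    using X by (metis blinfun_apply_blinfun_compose)
  then show ?thesis
    using bounded_ops_diff[OF closed_csubspace_UNIV T]
    by (simp add: defect_op_eq[OF T con] defect_op_eq[OF a(1,2)])
qed

section \<open>Differentiability in operator norm, reduced to scalar holomorphy\<close>

section \<open>Operator-valued holomorphic functions\<close>

text \<open>\<open>K\<close> guarantees that the supremum in \<open>op_norm\<close> is taken over a
  bounded set of reals; its size does not enter the estimate.\<close>

lemma op_norm_bound: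
  assumes "\<And>x. x \<in> U \<Longrightarrow> norm (A x) \<le> K * norm x" "x \<in> U"
  shows "norm (A x) \<le> op_norm U A * norm x"
proof (cases "x = 0")
  case True
  then show ?thesis using assms(1)[OF assms(2)] by simp
next
  case False
  have "norm (A u) / norm u \<le> \<bar>K\<bar>" if "u \<in> U" for u
  proof (cases "u = 0")
    case False
    then show ?thesis
      using assms(1)[OF that] by (simp add: divide_le_eq) (meson abs_ge_self mult_right_mono norm_ge_zero order_trans)
  qed simp
  then have "bdd_above ((\<lambda>u. norm (A u) / norm u) ` U)" by (rule bdd_aboveI2)
  then have "norm (A x) / norm x \<le> op_norm U A"
    unfolding op_norm_def by (rule cSUP_upper[OF assms(2)])
  then show ?thesis using False by (simp add: divide_le_eq)
qed

lemma op_norm_le: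
  assumes "0 \<in> U" "\<And>x. x \<in> U \<Longrightarrow> norm (A x) \<le> c * norm x" "c \<ge> 0"
  shows "op_norm U A \<le> c"
  unfolding op_norm_def
proof (rule cSUP_least)
  fix x assume x: "x \<in> U"
  show "norm (A x) / norm x \<le> c"
    using assms(2)[OF x] assms(3) by (cases "x = 0") (auto simp: divide_le_eq)
qed (use assms in auto)

lemma op_norm_nonneg:
  assumes "0 \<in> U" "\<And>x. x \<in> U \<Longrightarrow> norm (A x) \<le> K * norm x"
  shows "0 \<le> op_norm U A"
proof -
  have "norm (A u) / norm u \<le> \<bar>K\<bar>" if "u \<in> U" for u
  proof (cases "u = 0")
    case False
    then show ?thesis
      using assms(2)[OF that] by (simp add: divide_le_eq) (meson abs_ge_self mult_right_mono norm_ge_zero order_trans)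
  qed simp
  then have "bdd_above ((\<lambda>u. norm (A u) / norm u) ` U)" by (rule bdd_aboveI2)
  then show ?thesis unfolding op_norm_def
    by (rule cSUP_upper2[OF _ assms(1)]) simp
qed

definition has_cderiv :: "(complex \<Rightarrow> 'a::complex_hilbert) \<Rightarrow> 'a \<Rightarrow> complex \<Rightarrow> bool" where
  "has_cderiv f d z \<longleftrightarrow> ((\<lambda>w. inverse (w - z) *\<^sub>C (f w - f z)) \<longlongrightarrow> d) (at z)"

text \<open>The weak form reduces everything to scalar functions, and for bounded functions it
  already implies norm differentiability (\<open>weakly_holomorphic_cderiv\<close>).\<close>

definition weakly_holomorphic :: "(complex \<Rightarrow> 'a::complex_hilbert) \<Rightarrow> bool" where
  "weakly_holomorphic f \<longleftrightarrow> (\<forall>c. (\<lambda>z. cinner (f z) c) holomorphic_on unit_disk)"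

lemma weakly_holomorphicD:
  "weakly_holomorphic f \<Longrightarrow> (\<lambda>z. cinner (f z) c) holomorphic_on unit_disk"
  unfolding weakly_holomorphic_def by blast

lemma weakly_holomorphic_add:
  "weakly_holomorphic f \<Longrightarrow> weakly_holomorphic g \<Longrightarrow> weakly_holomorphic (\<lambda>z. f z + g z)"
  unfolding weakly_holomorphic_def by (auto simp: cinner_add_left intro!: holomorphic_intros)

lemma op_holomorphic_cderiv:
  assumes U: "closed_csubspace U" and F: "op_holomorphic U V F" and z: "z \<in> unit_disk"
  obtains A where "A \<in> bounded_ops U V" "\<And>x. x \<in> U \<Longrightarrow> has_cderiv (\<lambda>w. F w x) (A x) z"
proof -
  obtain A where A: "A \<in> bounded_ops U V"
    and lim: "((\<lambda>w. op_norm U (\<lambda>x. inverse (w - z) *\<^sub>C (F w x - F z x) - A x)) \<longlongrightarrow> 0) (at z)"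
    using F z unfolding op_holomorphic_def by blast
  have Fb: "F w \<in> bounded_ops U V" if "w \<in> unit_disk" for w
    using F that unfolding op_holomorphic_def by blast
  have "has_cderiv (\<lambda>w. F w x) (A x) z" if x: "x \<in> U" for x
    unfolding has_cderiv_def
  proof (rule Lim_null[THEN iffD2], rule Lim_null_comparison)
    let ?Q = "\<lambda>w x. inverse (w - z) *\<^sub>C (F w x - F z x) - A x"
    show "((\<lambda>w. op_norm U (?Q w) * norm x) \<longlongrightarrow> 0) (at z)"
      using tendsto_mult_right[OF lim, of "norm x"] by simp
    have "norm (?Q w x) \<le> op_norm U (?Q w) * norm x" if w: "w \<in> unit_disk" for w
    proof -
      obtain K1 where K1: "\<And>x. x \<in> U \<Longrightarrow> norm (F w x) \<le> K1 * norm x"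
        using bounded_ops_bound[OF Fb[OF w]] by blast
      obtain K2 where K2: "\<And>x. x \<in> U \<Longrightarrow> norm (F z x) \<le> K2 * norm x"
        using bounded_ops_bound[OF Fb[OF z]] by blast
      obtain K3 where K3: "\<And>x. x \<in> U \<Longrightarrow> norm (A x) \<le> K3 * norm x"
        using bounded_ops_bound[OF A] by blast
      \<comment> \<open>A crude bound, depending on \<open>w\<close>, that makes the supremum in
        \<open>op_norm\<close> finite so that \<open>op_norm_bound\<close> applies.\<close>
      have "norm (?Q w x) \<le> (cmod (inverse (w - z)) * (K1 + K2) + K3) * norm x" if "x \<in> U" for x
      proof -
        have "norm (?Q w x) \<le> cmod (inverse (w - z)) * norm (F w x - F z x) + norm (A x)"
          by (metis norm_scaleC norm_triangle_ineq4)
        also have "\<dots> \<le> cmod (inverse (w - z)) * (K1 * norm x + K2 * norm x) + K3 * norm x"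
          using K1[OF that] K2[OF that] K3[OF that] norm_triangle_ineq4[of "F w x" "F z x"]
          by (intro add_mono mult_left_mono) auto
        finally show ?thesis by (simp add: algebra_simps)
      qed
      then show ?thesis using op_norm_bound[of U "?Q w"] x by blast
    qed
    then show "\<forall>\<^sub>F w in at z. norm (?Q w x) \<le> op_norm U (?Q w) * norm x"
      using eventually_at_in_open'[OF open_ball z] by (rule eventually_mono[rotated])
  qed
  then show ?thesis using that A by blast
qed

lemma has_cderiv_cinner:
  assumes "has_cderiv f d z"
  shows "((\<lambda>w. cinner (f w) c) has_field_derivative cinner d c) (at z)"
proof -
  have "((\<lambda>w. cinner (inverse (w - z) *\<^sub>C (f w - f z)) c) \<longlongrightarrow> cinner d c) (at z)"
    using assms unfolding has_cderiv_def by (intro tendsto_intros)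
  then show ?thesis
    unfolding has_field_derivative_iff
    by (simp add: cinner_scaleC_left cinner_diff_left divide_inverse mult.commute)
qed

lemma has_cderiv_continuous:
  assumes "has_cderiv f d z"
  shows "isCont f z"
proof -
  have "((\<lambda>w. (w - z) *\<^sub>C (inverse (w - z) *\<^sub>C (f w - f z))) \<longlongrightarrow> (z - z) *\<^sub>C d) (at z)"
    using assms unfolding has_cderiv_def by (intro tendsto_intros)
  moreover have "\<forall>\<^sub>F w in at z. (w - z) *\<^sub>C (inverse (w - z) *\<^sub>C (f w - f z)) = f w - f z"
    unfolding eventually_at_filter by (simp add: scaleC_scaleC)
  ultimately have "((\<lambda>w. f w - f z) \<longlongrightarrow> 0) (at z)"
    using tendsto_cong by fastforce
  then show ?thesis unfolding isCont_def using Lim_null by blast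
qed

lemma op_holomorphic_weakly:
  assumes "closed_csubspace U" "op_holomorphic U V F" "x \<in> U"
  shows "weakly_holomorphic (\<lambda>z. F z x)"
  unfolding weakly_holomorphic_def
proof
  fix c
  show "(\<lambda>z. cinner (F z x) c) holomorphic_on unit_disk"
    unfolding holomorphic_on_open[OF open_ball]
  proof
    fix z assume "z \<in> unit_disk"
    then obtain A where "has_cderiv (\<lambda>w. F w x) (A x) z"
      using op_holomorphic_cderiv[OF assms(1,2)] assms(3) by blast
    then show "\<exists>f'. ((\<lambda>z. cinner (F z x) c) has_field_derivative f') (at z)"
      using has_cderiv_cinner by blast
  qed
qed

lemma op_holomorphic_continuous:
  assumes "closed_csubspace U" "op_holomorphic U V F" "x \<in> U"
  shows "continuous_on unit_disk (\<lambda>z. F z x)"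
proof (intro continuous_at_imp_continuous_on ballI)
  fix z assume "z \<in> unit_disk"
  then obtain A where "has_cderiv (\<lambda>w. F w x) (A x) z"
    using op_holomorphic_cderiv[OF assms(1,2)] assms(3) by blast
  then show "isCont (\<lambda>z. F z x) z" by (rule has_cderiv_continuous)
qed

subsection \<open>Cauchy estimates\<close>

text \<open>Cauchy's inequality on the circle of radius \<open>\<rho>/4\<close> about
  \<open>u\<close>, which stays inside since \<open>\<rho>/2 + \<rho>/4 < \<rho>\<close>.\<close>

lemma holomorphic_deriv_bound:
  assumes h: "h holomorphic_on ball z \<rho>" and B: "\<And>w. w \<in> ball z \<rho> \<Longrightarrow> cmod (h w) \<le> B"
    and u: "u \<in> ball z (\<rho>/2)"
  shows "cmod (deriv h u) \<le> 4 * B / \<rho>"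
proof -
  have \<rho>: "\<rho> > 0" using u zero_le_dist[of z u] unfolding mem_ball by linarith
  have sub: "cball u (\<rho>/4) \<subseteq> ball z \<rho>"
  proof
    fix v assume "v \<in> cball u (\<rho>/4)"
    then show "v \<in> ball z \<rho>" using u dist_triangle[of z v u] \<rho> by auto
  qed
  have "cmod ((deriv ^^ 1) h u) \<le> fact 1 * B / (\<rho>/4) ^ 1"
  proof (rule Cauchy_inequality)
    have "h holomorphic_on cball u (\<rho>/4)" by (rule holomorphic_on_subset[OF h sub])
    then show "h holomorphic_on ball u (\<rho>/4)" "continuous_on (cball u (\<rho>/4)) h"
      using holomorphic_on_subset[OF _ ball_subset_cball] holomorphic_on_imp_continuous_on by auto
    fix x assume "cmod (u - x) = \<rho>/4"
    then have "x \<in> cball u (\<rho>/4)" by (simp add: dist_norm)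
    then show "cmod (h x) \<le> B" using sub by (intro B) (rule subsetD)
  qed (use \<rho> in simp)
  then show ?thesis by (simp add: field_simps)
qed

lemma holomorphic_lipschitz:
  assumes h: "h holomorphic_on ball z \<rho>" and B: "\<And>w. w \<in> ball z \<rho> \<Longrightarrow> cmod (h w) \<le> B"
    and w: "w \<in> ball z (\<rho>/2)" "w' \<in> ball z (\<rho>/2)"
  shows "cmod (h w - h w') \<le> 4 * B / \<rho> * cmod (w - w')"
proof (rule field_differentiable_bound[of "ball z (\<rho>/2)" h "deriv h"])
  fix u assume u: "u \<in> ball z (\<rho>/2)"
  then have "dist z u < \<rho> / 2" by simp
  then have "u \<in> ball z \<rho>" using zero_le_dist[of z u] by (simp only: mem_ball)
  then show "(h has_field_derivative deriv h u) (at u within ball z (\<rho>/2))"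
    by (rule holomorphic_derivI[OF h open_ball])
  show "cmod (deriv h u) \<le> 4 * B / \<rho>" by (rule holomorphic_deriv_bound[OF h B u])
qed (use w in auto)

text \<open>The difference quotient has a removable singularity at \<open>z\<close>, and
  \<open>g\<close> is its extension. It is bounded by \<open>4 * B / \<rho>\<close> on the ball of
  radius \<open>\<rho>/2\<close>, and \<open>holomorphic_lipschitz\<close> on that ball yields the
  constant \<open>4 * (4 * B / \<rho>) / (\<rho>/2)\<close>.\<close>

lemma holomorphic_quotient_lipschitz:
  assumes h: "h holomorphic_on ball z \<rho>" and B: "\<And>w. w \<in> ball z \<rho> \<Longrightarrow> cmod (h w) \<le> B"
    and w: "w \<in> ball z (\<rho>/4)" "w' \<in> ball z (\<rho>/4)" "w \<noteq> z" "w' \<noteq> z" and \<rho>: "\<rho> > 0"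
  shows "cmod (inverse (w - z) * (h w - h z) - inverse (w' - z) * (h w' - h z))
    \<le> 32 / \<rho>\<^sup>2 * B * cmod (w - w')"
proof -
  define g where "g = (\<lambda>u. if u = z then deriv h z else (h u - h z) / (u - z))"
  have g: "g holomorphic_on ball z (\<rho>/2)" unfolding g_def
    by (rule pole_lemma) (use \<rho> in \<open>auto intro!: holomorphic_on_subset[OF h]\<close>)
  have gB: "cmod (g u) \<le> 4 * B / \<rho>" if u: "u \<in> ball z (\<rho>/2)" for u
  proof (cases "u = z")
    case True
    then show ?thesis using holomorphic_deriv_bound[OF h B, of z] \<rho> by (simp add: g_def)
  next
    case False
    have "cmod (h u - h z) \<le> 4 * B / \<rho> * cmod (u - z)"
      by (rule holomorphic_lipschitz[OF h B u]) (use \<rho> in auto)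
    then show ?thesis using False by (simp add: g_def norm_divide divide_le_eq)
  qed
  have "cmod (g w - g w') \<le> 4 * (4 * B / \<rho>) / (\<rho>/2) * cmod (w - w')"
    by (rule holomorphic_lipschitz[OF g gB]) (use w in auto)
  moreover have "g w = inverse (w - z) * (h w - h z)" "g w' = inverse (w' - z) * (h w' - h z)"
    using w(3,4) by (auto simp: g_def field_simps)
  moreover have "4 * (4 * B / \<rho>) / (\<rho>/2) = 32 / \<rho>\<^sup>2 * B"
    using \<rho> by (simp add: field_simps power2_eq_square)
  ultimately show ?thesis by (simp add: power2_eq_square)
qed

text \<open>The Lipschitz constant of the scalar quotients is linear in \<open>norm y\<close>, so
  \<open>norm_le_of_cinner\<close> makes the vector quotients Lipschitz in norm and therefore
  convergent by completeness. The explicit rate is recorded because \<open>op_holomorphicI\<close>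
  needs it uniformly in the vector argument.\<close>

lemma weakly_holomorphic_cderiv:
  fixes f :: "complex \<Rightarrow> 'a::complex_hilbert"
  assumes f: "weakly_holomorphic f" and B: "\<And>w. w \<in> unit_disk \<Longrightarrow> norm (f w) \<le> B"
    and z: "z \<in> unit_disk" and \<rho>: "\<rho> = 1 - cmod z"
  obtains d where "has_cderiv f d z"
    "\<And>w. w \<in> ball z (\<rho>/4) \<Longrightarrow> w \<noteq> z \<Longrightarrow>
       norm (inverse (w - z) *\<^sub>C (f w - f z) - d) \<le> 32 / \<rho>\<^sup>2 * B * cmod (w - z)"
proof -
  have \<rho>0: "\<rho> > 0" using z \<rho> by simp
  have sub: "ball z \<rho> \<subseteq> unit_disk" unfolding \<rho>
  proof
    fix v assume "v \<in> ball z (1 - cmod z)"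
    then show "v \<in> unit_disk" using norm_triangle_ineq[of z "v - z"] by (simp add: dist_norm norm_minus_commute)
  qed
  have B0: "0 \<le> B" using B[OF z] norm_ge_zero order_trans by blast
  define Q where "Q w = inverse (w - z) *\<^sub>C (f w - f z)" for w
  define K where "K = 32 / \<rho>\<^sup>2 * B"
  have K0: "K \<ge> 0" unfolding K_def using B0 by simp
  have lip: "norm (Q w - Q w') \<le> K * cmod (w - w')"
    if w: "w \<in> ball z (\<rho>/4)" "w' \<in> ball z (\<rho>/4)" "w \<noteq> z" "w' \<noteq> z" for w w'
  proof (rule norm_le_of_cinner)
    fix y
    have "cmod (cinner (f w) y) \<le> B * norm y" if "w \<in> ball z \<rho>" for w
      using cinner_cauchy_schwarz[of "f w" y] mult_right_mono[OF B, of w "norm y"] sub that by force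
    then have "cmod (inverse (w - z) * (cinner (f w) y - cinner (f z) y)
        - inverse (w' - z) * (cinner (f w') y - cinner (f z) y)) \<le> 32 / \<rho>\<^sup>2 * (B * norm y) * cmod (w - w')"
      by (intro holomorphic_quotient_lipschitz w \<rho>0 holomorphic_on_subset[OF weakly_holomorphicD[OF f] sub])
    then show "cmod (cinner (Q w - Q w') y) \<le> K * cmod (w - w') * norm y"
      by (simp add: Q_def K_def cinner_diff_left cinner_scaleC_left mult_ac)
  qed (use K0 in simp)
  define s where "s n = z + of_real (\<rho> / 8 * inverse (real (Suc n)))" for n
  have s: "s n \<in> ball z (\<rho>/4)" "s n \<noteq> z" for n
  proof -
    have "0 < inverse (real (Suc n))" "inverse (real (Suc n)) \<le> 1" by (auto simp: field_simps)
    then have "\<rho> / 8 * inverse (real (Suc n)) > 0" "\<rho> / 8 * inverse (real (Suc n)) \<le> \<rho>/8"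
      using \<rho>0 by (auto simp: mult_le_cancel_left1 intro: mult_pos_pos)
    then show "s n \<in> ball z (\<rho>/4)" "s n \<noteq> z"
      unfolding s_def using \<rho>0 by (auto simp: dist_norm norm_of_real simp del: of_real_mult of_real_divide of_real_inverse)
  qed
  have slim: "s \<longlonglongrightarrow> z"
  proof -
    have "s \<longlonglongrightarrow> z + of_real (\<rho> / 8 * 0)"
      unfolding s_def by (intro tendsto_intros LIMSEQ_inverse_real_of_nat)
    then show ?thesis by simp
  qed
  have "Cauchy (\<lambda>n. Q (s n))"
  proof (rule metric_CauchyI)
    fix e :: real assume e: "0 < e"
    have "Cauchy s" using slim by (rule LIMSEQ_imp_Cauchy)
    then obtain M where M: "\<forall>m\<ge>M. \<forall>n\<ge>M. dist (s m) (s n) < e / (K + 1)"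
      using e K0 metric_CauchyD[of s "e / (K + 1)"] by auto
    have "dist (Q (s m)) (Q (s n)) < e" if "m \<ge> M" "n \<ge> M" for m n
    proof -
      have "dist (Q (s m)) (Q (s n)) \<le> K * dist (s m) (s n)"
        unfolding dist_norm by (rule lip) (use s in auto)
      also have "\<dots> \<le> K * (e / (K + 1))" using M that K0 by (intro mult_left_mono) (auto intro: less_imp_le)
      also have "\<dots> < e" using K0 e by (simp add: field_simps)
      finally show ?thesis .
    qed
    then show "\<exists>M. \<forall>m\<ge>M. \<forall>n\<ge>M. dist (Q (s m)) (Q (s n)) < e" by blast
  qed
  then obtain d where d: "(\<lambda>n. Q (s n)) \<longlonglongrightarrow> d" using Cauchy_convergent convergent_def by blast
  have est: "norm (Q w - d) \<le> K * cmod (w - z)" if w: "w \<in> ball z (\<rho>/4)" "w \<noteq> z" for w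
  proof (rule LIMSEQ_le)
    show "(\<lambda>n. norm (Q w - Q (s n))) \<longlonglongrightarrow> norm (Q w - d)" by (intro tendsto_intros d)
    show "(\<lambda>n. K * cmod (w - s n)) \<longlonglongrightarrow> K * cmod (w - z)" by (intro tendsto_intros slim)
  qed (use lip w s in auto)
  have "(Q \<longlongrightarrow> d) (at z)"
  proof (rule Lim_null[THEN iffD2], rule Lim_null_comparison)
    show "((\<lambda>w. K * cmod (w - z)) \<longlongrightarrow> 0) (at z)" by (rule tendsto_eq_intros refl | simp)+
    show "\<forall>\<^sub>F w in at z. norm (Q w - d) \<le> K * cmod (w - z)"
      unfolding eventually_at_topological
      by (rule exI[of _ "ball z (\<rho>/4)"]) (use est \<rho>0 in auto)
  qed
  then have "has_cderiv f d z" unfolding has_cderiv_def Q_def .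
  then show ?thesis using that est unfolding Q_def K_def by blast
qed

lemma weakly_holomorphic_continuous:
  assumes "weakly_holomorphic f" "\<And>w. w \<in> unit_disk \<Longrightarrow> norm (f w) \<le> B"
  shows "continuous_on unit_disk f"
proof (intro continuous_at_imp_continuous_on ballI)
  fix z assume "z \<in> unit_disk"
  then obtain d where "has_cderiv f d z" using weakly_holomorphic_cderiv[OF assms] by blast
  then show "isCont f z" by (rule has_cderiv_continuous)
qed

text \<open>The rate in \<open>weakly_holomorphic_cderiv\<close> is proportional to
  \<open>\<bar>B\<bar> * norm x\<close>, so the pointwise quotients converge in operator norm. This
  is the way back from scalar holomorphy to the definition of the Schur class.\<close>

lemma op_holomorphicI:
  fixes F :: "complex \<Rightarrow> 'a::complex_hilbert \<Rightarrow> 'b::complex_hilbert"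
  assumes U: "closed_csubspace U" and V: "closed_csubspace V"
    and F: "\<And>z. z \<in> unit_disk \<Longrightarrow> F z \<in> bounded_ops U V"
    and B: "\<And>z x. z \<in> unit_disk \<Longrightarrow> x \<in> U \<Longrightarrow> norm (F z x) \<le> B * norm x"
    and h: "\<And>x. x \<in> U \<Longrightarrow> weakly_holomorphic (\<lambda>z. F z x)"
  shows "op_holomorphic U V F"
  unfolding op_holomorphic_def
proof (intro conjI ballI F)
  fix z assume z: "z \<in> unit_disk"
  define \<rho> where "\<rho> = 1 - cmod z"
  have \<rho>0: "\<rho> > 0" using z unfolding \<rho>_def by simp
  have B': "norm (F z x) \<le> \<bar>B\<bar> * norm x" if "z \<in> unit_disk" "x \<in> U" for z x
    using B[OF that] by (meson abs_ge_self mult_right_mono norm_ge_zero order_trans)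
  define K where "K = 32 / \<rho>\<^sup>2 * \<bar>B\<bar>"
  have K0: "K \<ge> 0" unfolding K_def by simp
  have "\<exists>d. has_cderiv (\<lambda>w. F w x) d z \<and> (\<forall>w. w \<in> ball z (\<rho>/4) \<longrightarrow> w \<noteq> z \<longrightarrow>
       norm (inverse (w - z) *\<^sub>C (F w x - F z x) - d) \<le> K * norm x * cmod (w - z))" if x: "x \<in> U" for x
  proof -
    obtain d where "has_cderiv (\<lambda>w. F w x) d z"
      "\<And>w. w \<in> ball z (\<rho>/4) \<Longrightarrow> w \<noteq> z \<Longrightarrow>
       norm (inverse (w - z) *\<^sub>C (F w x - F z x) - d) \<le> 32 / \<rho>\<^sup>2 * (\<bar>B\<bar> * norm x) * cmod (w - z)"
      using weakly_holomorphic_cderiv[OF h[OF x] _ z \<rho>_def, of "\<bar>B\<bar> * norm x"] B'[OF _ x] by blast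
    then show ?thesis unfolding K_def mult.assoc by blast
  qed
  then obtain A where A: "\<And>x. x \<in> U \<Longrightarrow> has_cderiv (\<lambda>w. F w x) (A x) z"
    and est: "\<And>x w. x \<in> U \<Longrightarrow> w \<in> ball z (\<rho>/4) \<Longrightarrow> w \<noteq> z \<Longrightarrow>
       norm (inverse (w - z) *\<^sub>C (F w x - F z x) - A x) \<le> K * norm x * cmod (w - z)" by metis
  have ev: "\<forall>\<^sub>F w in at z. w \<in> unit_disk"
    by (rule eventually_at_in_open'[OF open_ball z])
  have lim: "((\<lambda>w. inverse (w - z) *\<^sub>C (F w x - F z x)) \<longlongrightarrow> A x) (at z)" if "x \<in> U" for x
    using A[OF that] unfolding has_cderiv_def .
  \<comment> \<open>Any fixed point near \<open>z\<close> would do: the rate at \<open>w0\<close>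
    bounds the derivative \<open>A x\<close> by a multiple of \<open>norm x\<close>.\<close>
  define w0 where "w0 = z + of_real (\<rho>/8)"
  have w0: "w0 \<in> ball z (\<rho>/4)" "w0 \<noteq> z"
    unfolding w0_def using \<rho>0 by (auto simp: dist_norm norm_of_real simp del: of_real_divide)
  have w0d: "w0 \<in> unit_disk"
    using w0 norm_triangle_ineq[of z "w0 - z"] \<rho>0 unfolding \<rho>_def
    by (simp add: dist_norm norm_minus_commute)
  have Abd: "A \<in> bounded_ops U V"
  proof (rule bounded_opsI[where K = "cmod (inverse (w0 - z)) * (\<bar>B\<bar> + \<bar>B\<bar>) + K * cmod (w0 - z)"])
    fix x assume x: "x \<in> U"
    show "A x \<in> V"
      by (rule csubspace_lim[OF V lim[OF x]])
        (simp, rule eventually_mono[OF ev], intro csubspace_scaleC[OF V] csubspace_diff[OF V]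
          bounded_ops_mem[OF F] z x)
    show "A (c *\<^sub>C x) = c *\<^sub>C A x" for c
    proof (rule tendsto_unique[OF _ lim[OF csubspace_scaleC[OF U x]]])
      have "((\<lambda>w. c *\<^sub>C (inverse (w - z) *\<^sub>C (F w x - F z x))) \<longlongrightarrow> c *\<^sub>C A x) (at z)"
        by (intro tendsto_intros lim x)
      then show "((\<lambda>w. inverse (w - z) *\<^sub>C (F w (c *\<^sub>C x) - F z (c *\<^sub>C x))) \<longlongrightarrow> c *\<^sub>C A x) (at z)"
        by (rule Lim_transform_eventually) (rule eventually_mono[OF ev],
          simp only: bounded_ops_scaleC[OF F x] z scaleC_diff_right scaleC_scaleC mult.commute)
    qed simp
    show "A (x + y) = A x + A y" if y: "y \<in> U" for y
    proof (rule tendsto_unique[OF _ lim[OF csubspace_add[OF U x y]]])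
      have "((\<lambda>w. inverse (w - z) *\<^sub>C (F w x - F z x) + inverse (w - z) *\<^sub>C (F w y - F z y)) \<longlongrightarrow> A x + A y) (at z)"
        by (intro tendsto_intros lim x y)
      then show "((\<lambda>w. inverse (w - z) *\<^sub>C (F w (x + y) - F z (x + y))) \<longlongrightarrow> A x + A y) (at z)"
        by (rule Lim_transform_eventually) (rule eventually_mono[OF ev],
          simp only: bounded_ops_add[OF F x y] z, simp add: scaleC_diff_right scaleC_add_right)
    qed simp
    have "norm (A x) \<le> norm (inverse (w0 - z) *\<^sub>C (F w0 x - F z x)) +
        norm (inverse (w0 - z) *\<^sub>C (F w0 x - F z x) - A x)"
      using norm_triangle_sub[of "A x" "inverse (w0 - z) *\<^sub>C (F w0 x - F z x)"]
      by (simp add: norm_minus_commute)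
    also have "\<dots> \<le> cmod (inverse (w0 - z)) * (\<bar>B\<bar> * norm x + \<bar>B\<bar> * norm x) + K * norm x * cmod (w0 - z)"
      unfolding norm_scaleC
      using B'[OF w0d x] B'[OF z x] norm_triangle_ineq4[of "F w0 x" "F z x"]
      by (intro add_mono mult_left_mono est x w0) auto
    finally show "norm (A x) \<le> (cmod (inverse (w0 - z)) * (\<bar>B\<bar> + \<bar>B\<bar>) + K * cmod (w0 - z)) * norm x"
      by (simp add: algebra_simps)
  qed
  have "((\<lambda>w. op_norm U (\<lambda>x. inverse (w - z) *\<^sub>C (F w x - F z x) - A x)) \<longlongrightarrow> 0) (at z)"
  proof (rule Lim_null_comparison)
    show "((\<lambda>w. K * cmod (w - z)) \<longlongrightarrow> 0) (at z)" by (rule tendsto_eq_intros refl | simp)+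
    have "norm (op_norm U (\<lambda>x. inverse (w - z) *\<^sub>C (F w x - F z x) - A x)) \<le> K * cmod (w - z)"
      if w: "w \<in> ball z (\<rho>/4)" "w \<noteq> z" for w
    proof -
      have e: "norm (inverse (w - z) *\<^sub>C (F w x - F z x) - A x) \<le> K * cmod (w - z) * norm x" if "x \<in> U" for x
        using est[OF that w] by (simp add: mult_ac)
      show ?thesis
        using op_norm_le[OF csubspace_zero[OF U] e] op_norm_nonneg[OF csubspace_zero[OF U] e] K0 by simp
    qed
    then show "\<forall>\<^sub>F w in at z. norm (op_norm U (\<lambda>x. inverse (w - z) *\<^sub>C (F w x - F z x) - A x)) \<le> K * cmod (w - z)"
      unfolding eventually_at_topological
      by (intro exI[of _ "ball z (\<rho>/4)"]) (use \<rho>0 in auto)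
  qed
  then show "\<exists>A\<in>bounded_ops U V.
      ((\<lambda>w. op_norm U (\<lambda>x. inverse (w - z) *\<^sub>C (F w x - F z x) - A x)) \<longlongrightarrow> 0) (at z)"
    using Abd by blast
qed

text \<open>Product rule for a moving functional at a moving vector. The bound
  \<open>C / (1 - cmod z)\<close> is locally uniform, so \<open>q w\<close> applied to vectors
  tending to 0 tends to 0.\<close>

lemma holomorphic_eval:
  fixes q :: "complex \<Rightarrow> 'a::complex_hilbert \<Rightarrow> complex"
  assumes U: "closed_csubspace U"
    and hol: "\<And>y. y \<in> U \<Longrightarrow> (\<lambda>z. q z y) holomorphic_on unit_disk"
    and add: "\<And>z x y. z \<in> unit_disk \<Longrightarrow> x \<in> U \<Longrightarrow> y \<in> U \<Longrightarrow> q z (x + y) = q z x + q z y"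
    and scale: "\<And>z c x. z \<in> unit_disk \<Longrightarrow> x \<in> U \<Longrightarrow> q z (c *\<^sub>C x) = c * q z x"
    and bd: "\<And>z x. z \<in> unit_disk \<Longrightarrow> x \<in> U \<Longrightarrow> cmod (q z x) \<le> C / (1 - cmod z) * norm x"
    and R: "\<And>z. z \<in> unit_disk \<Longrightarrow> R z \<in> U"
    and R': "\<And>z. z \<in> unit_disk \<Longrightarrow> \<exists>d\<in>U. has_cderiv R d z"
  shows "(\<lambda>z. q z (R z)) holomorphic_on unit_disk"
  unfolding holomorphic_on_open[OF open_ball]
proof (intro ballI)
  fix z assume z: "z \<in> unit_disk"
  obtain d where d: "d \<in> U" "has_cderiv R d z" using R'[OF z] by blast
  let ?Q = "\<lambda>w. inverse (w - z) *\<^sub>C (R w - R z)"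
  have Qlim: "(?Q \<longlongrightarrow> d) (at z)" using d unfolding has_cderiv_def by blast
  have ev: "\<forall>\<^sub>F w in at z. w \<in> unit_disk"
    by (rule eventually_at_in_open'[OF open_ball z])
  have diff: "q w (x - y) = q w x - q w y" if "w \<in> unit_disk" "x \<in> U" "y \<in> U" for w x y
    using add[of w x "-y"] scale[of w y "-1"] that csubspace_minus[OF U] by (simp add: scaleC_minus_one)
  have QU: "?Q w \<in> U" if "w \<in> unit_disk" for w
    by (intro csubspace_scaleC csubspace_diff U R that z)
  have q1: "((\<lambda>w. q w d) \<longlongrightarrow> q z d) (at z)"
    using holomorphic_on_imp_continuous_on[OF hol[OF d(1)]] z open_ball
    by (metis continuous_on_eq_continuous_at isCont_def)
  have q2: "((\<lambda>w. q w (?Q w - d)) \<longlongrightarrow> 0) (at z)"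
  proof (rule Lim_null_comparison)
    show "\<forall>\<^sub>F w in at z. norm (q w (?Q w - d)) \<le> C / (1 - cmod w) * norm (?Q w - d)"
      using ev by eventually_elim (intro bd csubspace_diff[OF U] QU d)
    have "((\<lambda>w. C / (1 - cmod w) * norm (?Q w - d)) \<longlongrightarrow> C / (1 - cmod z) * norm (d - d)) (at z)"
      by (intro tendsto_intros Qlim) (use z in auto)
    then show "((\<lambda>w. C / (1 - cmod w) * norm (?Q w - d)) \<longlongrightarrow> 0) (at z)" by simp
  qed
  obtain e where e: "((\<lambda>w. q w (R z)) has_field_derivative e) (at z)"
    using hol[OF R[OF z]] z unfolding holomorphic_on_open[OF open_ball] by blast
  then have q3: "((\<lambda>w. (q w (R z) - q z (R z)) / (w - z)) \<longlongrightarrow> e) (at z)"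
    unfolding has_field_derivative_iff .
  \<comment> \<open>\<open>q w (R w) - q z (R z)\<close> is split into the change of the vector,
    \<open>q w (R w - R z)\<close>, and the change of the functional at the fixed vector
    \<open>R z\<close>.\<close>
  have "((\<lambda>w. q w (?Q w - d) + q w d + (q w (R z) - q z (R z)) / (w - z)) \<longlongrightarrow> 0 + q z d + e) (at z)"
    by (intro tendsto_intros q1 q2 q3)
  then have "((\<lambda>w. (q w (R w) - q z (R z)) / (w - z)) \<longlongrightarrow> 0 + q z d + e) (at z)"
  proof (rule Lim_transform_eventually)
    show "\<forall>\<^sub>F w in at z. q w (?Q w - d) + q w d + (q w (R z) - q z (R z)) / (w - z) = (q w (R w) - q z (R z)) / (w - z)"
      using ev
    proof eventually_elim
      fix w assume w: "w \<in> unit_disk"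
      have "q w (?Q w - d) = inverse (w - z) * (q w (R w) - q w (R z)) - q w d"
        using diff[OF w QU[OF w] d(1)] scale[OF w] diff[OF w R[OF w] R[OF z]]
          csubspace_diff[OF U R[OF w] R[OF z]] by simp
      then show "q w (?Q w - d) + q w d + (q w (R z) - q z (R z)) / (w - z) = (q w (R w) - q z (R z)) / (w - z)"
        by (simp add: divide_inverse algebra_simps)
    qed
  qed
  then show "\<exists>f'. ((\<lambda>z. q z (R z)) has_field_derivative f') (at z)"
    unfolding has_field_derivative_iff by blast
qed

section \<open>Poisson kernel estimates on Stolz regions and a weak type maximal inequality\<close>

section \<open>The Poisson integral and the nontangential maximal function\<close>

text \<open>Normalized to total mass \<open>2 * pi\<close> over a period, not to 1.\<close>

definition poisson_kernel :: "complex \<Rightarrow> real \<Rightarrow> real" where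
  "poisson_kernel z t = (1 - (cmod z)\<^sup>2) / (cmod (cis t - z))\<^sup>2"

lemma cis_neq_disk: "cmod z < 1 \<Longrightarrow> cis t \<noteq> z"
  using norm_cis[of t] by auto

lemma poisson_kernel_nonneg: "cmod z < 1 \<Longrightarrow> 0 \<le> poisson_kernel z t"
  unfolding poisson_kernel_def by (simp add: power_le_one)

lemma continuous_on_poisson_kernel [continuous_intros]:
  "cmod z < 1 \<Longrightarrow> continuous_on A (poisson_kernel z)"
  unfolding poisson_kernel_def using cis_neq_disk by (intro continuous_intros) auto

text \<open>Cauchy's formula for \<open>h(w) (1 - |z|\<^sup>2)/(1 - cnj z w)\<close>, which agrees with \<open>h\<close> at \<open>z\<close>.\<close>

lemma poisson_formula:
  fixes h :: "complex \<Rightarrow> complex"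
  assumes h: "h holomorphic_on ball 0 R" and R: "1 < R" and z: "cmod z < 1"
  shows "((\<lambda>t. complex_of_real (poisson_kernel z t) * h (cis t)) has_integral (2 * pi * h z)) {0..2*pi}"
proof -
  define F where "F w = h w * (1 - z * cnj z) / (1 - cnj z * w)" for w
  have ne: "1 - cnj z * w \<noteq> 0" if "cmod w \<le> 1" for w
  proof
    assume "1 - cnj z * w = 0"
    then have "cmod (cnj z * w) = 1" by (metis eq_iff_diff_eq_0 norm_one)
    moreover have "cmod (cnj z * w) \<le> cmod z * 1"
      using that by (simp only: norm_mult complex_mod_cnj) (intro mult_left_mono, auto)
    ultimately show False using z by simp
  qed
  have "h holomorphic_on cball 0 1" by (rule holomorphic_on_subset[OF h]) (use R in auto)
  then have "F holomorphic_on cball 0 1"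
    unfolding F_def using ne by (intro holomorphic_intros) auto
  from Cauchy_integral_circlepath_simple[OF this, of z]
  have "((\<lambda>u. F u / (u - z)) has_contour_integral 2 * of_real pi * \<i> * F z) (part_circlepath 0 1 0 (2*pi))"
    using z by (simp add: circlepath_def)
  then have 1: "((\<lambda>t. F (0 + of_real 1 * cis t) / (0 + of_real 1 * cis t - z) * of_real 1 * \<i> * cis t)
      has_integral 2 * of_real pi * \<i> * F z) {0..2*pi}"
    by (subst (asm) has_contour_integral_part_circlepath_iff) auto
  have Fz: "F z = h z" using ne[of z] z by (simp add: F_def mult.commute)
  have 2: "(-\<i>) * (F (0 + of_real 1 * cis t) / (0 + of_real 1 * cis t - z) * of_real 1 * \<i> * cis t)
     = complex_of_real (poisson_kernel z t) * h (cis t)" for t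
  proof -
    have c1: "cis t * cnj (cis t) = 1" by (simp add: cis_cnj cis_mult)
    have nz: "cis t - z \<noteq> 0" using cis_neq_disk[OF z] by simp
    have "(1 - cnj z * cis t) = cis t * cnj (cis t - z)"
      using c1 by (simp add: algebra_simps)
    then have "F (cis t) / (cis t - z) * cis t = h (cis t) * (1 - z * cnj z) / (cnj (cis t - z) * (cis t - z))"
      using nz unfolding F_def by (simp add: divide_simps)
    also have "\<dots> = complex_of_real (poisson_kernel z t) * h (cis t)"
      unfolding poisson_kernel_def of_real_divide of_real_diff complex_norm_square
      by (simp add: mult.commute)
    finally show ?thesis by (simp add: mult_ac)
  qed
  have 3: "(-\<i>) * (2 * of_real pi * \<i> * F z) = 2 * pi * h z" by (simp add: Fz)
  from has_integral_mult_right[OF 1, of "-\<i>"] show ?thesis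
    unfolding 2 3 .
qed

lemma poisson_kernel_integral:
  assumes "cmod z < 1"
  shows "(poisson_kernel z has_integral (2 * pi)) {0..2*pi}"
proof -
  have "((\<lambda>t. complex_of_real (poisson_kernel z t) * 1) has_integral (2 * pi * 1)) {0..2*pi}"
    using poisson_formula[of "\<lambda>_. 1" 2 z] assms by simp
  from has_integral_Re[OF this] show ?thesis by simp
qed

text \<open>A rotation moves the window to one centred at \<open>t0\<close>, so that
  \<open>\<bar>t - t0\<bar> \<le> pi\<close> holds throughout, as the chord estimate
  requires.\<close>

lemma poisson_formula_shifted:
  fixes h :: "complex \<Rightarrow> complex"
  assumes h: "h holomorphic_on ball 0 R" and R: "1 < R" and z: "cmod z < 1"
  shows "((\<lambda>t. complex_of_real (poisson_kernel z t) * h (cis t)) has_integral (2 * pi * h z)) {t0-pi..t0+pi}"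
proof -
  \<comment> \<open>\<open>u\<close> inverts the rotation by \<open>- cis t0\<close>; this rotation
    sends the midpoint \<open>pi\<close> of \<open>{0..2*pi}\<close> to the angle
    \<open>t0\<close>.\<close>
  define u where "u = - cis (- t0)"
  have u: "cmod u = 1" "- cis t0 * u = 1" unfolding u_def by (auto simp: cis_mult)
  have "(\<lambda>w. h (- cis t0 * w)) holomorphic_on ball 0 R"
    by (rule holomorphic_on_compose_gen[of "\<lambda>w. - cis t0 * w" _ h "ball 0 R", unfolded o_def])
      (auto intro!: holomorphic_intros h simp: norm_mult)
  from poisson_formula[OF this R, of "u * z"] u z
  have "((\<lambda>t. complex_of_real (poisson_kernel (u * z) t) * h (- cis t0 * cis t)) has_integral
      2 * pi * h (- cis t0 * (u * z))) {0..2*pi}" by (simp add: norm_mult)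
  from has_integral_shift_real_ivl[OF this, of "pi - t0"]
  have *: "((\<lambda>t. complex_of_real (poisson_kernel (u * z) (t + (pi - t0))) * h (- cis t0 * cis (t + (pi - t0))))
      has_integral 2 * pi * h (- cis t0 * (u * z))) {0 - (pi - t0)..2*pi - (pi - t0)}" .
  have e1: "- cis t0 * cis (t + (pi - t0)) = cis t" for t
  proof -
    have "- cis t0 * cis (t + (pi - t0)) = - cis (t + pi)" by (simp add: cis_mult)
    then show ?thesis by (simp add: complex_eq_iff)
  qed
  have e2: "cmod (cis (t + (pi - t0)) - u * z) = cmod (cis t - z)" for t
  proof -
    have "cmod (cis (t + (pi - t0)) - u * z) = cmod (- cis t0) * cmod (cis (t + (pi - t0)) - u * z)" by simp
    also have "\<dots> = cmod (- cis t0 * cis (t + (pi - t0)) - (- cis t0 * u) * z)"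
      by (simp only: norm_mult[symmetric] right_diff_distrib mult.assoc)
    finally show ?thesis unfolding e1 u by simp
  qed
  have e3: "poisson_kernel (u * z) (t + (pi - t0)) = poisson_kernel z t" for t
    unfolding poisson_kernel_def e2 by (simp add: norm_mult u)
  have e4: "- cis t0 * (u * z) = z" using u by (metis mult.assoc mult.left_neutral)
  have e5: "{0 - (pi - t0)..2*pi - (pi - t0)} = {t0-pi..t0+pi}" by auto
  show ?thesis using * unfolding e1 e3 e4 e5 .
qed

text \<open>Subharmonicity of the squared norm, derived from the holomorphic case: \<open>h\<close>
  is the square of the pairing with the fixed vector \<open>c = f (\<rho> * z)\<close>. Then
  \<open>h z\<close> has modulus \<open>norm c ^ 4\<close>, while on the circle \<open>h\<close> is
  at most \<open>(norm c)\<^sup>2\<close> times the squared norm of \<open>f\<close>, and one factor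
  \<open>(norm c)\<^sup>2\<close> cancels. The dilation by \<open>\<rho>\<close> makes
  \<open>h\<close> holomorphic beyond the closed disk.\<close>

lemma poisson_norm_square:
  fixes f :: "complex \<Rightarrow> 'a::complex_hilbert" and \<rho> :: real and z :: complex
  assumes f: "weakly_holomorphic f" and cont: "continuous_on unit_disk f"
    and \<rho>: "0 < \<rho>" "\<rho> < 1" and z: "cmod z < 1"
  shows "2 * pi * (norm (f (\<rho> * z)))\<^sup>2 \<le>
    integral {t0-pi..t0+pi} (\<lambda>t. poisson_kernel z t * (norm (f (\<rho> * cis t)))\<^sup>2)"
proof (cases "f (\<rho> * z) = 0")
  case True
  then show ?thesis
    using poisson_kernel_nonneg[OF z] \<rho> by (auto intro!: Henstock_Kurzweil_Integration.integral_nonneg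
        integrable_continuous_interval continuous_intros continuous_on_compose2[OF cont] z simp: norm_mult)
next
  case False
  define c where "c = f (\<rho> * z)"
  define h where "h w = (cinner (f (\<rho> * w)) c)\<^sup>2" for w :: complex
  define G where "G t = (norm (f (\<rho> * cis t)))\<^sup>2" for t
  have "(\<lambda>w::complex. cinner (f (\<rho> * w)) c) holomorphic_on ball 0 (1/\<rho>)"
    by (rule holomorphic_on_compose_gen[of "\<lambda>w::complex. \<rho> * w" _ "\<lambda>w. cinner (f w) c" unit_disk, unfolded o_def])
      (use \<rho> in \<open>auto intro!: holomorphic_intros weakly_holomorphicD[OF f] simp: norm_mult field_simps\<close>)
  then have "h holomorphic_on ball 0 (1/\<rho>)" unfolding h_def by (intro holomorphic_intros)
  from poisson_formula_shifted[OF this _ z, of t0] \<rho>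
  have I: "((\<lambda>t. complex_of_real (poisson_kernel z t) * h (cis t)) has_integral (2 * pi * h z)) {t0-pi..t0+pi}"
    by (simp add: field_simps)
  have Gc: "continuous_on A G" for A
    unfolding G_def
    by (intro continuous_intros continuous_on_compose2[OF cont]) (use \<rho> in \<open>auto simp: norm_mult\<close>)
  have int: "(\<lambda>t. poisson_kernel z t * G t) integrable_on {t0-pi..t0+pi}"
    by (intro integrable_continuous_interval continuous_intros Gc z)
  have "norm (integral {t0-pi..t0+pi} (\<lambda>t. complex_of_real (poisson_kernel z t) * h (cis t)))
      \<le> integral {t0-pi..t0+pi} (\<lambda>t. (norm c)\<^sup>2 * (poisson_kernel z t * G t))"
  proof (rule Henstock_Kurzweil_Integration.integral_norm_bound_integral)
    show "(\<lambda>t. complex_of_real (poisson_kernel z t) * h (cis t)) integrable_on {t0-pi..t0+pi}"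
      using I by blast
    show "(\<lambda>t. (norm c)\<^sup>2 * (poisson_kernel z t * G t)) integrable_on {t0-pi..t0+pi}"
      using int by (rule integrable_on_mult_right)
    fix t
    have "cmod (h (cis t)) \<le> (norm (f (\<rho> * cis t)) * norm c)\<^sup>2"
      unfolding h_def norm_power by (intro power_mono cinner_cauchy_schwarz) simp
    then have "poisson_kernel z t * cmod (h (cis t)) \<le> poisson_kernel z t * (G t * (norm c)\<^sup>2)"
      unfolding G_def by (intro mult_left_mono poisson_kernel_nonneg z) (simp add: power_mult_distrib)
    then show "norm (complex_of_real (poisson_kernel z t) * h (cis t)) \<le> (norm c)\<^sup>2 * (poisson_kernel z t * G t)"
      using poisson_kernel_nonneg[OF z, of t] by (simp add: norm_mult mult_ac)
  qed
  also have "\<dots> = (norm c)\<^sup>2 * integral {t0-pi..t0+pi} (\<lambda>t. poisson_kernel z t * G t)"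
    by (rule integral_mult_right)
  also have "integral {t0-pi..t0+pi} (\<lambda>t. complex_of_real (poisson_kernel z t) * h (cis t)) = 2 * pi * h z"
    using I by (rule integral_unique)
  also have "norm (2 * pi * h z) = (norm c)\<^sup>2 * (2 * pi * (norm c)\<^sup>2)"
  proof -
    have "h z = complex_of_real ((norm c)\<^sup>2) * complex_of_real ((norm c)\<^sup>2)"
      unfolding h_def c_def[symmetric] cinner_self power2_eq_square ..
    then have "norm (h z) = (norm c)\<^sup>2 * (norm c)\<^sup>2" by (simp only: norm_mult norm_of_real abs_power2)
    then show ?thesis by (simp add: norm_mult)
  qed
  finally have "(norm c)\<^sup>2 * (2 * pi * (norm c)\<^sup>2) \<le>
      (norm c)\<^sup>2 * integral {t0-pi..t0+pi} (\<lambda>t. poisson_kernel z t * G t)" .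
  moreover have "(norm c)\<^sup>2 > 0" using False by (simp add: c_def)
  ultimately show ?thesis unfolding c_def G_def by (simp add: mult_le_cancel_left_pos)
qed

text \<open>The constant 1/4 is crude but splits easily: up to \<open>pi/3\<close> the derivative
  \<open>cos x - 1/4\<close> is positive, and beyond it
  \<open>sin x \<ge> 1/2 \<ge> x/4\<close>.\<close>

lemma sin_ge_quarter:
  assumes "0 \<le> x" "x \<le> pi/2"
  shows "x / 4 \<le> sin x"
proof (cases "x \<le> pi/3")
  case True
  have "sin 0 - 0/4 \<le> sin x - x/4"
  proof (rule DERIV_nonneg_imp_nondecreasing[OF assms(1)])
    fix y assume y: "0 \<le> y" "y \<le> x"
    have "cos (pi/3) \<le> cos y" using y True by (intro cos_monotone_0_pi_le) auto
    then have "0 \<le> cos y - 1/4" by (simp add: cos_60)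
    moreover have "((\<lambda>x. sin x - x/4) has_real_derivative cos y - 1/4) (at y)"
      by (auto intro!: derivative_eq_intros)
    ultimately show "\<exists>d. ((\<lambda>x. sin x - x/4) has_real_derivative d) (at y) \<and> 0 \<le> d" by blast
  qed
  then show ?thesis by simp
next
  case False
  then have "sin (pi/6) \<le> sin x" using assms by (intro sin_monotone_2pi_le) auto
  moreover have "x / 4 \<le> 1/2" using assms pi_less_4 by simp
  ultimately show ?thesis by (simp add: sin_30)
qed

lemma cis_chord:
  assumes "\<bar>s\<bar> \<le> pi"
  shows "\<bar>s\<bar> / 4 \<le> cmod (cis s - 1)"
proof -
  have pos: "s / 4 \<le> cmod (cis s - 1)" if s: "0 \<le> s" "s \<le> pi" for s
  proof -
    have "(cmod (cis s - 1))\<^sup>2 = 2 - 2 * cos s"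
      using sin_cos_squared_add[of s] by (simp add: cmod_power2 power2_diff algebra_simps)
    also have "\<dots> = (2 * sin (s/2))\<^sup>2"
      using cos_double_sin[of "s/2"] by (simp add: power2_eq_square)
    finally have "cmod (cis s - 1) = 2 * sin (s/2)"
      by (rule power2_eq_imp_eq) (use s sin_ge_zero[of "s/2"] in auto)
    then show ?thesis using sin_ge_quarter[of "s/2"] s by simp
  qed
  show ?thesis
  proof (cases "0 \<le> s")
    case True then show ?thesis using pos[of s] assms by simp
  next
    case False
    have "cmod (cis s - 1) = cmod (cis (-s) - 1)"
      by (metis cis_cnj complex_cnj_diff complex_cnj_one complex_mod_cnj)
    then show ?thesis using pos[of "-s"] False assms by simp
  qed
qed

text \<open>On the Stolz region \<open>|cis t - z| \<ge> max (1 - |z|) |t - t0| / b\<close>; the sum on the right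
  majorizes the resulting kernel by its dyadic layers.\<close>

lemma poisson_kernel_dyadic:
  assumes a: "1 < a" and z: "z \<in> stolz_region a (cis t0)" and t: "\<bar>t - t0\<bar> \<le> pi"
    and hd: "h = 1 - cmod z" and N: "pi \<le> 2 ^ N * h"
  shows "poisson_kernel z t \<le>
    (\<Sum>k\<le>N. (2 * (4 * (1 + a))\<^sup>2 * 4 / (4 ^ k * h)) * indicator (cball t0 (2 ^ k * h)) t)"
proof -
  \<comment> \<open>From \<open>\<bar>s\<bar> / 4 \<le> d + a * h\<close> (chord estimate and
    aperture) and \<open>h \<le> d\<close> follows \<open>\<bar>s\<bar> \<le> b * d\<close>.\<close>
  define b where "b = 4 * (1 + a)"
  define s where "s = t - t0"
  define d where "d = cmod (cis t - z)"
  have b: "b \<ge> 1" unfolding b_def using a by simp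
  have h: "0 < h" "h \<le> 1" using z hd unfolding stolz_region_def by auto
  have d1: "h \<le> d"
    unfolding d_def hd using norm_triangle_ineq2[of "cis t" z] by simp
  have "\<bar>s\<bar> / 4 \<le> cmod (cis s - 1)" by (rule cis_chord) (use t s_def in simp)
  also have "\<dots> = cmod (cis t0 * (cis s - 1))" by (simp add: norm_mult)
  also have "cis t0 * (cis s - 1) = (cis t - z) + (z - cis t0)"
    unfolding s_def by (simp add: right_diff_distrib cis_mult)
  also have "cmod \<dots> \<le> d + cmod (z - cis t0)" unfolding d_def by (rule norm_triangle_ineq)
  also have "cmod (z - cis t0) \<le> a * h" using z unfolding stolz_region_def hd dist_norm by auto
  also have "a * h \<le> a * d" using a d1 by simp
  finally have d2: "\<bar>s\<bar> \<le> b * d" unfolding b_def by (simp add: algebra_simps)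
  have d0: "d > 0" using d1 h by simp
  have P: "poisson_kernel z t \<le> 2 * h / d\<^sup>2"
  proof -
    have "1 - (cmod z)\<^sup>2 = h * (1 + cmod z)" unfolding hd by (simp add: power2_eq_square algebra_simps)
    also have "\<dots> \<le> h * 2" using h hd by (intro mult_left_mono) auto
    finally show ?thesis unfolding poisson_kernel_def d_def[symmetric] by (intro divide_right_mono) auto
  qed
  have term0: "0 \<le> (2 * b\<^sup>2 * 4 / (4 ^ k * h)) * indicator (cball t0 (2 ^ k * h)) t" for k
    using h by simp
  have ex: "\<exists>k\<le>N. \<bar>s\<bar> \<le> 2 ^ k * h" using N t s_def by (intro exI[of _ N]) auto
  \<comment> \<open>The first dyadic layer that reaches \<open>t\<close>. For \<open>k > 0\<close>
    minimality gives \<open>2 ^ (k - 1) * h < \<bar>s\<bar>\<close>, so \<open>2 ^ k * h\<close> is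
    at most \<open>2 * (b * d)\<close> and the term of this layer alone dominates the
    kernel.\<close>
  define k where "k = (LEAST k. \<bar>s\<bar> \<le> 2 ^ k * h)"
  have k1: "\<bar>s\<bar> \<le> 2 ^ k * h" unfolding k_def using ex by (metis (no_types, lifting) LeastI)
  have k2: "k \<le> N" unfolding k_def using ex by (meson Least_le order_trans)
  have k3: "k = 0 \<or> 2 ^ (k - 1) * h < \<bar>s\<bar>"
    using not_less_Least[of "k - 1" "\<lambda>k. \<bar>s\<bar> \<le> 2 ^ k * h"] unfolding k_def[symmetric] by force
  have bd: "2 ^ k * h \<le> 2 * (b * d)"
  proof (cases "k = 0")
    case True
    have "h \<le> b * d" using d1 b d0 by (metis mult_le_cancel_right1 order_less_le order_trans linorder_not_less)
    then show ?thesis using True h by simp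
  next
    case False
    then have "2 ^ k = 2 * (2::real) ^ (k - 1)" by (metis power_eq_if)
    then show ?thesis using k3 False d2 by simp
  qed
  have "2 * h / d\<^sup>2 \<le> 2 * b\<^sup>2 * 4 / (4 ^ k * h)"
  proof -
    have "(2 ^ k * h)\<^sup>2 \<le> (2 * (b * d))\<^sup>2" using bd h by (intro power_mono) auto
    then have "4 ^ k * h * h \<le> 4 * b\<^sup>2 * d\<^sup>2"
      by (simp add: power_mult_distrib power2_eq_square mult_ac flip: power_mult_distrib)
    then show ?thesis using h d0 by (simp add: field_simps)
  qed
  also have "\<dots> = (2 * b\<^sup>2 * 4 / (4 ^ k * h)) * indicator (cball t0 (2 ^ k * h)) t"
    using k1 unfolding s_def by (simp add: dist_real_def abs_minus_commute)
  also have "\<dots> \<le> (\<Sum>k\<le>N. (2 * b\<^sup>2 * 4 / (4 ^ k * h)) * indicator (cball t0 (2 ^ k * h)) t)"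
    by (rule member_le_sum[of k]) (use k2 term0 in auto)
  finally show ?thesis using P unfolding b_def by simp
qed

text \<open>\<open>M\<close> stands for the Hardy-Littlewood maximal function of \<open>G\<close> at
  \<open>t0\<close>. The integral over a layer grows like \<open>2 ^ k\<close> while its weight
  decays like \<open>1 / 4 ^ k\<close>, so the layers sum as a geometric series with ratio
  1/2.\<close>

lemma poisson_integral_maximal:
  assumes a: "1 < a" and z: "z \<in> stolz_region a (cis t0)"
    and G: "continuous_on UNIV G" "\<And>t. 0 \<le> G t"
    and M: "\<And>\<delta>. 0 < \<delta> \<Longrightarrow> \<delta> \<le> 2 * pi \<Longrightarrow> integral (cball t0 \<delta>) G \<le> 2 * \<delta> * M"
  shows "integral {t0-pi..t0+pi} (\<lambda>t. poisson_kernel z t * G t) \<le> 32 * (4 * (1 + a))\<^sup>2 * M"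
proof -
  define h where "h = 1 - cmod z"
  define C where "C = 2 * (4 * (1 + a))\<^sup>2 * 4"
  have C0: "C \<ge> 0" unfolding C_def by simp
  have h: "0 < h" "h \<le> 1" using z unfolding stolz_region_def h_def by auto
  have z1: "cmod z < 1" using h h_def by simp
  have Gint: "G integrable_on cball t0 \<delta>" "G integrable_on {x..y}" for \<delta> x y
    using G(1) by (auto simp: cball_eq_atLeastAtMost intro!: integrable_continuous_interval
        intro: continuous_on_subset)
  have M0: "0 \<le> M"
  proof -
    have "0 \<le> integral (cball t0 1) G" by (intro Henstock_Kurzweil_Integration.integral_nonneg Gint G)
    also have "\<dots> \<le> 2 * 1 * M" by (rule M) (use pi_gt3 in auto)
    finally show ?thesis by simp
  qed
  have exN: "\<exists>N. pi \<le> 2 ^ N * h"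
  proof -
    obtain N where "pi / h < 2 ^ N" using real_arch_pow[of 2 "pi/h"] by auto
    then show ?thesis using h by (intro exI[of _ N]) (simp add: field_simps)
  qed
  \<comment> \<open>Least, so that \<open>2 ^ N * h \<le> 2 * pi\<close>: the widest layer covers
    the window, yet its radius stays in the range where \<open>M\<close> is assumed to bound the
    averages.\<close>
  define N where "N = (LEAST N. pi \<le> 2 ^ N * h)"
  have N: "pi \<le> 2 ^ N * h" unfolding N_def using exN by (rule LeastI_ex)
  have N0: "N \<noteq> 0" using N h pi_gt3 by (intro notI) simp
  have "\<not> pi \<le> 2 ^ (N - 1) * h"
    using not_less_Least[of "N - 1" "\<lambda>N. pi \<le> 2 ^ N * h"] N0 unfolding N_def[symmetric] by simp
  moreover have "2 ^ N = 2 * (2::real) ^ (N - 1)" using N0 by (metis power_eq_if)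
  ultimately have N2: "2 ^ N * h \<le> 2 * pi" by simp
  let ?I = "{t0-pi..t0+pi}"
  have layer: "(\<lambda>t. indicator (cball t0 \<delta>) t * G t) integrable_on ?I"
    "integral ?I (\<lambda>t. indicator (cball t0 \<delta>) t * G t) \<le> integral (cball t0 \<delta>) G" for \<delta>
  proof -
    have eq: "(\<lambda>t. indicator (cball t0 \<delta>) t * G t) = (\<lambda>t. if t \<in> cball t0 \<delta> then G t else 0)"
      by (auto simp: indicator_def)
    have int: "G integrable_on (cball t0 \<delta> \<inter> ?I)"
      unfolding cball_eq_atLeastAtMost Int_atLeastAtMost by (rule Gint)
    show "(\<lambda>t. indicator (cball t0 \<delta>) t * G t) integrable_on ?I"
      unfolding eq integrable_restrict_Int by (rule int)
    show "integral ?I (\<lambda>t. indicator (cball t0 \<delta>) t * G t) \<le> integral (cball t0 \<delta>) G"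
      unfolding eq integral_restrict_Int by (rule integral_subset_le[OF _ int Gint(1)]) (use G in auto)
  qed
  have "integral ?I (\<lambda>t. poisson_kernel z t * G t)
      \<le> integral ?I (\<lambda>t. \<Sum>k\<le>N. C / (4 ^ k * h) * (indicator (cball t0 (2 ^ k * h)) t * G t))"
  proof (rule integral_le)
    show "(\<lambda>t. poisson_kernel z t * G t) integrable_on ?I"
      by (intro integrable_continuous_interval continuous_intros z1 continuous_on_subset[OF G(1)]) auto
    show "(\<lambda>t. \<Sum>k\<le>N. C / (4 ^ k * h) * (indicator (cball t0 (2 ^ k * h)) t * G t)) integrable_on ?I"
      by (intro integrable_sum integrable_on_mult_right layer) auto
    fix t assume "t \<in> ?I"
    then have "\<bar>t - t0\<bar> \<le> pi" by auto
    from mult_right_mono[OF poisson_kernel_dyadic[OF a z this h_def N, folded C_def] G(2)[of t]]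
    show "poisson_kernel z t * G t \<le> (\<Sum>k\<le>N. C / (4 ^ k * h) * (indicator (cball t0 (2 ^ k * h)) t * G t))"
      unfolding sum_distrib_right mult.assoc .
  qed
  also have "\<dots> = (\<Sum>k\<le>N. C / (4 ^ k * h) * integral ?I (\<lambda>t. indicator (cball t0 (2 ^ k * h)) t * G t))"
    unfolding integral_mult_right[symmetric]
    by (rule Henstock_Kurzweil_Integration.integral_sum) (intro finite_atMost integrable_on_mult_right layer)+
  also have "\<dots> \<le> (\<Sum>k\<le>N. C / (4 ^ k * h) * (2 * (2 ^ k * h) * M))"
  proof (intro sum_mono mult_left_mono)
    fix k assume "k \<in> {..N}"
    then have "(2::real) ^ k \<le> 2 ^ N" by (intro power_increasing) auto
    then have "2 ^ k * h \<le> 2 * pi" using N2 h by (meson mult_right_mono less_imp_le order_trans)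
    then show "integral ?I (\<lambda>t. indicator (cball t0 (2 ^ k * h)) t * G t) \<le> 2 * (2 ^ k * h) * M"
      using layer(2) M[of "2 ^ k * h"] h by (meson mult_pos_pos order_trans zero_less_numeral zero_less_power)
  qed (use C0 h in auto)
  also have "\<dots> = (\<Sum>k\<le>N. 2 * C * M * (1/2) ^ k)"
  proof (intro sum.cong refl)
    fix k
    have "(4::real) ^ k = 2 ^ k * 2 ^ k" by (simp flip: power_mult_distrib)
    then show "C / (4 ^ k * h) * (2 * (2 ^ k * h) * M) = 2 * C * M * (1/2) ^ k"
      using h by (simp add: field_simps power_one_over)
  qed
  also have "\<dots> = 2 * C * M * (\<Sum>k\<le>N. (1/2) ^ k)" by (simp add: sum_distrib_left)
  also have "\<dots> \<le> 2 * C * M * 2"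
  proof (intro mult_left_mono)
    have "(\<Sum>k\<le>N. (1/2::real) ^ k) = 2 - (1/2) ^ N"
      by (induction N) (auto simp: field_simps)
    then show "(\<Sum>k\<le>N. (1/2::real) ^ k) \<le> 2" by simp
  qed (use C0 M0 in auto)
  finally show ?thesis unfolding C_def by simp
qed

text \<open>Vitali covering: disjoint balls whose fivefold enlargements cover \<open>S\<close>, each
  of length below \<open>1 / s\<close> times the integral of \<open>G\<close> over it. Centres in
  \<open>{0..2*pi}\<close> and radii up to \<open>2*pi\<close> place all of them in
  \<open>{-2*pi..4*pi}\<close>.\<close>

lemma maximal_weak_type:
  fixes G :: "real \<Rightarrow> real"
  assumes G: "continuous_on UNIV G" "\<And>t. 0 \<le> G t" and s: "0 < s"
    and S: "S \<in> sets lebesgue" "S \<subseteq> {0..2*pi}"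
    and big: "\<And>t. t \<in> S \<Longrightarrow> \<exists>\<delta>. 0 < \<delta> \<and> \<delta> \<le> 2*pi \<and> 2 * \<delta> * s < integral (cball t \<delta>) G"
  shows "measure lebesgue S \<le> 5 / s * integral {-2*pi..4*pi} G"
proof -
  have Gint: "G integrable_on cball t \<delta>" "G integrable_on {x..y}" for \<delta> x y t
    using G(1) by (auto simp: cball_eq_atLeastAtMost intro!: integrable_continuous_interval
        intro: continuous_on_subset)
  obtain r where r: "\<And>t. t \<in> S \<Longrightarrow> 0 < r t \<and> r t \<le> 2*pi"
    and rb: "\<And>t. t \<in> S \<Longrightarrow> 2 * r t * s < integral (cball t (r t)) G"
    using big by metis
  have "S \<subseteq> (\<Union>i\<in>S. cball i (r i))" using r by (force intro: less_imp_le)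
  from Vitali_covering_lemma_cballs[OF this r]
  obtain C where C: "countable C" "C \<subseteq> S"
    and disj: "pairwise (\<lambda>i j. disjnt (cball i (r i)) (cball j (r j))) C"
    and cov: "S \<subseteq> (\<Union>i\<in>C. cball i (5 * r i))" by blast
  have fin: "measure lebesgue (\<Union>i\<in>F. cball i (5 * r i)) \<le> 5 / s * integral {-2*pi..4*pi} G"
    if F: "F \<subseteq> C" "finite F" for F
  proof -
    have le: "(\<Sum>i\<in>F. integral (cball i (r i)) G) \<le> integral {-2*pi..4*pi} G"
    proof (rule has_integral_subset_le)
      show "(G has_integral (\<Sum>i\<in>F. integral (cball i (r i)) G)) (\<Union>i\<in>F. cball i (r i))"
      proof (rule has_integral_UN[OF F(2)])
        show "(G has_integral integral (cball i (r i)) G) (cball i (r i))" for i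
          using Gint by blast
        show "pairwise (\<lambda>i i'. negligible (cball i (r i) \<inter> cball i' (r i'))) F"
          using disj F(1) unfolding pairwise_def disjnt_def by (metis negligible_empty subsetD)
      qed
      show "(G has_integral integral {-2*pi..4*pi} G) {-2*pi..4*pi}" using Gint by blast
      show "(\<Union>i\<in>F. cball i (r i)) \<subseteq> {-2*pi..4*pi}"
      proof (intro UN_least)
        fix i assume "i \<in> F"
        then have "i \<in> S" using F C by blast
        then show "cball i (r i) \<subseteq> {-2*pi..4*pi}"
          using r[of i] S(2) by (auto simp: cball_eq_atLeastAtMost)
      qed
    qed (use G in auto)
    have "measure lebesgue (\<Union>i\<in>F. cball i (5 * r i)) \<le> (\<Sum>i\<in>F. measure lebesgue (cball i (5 * r i)))"
      by (rule measure_UNION_le[OF F(2)]) auto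
    also have "\<dots> = (\<Sum>i\<in>F. 5 / s * (2 * r i * s))"
      using r F C s by (intro sum.cong refl) (force simp: cball_eq_atLeastAtMost)
    also have "\<dots> \<le> (\<Sum>i\<in>F. 5 / s * integral (cball i (r i)) G)"
      using rb F C s by (intro sum_mono mult_left_mono) (auto intro: less_imp_le)
    also have "\<dots> = 5 / s * (\<Sum>i\<in>F. integral (cball i (r i)) G)" by (simp add: sum_distrib_left)
    also have "\<dots> \<le> 5 / s * integral {-2*pi..4*pi} G"
      using s by (intro mult_left_mono le) simp
    finally show ?thesis .
  qed
  have fm: "cball i (5 * r i) \<in> lmeasurable" for i by simp
  have "measure lebesgue S \<le> measure lebesgue (\<Union>i\<in>C. cball i (5 * r i))"
    by (rule measure_mono_fmeasurable[OF cov S(1) fmeasurable_UN_bound[OF C(1) fm fin]])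
  also have "\<dots> \<le> 5 / s * integral {-2*pi..4*pi} G" by (rule measure_UN_bound[OF C(1) fm fin])
  finally show ?thesis .
qed

lemma stolz_region_disk: "z \<in> stolz_region a \<xi> \<Longrightarrow> z \<in> unit_disk"
  unfolding stolz_region_def by simp

lemma integral_three_periods:
  fixes g :: "complex \<Rightarrow> real"
  assumes "continuous_on UNIV (\<lambda>t. g (cis t))"
  shows "integral {-2*pi..4*pi} (\<lambda>t. g (cis t)) = 3 * integral {0..2*pi} (\<lambda>t. g (cis t))"
proof -
  let ?G = "\<lambda>t. g (cis t)"
  have int: "?G integrable_on {x..y}" for x y
    by (rule integrable_continuous_interval) (rule continuous_on_subset[OF assms], simp)
  have per: "cis (t + 2*pi) = cis t" "cis (t + (-(2*pi))) = cis t" for t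
    by (simp_all add: complex_eq_iff cos_diff sin_diff)
  have "integral {0 - 2*pi..2*pi - 2*pi} (\<lambda>t. ?G (t + 2*pi)) = integral {0..2*pi} ?G"
    by (rule integral_shift_real_ivl)
  then have 1: "integral {-2*pi..0} ?G = integral {0..2*pi} ?G" by (simp add: per)
  have "integral {0 - (-(2*pi))..2*pi - (-(2*pi))} (\<lambda>t. ?G (t + (-(2*pi)))) = integral {0..2*pi} ?G"
    by (rule integral_shift_real_ivl)
  then have 2: "integral {2*pi..4*pi} ?G = integral {0..2*pi} ?G" unfolding per by simp
  have "integral {-2*pi..0} ?G + integral {0..4*pi} ?G = integral {-2*pi..4*pi} ?G"
    by (rule Henstock_Kurzweil_Integration.integral_combine) (auto intro: int)
  moreover have "integral {0..2*pi} ?G + integral {2*pi..4*pi} ?G = integral {0..4*pi} ?G"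
    by (rule Henstock_Kurzweil_Integration.integral_combine) (auto intro: int)
  ultimately show ?thesis using 1 2 by linarith
qed

text \<open>Superlevel set, in the angle, of the nontangential maximal function of the squared
  norm.\<close>

definition nt_large :: "real \<Rightarrow> (complex \<Rightarrow> 'a::complex_hilbert) \<Rightarrow> real \<Rightarrow> real set" where
  "nt_large a f s = {t \<in> {0..2*pi}. \<exists>z\<in>stolz_region a (cis t). s < (norm (f z))\<^sup>2}"

text \<open>For each fixed \<open>z\<close> the angles whose Stolz region contains \<open>z\<close>
  form an open set, so the set is a union of open sets cut with \<open>{0..2*pi}\<close>, whatever
  \<open>f\<close> is.\<close>

lemma nt_large_sets: "nt_large a f s \<in> lmeasurable"
proof -
  let ?O = "\<Union>z\<in>{z\<in>unit_disk. s < (norm (f z))\<^sup>2}. {t. dist z (cis t) < a * (1 - norm z)}"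
  have "open {t. dist z (cis t) < a * (1 - norm z)}" for z
    by (intro open_Collect_less continuous_intros)
  then have "open ?O" by blast
  then have "?O \<in> sets lebesgue" by (simp add: lborelD)
  then have "{0..2*pi} \<inter> ?O \<in> lmeasurable"
    by (intro fmeasurable_Int_fmeasurable) auto
  also have "{0..2*pi} \<inter> ?O = nt_large a f s"
    unfolding nt_large_def stolz_region_def by blast
  finally show ?thesis .
qed

text \<open>If all averages at \<open>t\<close> were at most \<open>s'\<close>, the Poisson estimate
  would force \<open>(norm (f (\<rho> * z)))\<^sup>2 \<le> s\<close> on the whole Stolz region. With
  \<open>s' = 2 * pi * s / K\<close>, the factor 5 of the covering and 3 for the three periods, the
  constant is \<open>15 * 32 / (2 * pi) = 240 / pi\<close> times
  \<open>(4 * (1 + a))\<^sup>2\<close>.\<close>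

lemma nt_maximal_weak_type_dilated:
  fixes f :: "complex \<Rightarrow> 'a::complex_hilbert" and \<rho> :: real
  assumes f: "weakly_holomorphic f" and cont: "continuous_on unit_disk f"
    and \<rho>: "0 < \<rho>" "\<rho> < 1" and a: "1 < a" and s: "0 < s"
    and Q: "integral {0..2*pi} (\<lambda>t. (norm (f (\<rho> * cis t)))\<^sup>2) \<le> Q"
  shows "measure lebesgue (nt_large a (\<lambda>z. f (\<rho> * z)) s) \<le> 240 * (4 * (1 + a))\<^sup>2 / pi * Q / s"
proof -
  define G where "G t = (norm (f (\<rho> * cis t)))\<^sup>2" for t
  define K where "K = 32 * (4 * (1 + a))\<^sup>2"
  have K: "K > 0" unfolding K_def using a by simp
  have Gc: "continuous_on UNIV G" unfolding G_def
    by (intro continuous_intros continuous_on_compose2[OF cont]) (use \<rho> in \<open>auto simp: norm_mult\<close>)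
  define s' where "s' = 2 * pi * s / K"
  have s': "s' > 0" unfolding s'_def using s K by simp
  have "measure lebesgue (nt_large a (\<lambda>z. f (\<rho> * z)) s) \<le> 5 / s' * integral {-2*pi..4*pi} G"
  proof (rule maximal_weak_type[OF Gc _ s'])
    show "nt_large a (\<lambda>z. f (\<rho> * z)) s \<in> sets lebesgue" using nt_large_sets by blast
    show "nt_large a (\<lambda>z. f (\<rho> * z)) s \<subseteq> {0..2*pi}" unfolding nt_large_def by blast
    fix t assume "t \<in> nt_large a (\<lambda>z. f (\<rho> * z)) s"
    then obtain z :: complex where z: "z \<in> stolz_region a (cis t)" "s < (norm (f (\<rho> * z)))\<^sup>2"
      unfolding nt_large_def by blast
    show "\<exists>\<delta>. 0 < \<delta> \<and> \<delta> \<le> 2*pi \<and> 2 * \<delta> * s' < integral (cball t \<delta>) G"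
    proof (rule ccontr)
      assume no: "\<not> ?thesis"
      have "2 * pi * (norm (f (\<rho> * z)))\<^sup>2 \<le> integral {t-pi..t+pi} (\<lambda>t. poisson_kernel z t * G t)"
        unfolding G_def by (rule poisson_norm_square[OF f cont \<rho>])
          (use stolz_region_disk[OF z(1)] in simp)
      also have "\<dots> \<le> 32 * (4 * (1 + a))\<^sup>2 * s'"
        by (rule poisson_integral_maximal[OF a z(1) Gc]) (use no in \<open>auto simp: G_def not_less\<close>)
      also have "\<dots> = 2 * pi * s" using K unfolding s'_def K_def[symmetric] by simp
      finally show False using z(2) pi_gt_zero by (simp add: mult_le_cancel_left_pos)
    qed
  qed (simp add: G_def)
  also have "integral {-2*pi..4*pi} G = 3 * integral {0..2*pi} G"
    unfolding G_def using integral_three_periods[of "\<lambda>w. (norm (f (\<rho> * w)))\<^sup>2"] Gc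
    unfolding G_def by simp
  also have "5 / s' * (3 * integral {0..2*pi} G) \<le> 5 / s' * (3 * Q)"
    using Q s' unfolding G_def by (intro mult_left_mono) auto
  also have "\<dots> = 240 * (4 * (1 + a))\<^sup>2 / pi * Q / s"
    unfolding s'_def K_def using s a by (simp add: field_simps)
  finally show ?thesis .
qed

text \<open>Dilations are removed by continuity: a point of \<open>nt_large a f s\<close> belongs to
  the sets of the dilates by \<open>\<rho> m\<close> for all large \<open>m\<close>. The sets
  \<open>A n\<close> increase, so the uniform bound passes to their union.\<close>

lemma nt_maximal_weak_type:
  fixes f :: "complex \<Rightarrow> 'a::complex_hilbert"
  assumes f: "weakly_holomorphic f" and cont: "continuous_on unit_disk f"
    and a: "1 < a" and s: "0 < s"
    and Q: "\<And>\<rho>. 0 < \<rho> \<Longrightarrow> \<rho> < 1 \<Longrightarrow> integral {0..2*pi} (\<lambda>t. (norm (f (complex_of_real \<rho> * cis t)))\<^sup>2) \<le> Q"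
  shows "measure lebesgue (nt_large a f s) \<le> 240 * (4 * (1 + a))\<^sup>2 / pi * Q / s"
proof -
  define B where "B = 240 * (4 * (1 + a))\<^sup>2 / pi * Q / s"
  define \<rho> where "\<rho> n = 1 - inverse (real (Suc (Suc n)))" for n
  have \<rho>: "0 < \<rho> n" "\<rho> n < 1" for n unfolding \<rho>_def by (auto simp: field_simps)
  have \<rho>lim: "\<rho> \<longlonglongrightarrow> 1"
  proof -
    have "\<rho> \<longlonglongrightarrow> 1 - 0" unfolding \<rho>_def
      by (intro tendsto_intros LIMSEQ_Suc[OF LIMSEQ_inverse_real_of_nat])
    then show ?thesis by simp
  qed
  define A where "A n = (\<Inter>m\<in>{n..}. nt_large a (\<lambda>z. f (\<rho> m * z)) s)" for n
  have Asub: "A n \<subseteq> nt_large a (\<lambda>z. f (\<rho> n * z)) s" for n unfolding A_def by auto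
  have Ameas: "A n \<in> lmeasurable" for n
    by (rule fmeasurableI2[OF nt_large_sets Asub])
      (auto simp: A_def intro!: sets.countable_INT'' nt_large_sets[THEN fmeasurableD])
  have AB: "measure lebesgue (A n) \<le> B" for n
  proof -
    have "measure lebesgue (A n) \<le> measure lebesgue (nt_large a (\<lambda>z. f (\<rho> n * z)) s)"
      using Ameas by (intro measure_mono_fmeasurable[OF Asub _ nt_large_sets]) auto
    also have "\<dots> \<le> B" unfolding B_def
      by (rule nt_maximal_weak_type_dilated[OF f cont \<rho> a s Q[OF \<rho>]])
    finally show ?thesis .
  qed
  have "(\<Union>i\<le>n. A i) = A n" for n
  proof
    show "(\<Union>i\<le>n. A i) \<subseteq> A n" unfolding A_def by (force dest: order_trans)
  qed auto
  then have AB': "measure lebesgue (\<Union>i\<le>n. A i) \<le> B" for n using AB by simp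
  have "nt_large a f s \<subseteq> (\<Union>n. A n)"
  proof
    fix t assume "t \<in> nt_large a f s"
    then obtain z where t: "t \<in> {0..2*pi}" and z: "z \<in> stolz_region a (cis t)" "s < (norm (f z))\<^sup>2"
      unfolding nt_large_def by blast
    have zd: "z \<in> unit_disk" by (rule stolz_region_disk[OF z(1)])
    have "isCont f z" using cont zd by (simp add: continuous_on_eq_continuous_at)
    moreover have "(\<lambda>n. complex_of_real (\<rho> n) * z) \<longlonglongrightarrow> of_real 1 * z" by (intro tendsto_intros \<rho>lim)
    ultimately have "(\<lambda>n. f (\<rho> n * z)) \<longlonglongrightarrow> f z" using isCont_tendsto_compose[of z f "\<lambda>n. of_real (\<rho> n) * z" sequentially] by simp
    then have "(\<lambda>n. (norm (f (\<rho> n * z)))\<^sup>2) \<longlonglongrightarrow> (norm (f z))\<^sup>2" by (intro tendsto_intros)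
    from order_tendstoD(1)[OF this z(2)] obtain n where "\<forall>m\<ge>n. s < (norm (f (\<rho> m * z)))\<^sup>2"
      unfolding eventually_sequentially by blast
    then have "t \<in> A n" unfolding A_def nt_large_def using t z(1) by auto
    then show "t \<in> (\<Union>n. A n)" by blast
  qed
  then have "measure lebesgue (nt_large a f s) \<le> measure lebesgue (\<Union>n. A n)"
    by (intro measure_mono_fmeasurable fmeasurable_countable_Union[OF Ameas AB'] fmeasurableD nt_large_sets)
  also have "\<dots> \<le> B" by (rule measure_countable_Union_le[OF Ameas AB'])
  finally show ?thesis unfolding B_def .
qed

section \<open>Square-summable Taylor coefficients and nontangential limits of bounded vector-valued
  functions\<close>

section \<open>Taylor coefficients and Fatou's theorem\<close>

text \<open>The \<open>n\<close>-th scalar coefficient is conjugate linear and bounded in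
  \<open>c\<close>, so Riesz representation turns it into a vector \<open>a n\<close>. Cauchy's
  inequality gives the bound on circles of radius \<open>r < 1\<close>, and \<open>r\<close> tends
  to 1.\<close>

lemma taylor_coefficients:
  fixes f :: "complex \<Rightarrow> 'a::complex_hilbert"
  assumes f: "weakly_holomorphic f" and B: "\<And>z. z \<in> unit_disk \<Longrightarrow> norm (f z) \<le> B"
  obtains a where "\<And>n. norm (a n) \<le> B" "\<And>z. z \<in> unit_disk \<Longrightarrow> (\<lambda>n. z ^ n *\<^sub>C a n) sums f z"
proof -
  have B0: "0 \<le> B" by (rule order_trans[OF norm_ge_zero B[of 0]]) simp
  define k where "k n c = (deriv ^^ n) (\<lambda>z. cinner (f z) c) 0 / fact n" for n c
  note hol = weakly_holomorphicD[OF f]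
  have kb: "cmod (k n c) \<le> B * norm c" for n c
  proof -
    have r: "cmod (k n c) * r ^ n \<le> B * norm c" if r: "0 < r" "r < 1" for r
    proof -
      have "cmod ((deriv ^^ n) (\<lambda>z. cinner (f z) c) 0) \<le> fact n * (B * norm c) / r ^ n"
      proof (rule Cauchy_inequality)
        have h: "(\<lambda>z. cinner (f z) c) holomorphic_on cball 0 r"
          by (rule holomorphic_on_subset[OF hol]) (use r in auto)
        show "(\<lambda>z. cinner (f z) c) holomorphic_on ball 0 r"
          by (rule holomorphic_on_subset[OF h ball_subset_cball])
        show "continuous_on (cball 0 r) (\<lambda>z. cinner (f z) c)"
          by (rule holomorphic_on_imp_continuous_on[OF h])
        fix x :: complex assume "cmod (0 - x) = r"
        then have "norm (f x) \<le> B" using B r by simp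
        then show "cmod (cinner (f x) c) \<le> B * norm c"
          using cinner_cauchy_schwarz[of "f x" c] by (meson mult_right_mono norm_ge_zero order_trans)
      qed (use r in simp)
      then show ?thesis unfolding k_def using r by (simp add: norm_divide field_simps)
    qed
    have "((\<lambda>r. cmod (k n c) * r ^ n) \<longlongrightarrow> cmod (k n c) * 1 ^ n) (at_left 1)"
      by (intro tendsto_intros)
    moreover have "\<forall>\<^sub>F r in at_left (1::real). cmod (k n c) * r ^ n \<le> B * norm c"
      by (rule eventually_mono[OF eventually_at_left_real[OF zero_less_one]]) (use r in auto)
    ultimately show ?thesis by (intro tendsto_upperbound[of "\<lambda>r. cmod (k n c) * r ^ n"]) auto
  qed
  have kadd: "k n (x + y) = k n x + k n y" for n x y
    unfolding k_def cinner_add_right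
    by (subst higher_deriv_add[OF hol hol open_ball]) (auto simp: add_divide_distrib)
  have kscale: "k n (a *\<^sub>C x) = cnj a * k n x" for n a x
    unfolding k_def cinner_scaleC_right
    by (subst higher_deriv_cmult[OF hol _ open_ball]) auto
  have "\<exists>w. \<forall>c. k n c = cinner w c" for n
  proof -
    obtain w where "\<And>c. c \<in> UNIV \<Longrightarrow> cnj (k n c) = cinner c w"
      by (rule functional_factorization[of UNIV "\<lambda>x. x" "\<lambda>c. cnj (k n c)" B])
        (auto simp: kadd kscale kb)
    then have "cnj (cnj (k n c)) = cnj (cinner c w)" for c by simp
    then have "k n c = cnj (cinner c w)" for c unfolding complex_cnj_cnj .
    then have "k n c = cinner w c" for c using cinner_commute[of w c] by (rule trans[OF _ sym])
    then show ?thesis by blast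
  qed
  then have "\<exists>a. \<forall>n c. k n c = cinner (a n) c" by (rule choice[OF allI])
  then obtain a where a: "\<And>n c. k n c = cinner (a n) c" by blast
  have anorm: "norm (a n) \<le> B" for n
    by (rule norm_le_of_cinner) (use kb a B0 in auto)
  have "(\<lambda>n. z ^ n *\<^sub>C a n) sums f z" if z: "z \<in> unit_disk" for z
  proof -
    have "summable (\<lambda>n. norm (z ^ n *\<^sub>C a n))"
    proof (rule summable_comparison_test')
      show "summable (\<lambda>n. cmod z ^ n * B)" using z by (intro summable_mult2 summable_geometric) simp
      show "norm (norm (z ^ n *\<^sub>C a n)) \<le> cmod z ^ n * B" for n
        using anorm[of n] by (simp add: norm_scaleC norm_power mult_left_mono)
    qed
    from summable_sums[OF summable_norm_cancel[OF this]]
    have s: "(\<lambda>n. z ^ n *\<^sub>C a n) sums (\<Sum>n. z ^ n *\<^sub>C a n)" .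
    have eq: "cinner (\<Sum>n. z ^ n *\<^sub>C a n) c = cinner (f z) c" for c
    proof (rule sums_unique2)
      show "(\<lambda>n. cinner (z ^ n *\<^sub>C a n) c) sums cinner (\<Sum>n. z ^ n *\<^sub>C a n) c"
        by (rule bounded_linear.sums[OF bounded_bilinear.bounded_linear_left[OF bounded_bilinear_cinner] s])
      show "(\<lambda>n. cinner (z ^ n *\<^sub>C a n) c) sums cinner (f z) c"
        using holomorphic_power_series[OF hol z, of c] by (simp add: k_def[symmetric] a cinner_scaleC_left mult.commute)
    qed
    have "(\<Sum>n. z ^ n *\<^sub>C a n) = f z"
    proof (rule cinner_eqI[of UNIV])
      fix v show "cinner v (\<Sum>n. z ^ n *\<^sub>C a n) = cinner v (f z)"
        unfolding cinner_commute[of v "\<Sum>n. z ^ n *\<^sub>C a n"] cinner_commute[of v "f z"] eq ..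
    qed simp_all
    then show ?thesis using s by simp
  qed
  then show ?thesis using that anorm by blast
qed

lemma has_integral_cis:
  "((\<lambda>t. cis (of_int k * t)) has_integral (if k = 0 then 2 * pi else 0)) {0..2*pi}"
proof (cases "k = 0")
  case True
  have "((\<lambda>t::real. 1::complex) has_integral (2*pi - 0) *\<^sub>R 1) {0..2*pi}"
    by (rule has_integral_const_real[of 1 0 "2*pi", THEN has_integral_eq_rhs]) simp
  then show ?thesis using True by (simp add: scaleR_conv_of_real)
next
  case False
  define F where "F t = cis (of_int k * t) / (\<i> * of_int k)" for t :: real
  have "((\<lambda>t. cis (of_int k * t)) has_integral (F (2*pi) - F 0)) {0..2*pi}"
  proof (rule fundamental_theorem_of_calculus)
    fix t :: real
    have "((\<lambda>t. exp (\<i> * of_int k * of_real t) / (\<i> * of_int k)) has_vector_derivative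
        exp (\<i> * of_int k * of_real t)) (at t within {0..2*pi})"
      by (rule has_vector_derivative_real_field)
        (use False in \<open>auto intro!: derivative_eq_intros simp: field_simps\<close>)
    then show "(F has_vector_derivative cis (of_int k * t)) (at t within {0..2*pi})"
      unfolding F_def cis_conv_exp by (simp add: mult.assoc)
  qed simp
  moreover have "F (2*pi) = F 0"
  proof -
    have "cis (of_int k * (2*pi)) = 1" by (metis cis_multiple_2pi Ints_of_int mult.commute)
    then show ?thesis unfolding F_def by simp
  qed
  ultimately show ?thesis using False by simp
qed

lemma parseval_finite:
  fixes a :: "nat \<Rightarrow> 'a::complex_hilbert" and \<rho> :: real
  assumes J: "finite J"
  shows "((\<lambda>t. (norm (\<Sum>n\<in>J. (\<rho> * cis t) ^ n *\<^sub>C a n))\<^sup>2) has_integral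
    (2 * pi * (\<Sum>n\<in>J. (norm (a n))\<^sup>2 * (\<rho>\<^sup>2) ^ n))) {0..2*pi}"
proof -
  define c where "c n m = complex_of_real (\<rho> ^ n * \<rho> ^ m) * cinner (a n) (a m)" for n m
  have e: "complex_of_real ((norm (\<Sum>n\<in>J. (\<rho> * cis t) ^ n *\<^sub>C a n))\<^sup>2)
      = (\<Sum>n\<in>J. \<Sum>m\<in>J. c n m * cis (of_int (int n - int m) * t))" for t
  proof -
    have p: "(\<rho> * cis t) ^ n * cnj ((\<rho> * cis t) ^ m) = complex_of_real (\<rho> ^ n * \<rho> ^ m) * cis (of_int (int n - int m) * t)" for n m
    proof -
      have "cis t ^ n * cis (- t) ^ m = cis (of_int (int n - int m) * t)"
        by (simp only: Complex.DeMoivre cis_mult) (simp add: left_diff_distrib)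
      then show ?thesis by (simp add: power_mult_distrib cis_cnj)
    qed
    let ?X = "\<lambda>n. (\<rho> * cis t) ^ n *\<^sub>C a n"
    have "complex_of_real ((norm (\<Sum>n\<in>J. ?X n))\<^sup>2) = (\<Sum>n\<in>J. cinner (?X n) (\<Sum>m\<in>J. ?X m))"
      by (simp only: cinner_self[symmetric] cinner_sum_left)
    also have "\<dots> = (\<Sum>n\<in>J. \<Sum>m\<in>J. cinner (?X n) (?X m))" by (simp only: cinner_sum_right)
    also have "\<dots> = (\<Sum>n\<in>J. \<Sum>m\<in>J. c n m * cis (of_int (int n - int m) * t))"
    proof (intro sum.cong refl)
      fix n m
      have "cinner (?X n) (?X m) = ((\<rho> * cis t) ^ n * cnj ((\<rho> * cis t) ^ m)) * cinner (a n) (a m)"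
        by (simp only: cinner_scaleC_left cinner_scaleC_right mult.assoc mult.left_commute)
      also have "\<dots> = c n m * cis (of_int (int n - int m) * t)"
        unfolding p c_def by (simp only: mult.assoc mult.commute[of _ "cinner _ _"])
      finally show "cinner (?X n) (?X m) = c n m * cis (of_int (int n - int m) * t)" .
    qed
    finally show ?thesis .
  qed
  have "((\<lambda>t. \<Sum>n\<in>J. \<Sum>m\<in>J. c n m * cis (of_int (int n - int m) * t)) has_integral
     (\<Sum>n\<in>J. \<Sum>m\<in>J. c n m * (if int n - int m = 0 then 2 * pi else 0))) {0..2*pi}"
    by (intro has_integral_sum J has_integral_mult_right has_integral_cis)
  also have "(\<Sum>n\<in>J. \<Sum>m\<in>J. c n m * (if int n - int m = 0 then 2 * pi else 0)) =
      (\<Sum>n\<in>J. \<Sum>m\<in>J. if n = m then c n m * (2 * pi) else 0)"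
    by (intro sum.cong refl) auto
  also have "\<dots> = (\<Sum>n\<in>J. c n n * (2 * pi))" using J by (simp add: sum.delta)
  also have "\<dots> = complex_of_real (2 * pi * (\<Sum>n\<in>J. (norm (a n))\<^sup>2 * (\<rho>\<^sup>2) ^ n))"
    by (simp add: c_def cinner_self sum_distrib_left mult_ac power2_eq_square power_mult_distrib)
  finally have "((\<lambda>t. complex_of_real ((norm (\<Sum>n\<in>J. (\<rho> * cis t) ^ n *\<^sub>C a n))\<^sup>2)) has_integral
      complex_of_real (2 * pi * (\<Sum>n\<in>J. (norm (a n))\<^sup>2 * (\<rho>\<^sup>2) ^ n))) {0..2*pi}" unfolding e .
  from has_integral_Re[OF this] show ?thesis by simp
qed

text \<open>Orthogonality makes the circle integrals of the remainders equal to weighted tail sums;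
  \<open>N = 0\<close> and \<open>\<rho>\<close> tending to 1 give square summability from the bound
  \<open>B\<close>. The final tail is independent of \<open>\<rho>\<close>, as the weak type bound
  demands.\<close>

lemma taylor_square_summable:
  fixes f :: "complex \<Rightarrow> 'a::complex_hilbert"
  assumes f: "weakly_holomorphic f" and B: "\<And>z. z \<in> unit_disk \<Longrightarrow> norm (f z) \<le> B"
  obtains a where "summable (\<lambda>n. (norm (a n))\<^sup>2)"
    "\<And>N \<rho>. 0 < \<rho> \<Longrightarrow> \<rho> < 1 \<Longrightarrow>
      integral {0..2*pi} (\<lambda>t. (norm (f (complex_of_real \<rho> * cis t)
          - (\<Sum>n<N. (complex_of_real \<rho> * cis t) ^ n *\<^sub>C a n)))\<^sup>2)
        \<le> 2 * pi * (\<Sum>n. (norm (a (n + N)))\<^sup>2)"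
proof -
  obtain a where aB: "\<And>n. norm (a n) \<le> B"
    and sums: "\<And>z. z \<in> unit_disk \<Longrightarrow> (\<lambda>n. z ^ n *\<^sub>C a n) sums f z"
    using taylor_coefficients[OF f B] by blast
  have B0: "0 \<le> B" using aB[of 0] norm_ge_zero order_trans by blast
  define S where "S N K z = (\<Sum>n\<in>{N..<K}. z ^ n *\<^sub>C a n)" for N K and z :: complex
  define T where "T N z = f z - (\<Sum>n<N. z ^ n *\<^sub>C a n)" for N and z :: complex
  have conv: "(\<lambda>t. (norm (T N (complex_of_real \<rho> * cis t)))\<^sup>2) integrable_on {0..2*pi}"
    "(\<lambda>K. 2 * pi * (\<Sum>n\<in>{N..<K}. (norm (a n))\<^sup>2 * (\<rho>\<^sup>2) ^ n))
       \<longlonglongrightarrow> integral {0..2*pi} (\<lambda>t. (norm (T N (complex_of_real \<rho> * cis t)))\<^sup>2)"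
    if \<rho>: "0 < \<rho>" "\<rho> < 1" for N and \<rho> :: real
  proof -
    let ?F = "\<lambda>K t. (norm (S N K (complex_of_real \<rho> * cis t)))\<^sup>2"
    let ?D = "B * (1 / (1 - \<rho>))"
    have P: "(?F K has_integral (2 * pi * (\<Sum>n\<in>{N..<K}. (norm (a n))\<^sup>2 * (\<rho>\<^sup>2) ^ n))) {0..2*pi}" for K
      unfolding S_def by (rule parseval_finite) simp
    have bd: "norm (?F K t) \<le> ?D\<^sup>2" for K t
    proof -
      have "norm (S N K (complex_of_real \<rho> * cis t)) \<le> (\<Sum>n\<in>{N..<K}. norm ((complex_of_real \<rho> * cis t) ^ n *\<^sub>C a n))"
        unfolding S_def by (rule norm_sum)
      also have "\<dots> \<le> (\<Sum>n\<in>{N..<K}. B * \<rho> ^ n)"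
        using \<rho> aB by (intro sum_mono) (simp add: norm_scaleC norm_power norm_mult mult.commute mult_right_mono)
      also have "\<dots> = B * (\<Sum>n\<in>{N..<K}. \<rho> ^ n)" by (simp add: sum_distrib_left)
      also have "\<dots> \<le> B * (\<Sum>n. \<rho> ^ n)"
        using \<rho> B0 by (intro mult_left_mono sum_le_suminf summable_geometric) auto
      also have "\<dots> = ?D" using \<rho> by (simp add: suminf_geometric)
      finally show ?thesis by (simp add: power_mono)
    qed
    have lim: "(\<lambda>K. ?F K t) \<longlonglongrightarrow> (norm (T N (complex_of_real \<rho> * cis t)))\<^sup>2" for t
    proof -
      let ?z = "complex_of_real \<rho> * cis t"
      have z: "?z \<in> unit_disk" using \<rho> by (simp add: norm_mult)
      have "(\<lambda>K. (\<Sum>n<K. ?z ^ n *\<^sub>C a n) - (\<Sum>n<N. ?z ^ n *\<^sub>C a n)) \<longlonglongrightarrow> T N ?z"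
        using sums[OF z] unfolding T_def sums_def by (intro tendsto_intros)
      moreover have "\<forall>\<^sub>F K in sequentially. (\<Sum>n<K. ?z ^ n *\<^sub>C a n) - (\<Sum>n<N. ?z ^ n *\<^sub>C a n) = S N K ?z"
        using eventually_ge_at_top[of N]
      proof eventually_elim
        fix K assume "N \<le> K"
        then have "(\<Sum>n<K. ?z ^ n *\<^sub>C a n) = (\<Sum>n<N. ?z ^ n *\<^sub>C a n) + S N K ?z"
          unfolding S_def by (simp add: sum.atLeastLessThan_concat lessThan_atLeast0)
        then show "(\<Sum>n<K. ?z ^ n *\<^sub>C a n) - (\<Sum>n<N. ?z ^ n *\<^sub>C a n) = S N K ?z" by simp
      qed
      ultimately have "(\<lambda>K. S N K ?z) \<longlonglongrightarrow> T N ?z" by (rule Lim_transform_eventually)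
      then show ?thesis by (intro tendsto_intros)
    qed
    have P': "integral {0..2*pi} (?F K) = 2 * pi * (\<Sum>n\<in>{N..<K}. (norm (a n))\<^sup>2 * (\<rho>\<^sup>2) ^ n)" for K
      using P by (rule integral_unique)
    show "(\<lambda>t. (norm (T N (complex_of_real \<rho> * cis t)))\<^sup>2) integrable_on {0..2*pi}"
      by (rule dominated_convergence(1)[of ?F _ "\<lambda>_. ?D\<^sup>2"]) (use P bd lim in \<open>auto simp: has_integral_integrable\<close>)
    have "(\<lambda>K. integral {0..2*pi} (?F K)) \<longlonglongrightarrow> integral {0..2*pi} (\<lambda>t. (norm (T N (complex_of_real \<rho> * cis t)))\<^sup>2)"
      by (rule dominated_convergence(2)[of ?F _ "\<lambda>_. ?D\<^sup>2"]) (use P bd lim in \<open>auto simp: has_integral_integrable\<close>)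
    then show "(\<lambda>K. 2 * pi * (\<Sum>n\<in>{N..<K}. (norm (a n))\<^sup>2 * (\<rho>\<^sup>2) ^ n))
       \<longlonglongrightarrow> integral {0..2*pi} (\<lambda>t. (norm (T N (complex_of_real \<rho> * cis t)))\<^sup>2)"
      unfolding P' .
  qed
  have part: "(\<Sum>n<K. (norm (a n))\<^sup>2) \<le> B\<^sup>2" for K
  proof -
    have r: "(\<Sum>n<K. (norm (a n))\<^sup>2 * (\<rho>\<^sup>2) ^ n) \<le> B\<^sup>2" if \<rho>: "0 < \<rho>" "\<rho> < 1" for \<rho> :: real
    proof -
      let ?c = "\<lambda>K. 2 * pi * (\<Sum>n\<in>{0..<K}. (norm (a n))\<^sup>2 * (\<rho>\<^sup>2) ^ n)"
      have "incseq ?c" by (rule incseq_SucI) simp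
      then have "?c K \<le> integral {0..2*pi} (\<lambda>t. (norm (T 0 (complex_of_real \<rho> * cis t)))\<^sup>2)"
        by (rule incseq_le[OF _ conv(2)[OF \<rho>]])
      also have "\<dots> \<le> integral {0..2*pi} (\<lambda>t. B\<^sup>2)"
        using B \<rho> by (intro integral_le conv \<rho>) (auto simp: T_def norm_mult power_mono)
      also have "\<dots> = 2 * pi * B\<^sup>2" by simp
      finally show ?thesis by (simp add: lessThan_atLeast0)
    qed
    have "((\<lambda>\<rho>. \<Sum>n<K. (norm (a n))\<^sup>2 * (\<rho>\<^sup>2) ^ n) \<longlongrightarrow> (\<Sum>n<K. (norm (a n))\<^sup>2 * (1\<^sup>2) ^ n)) (at_left 1)"
      by (intro tendsto_intros)
    moreover have "\<forall>\<^sub>F \<rho> in at_left (1::real). (\<Sum>n<K. (norm (a n))\<^sup>2 * (\<rho>\<^sup>2) ^ n) \<le> B\<^sup>2"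
      by (rule eventually_mono[OF eventually_at_left_real[OF zero_less_one]]) (use r in auto)
    ultimately have "(\<Sum>n<K. (norm (a n))\<^sup>2 * (1\<^sup>2) ^ n) \<le> B\<^sup>2"
      by (intro tendsto_upperbound) auto
    then show ?thesis by simp
  qed
  have sm: "summable (\<lambda>n. (norm (a n))\<^sup>2)"
    by (rule summableI_nonneg_bounded[OF _ part]) simp
  have "integral {0..2*pi} (\<lambda>t. (norm (T N (complex_of_real \<rho> * cis t)))\<^sup>2) \<le> 2 * pi * (\<Sum>n. (norm (a (n + N)))\<^sup>2)"
    if \<rho>: "0 < \<rho>" "\<rho> < 1" for N and \<rho> :: real
  proof (rule LIMSEQ_le_const2[OF conv(2)[OF \<rho>]], intro exI allI impI mult_left_mono)
    fix K assume "N \<le> K"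
    have "(\<Sum>n\<in>{N..<K}. (norm (a n))\<^sup>2 * (\<rho>\<^sup>2) ^ n) \<le> (\<Sum>n\<in>{N..<K}. (norm (a n))\<^sup>2)"
    proof (rule sum_mono)
      fix n
      have "(\<rho>\<^sup>2) ^ n \<le> 1" using \<rho> by (intro power_le_one) (auto simp: power_le_one)
      then show "(norm (a n))\<^sup>2 * (\<rho>\<^sup>2) ^ n \<le> (norm (a n))\<^sup>2" by (simp add: mult_left_le)
    qed
    also have "\<dots> = (\<Sum>n<K - N. (norm (a (n + N)))\<^sup>2)"
      using sum.shift_bounds_nat_ivl[of "\<lambda>n. (norm (a n))\<^sup>2" 0 N "K - N"] \<open>N \<le> K\<close>
      by (simp add: lessThan_atLeast0)
    also have "\<dots> \<le> (\<Sum>n. (norm (a (n + N)))\<^sup>2)"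
      by (rule sum_le_suminf) (use sm summable_iff_shift[of "\<lambda>n. (norm (a n))\<^sup>2" N] in auto)
    finally show "(\<Sum>n\<in>{N..<K}. (norm (a n))\<^sup>2 * (\<rho>\<^sup>2) ^ n) \<le> (\<Sum>n. (norm (a (n + N)))\<^sup>2)" .
  qed simp
  then show ?thesis using that[OF sm] unfolding T_def by blast
qed

lemma weakly_holomorphic_polynomial: "weakly_holomorphic (\<lambda>z. \<Sum>n<N. z ^ n *\<^sub>C a n)"
  unfolding weakly_holomorphic_def cinner_sum_left cinner_scaleC_left
  by (intro allI holomorphic_intros)

lemma weakly_holomorphic_diff:
  "weakly_holomorphic f \<Longrightarrow> weakly_holomorphic g \<Longrightarrow> weakly_holomorphic (\<lambda>z. f z - g z)"
  unfolding weakly_holomorphic_def by (auto simp: cinner_diff_left intro!: holomorphic_intros)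

text \<open>Failure, at level \<open>s\<close>, of the Cauchy criterion along one Stolz
  region.\<close>

definition oscillates :: "real \<Rightarrow> (complex \<Rightarrow> 'a::complex_hilbert) \<Rightarrow> real \<Rightarrow> complex \<Rightarrow> bool" where
  "oscillates a f s \<xi> \<longleftrightarrow> (\<forall>\<delta>>0. \<exists>z\<in>stolz_region a \<xi> \<inter> ball \<xi> \<delta>. \<exists>w\<in>stolz_region a \<xi> \<inter> ball \<xi> \<delta>.
     s \<le> norm (f z - f w))"

text \<open>Taylor polynomials do not oscillate, and the weak type estimate bounds the oscillation of the
  remainder by its norm in \<open>H\<^sup>2\<close>.\<close>

lemma negligible_oscillates:
  fixes f :: "complex \<Rightarrow> 'a::complex_hilbert"
  assumes f: "weakly_holomorphic f" and B: "\<And>z. z \<in> unit_disk \<Longrightarrow> norm (f z) \<le> B"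
    and a: "1 < a" and s: "0 < s"
  shows "negligible {t \<in> {0..2*pi}. oscillates a f s (cis t)}"
proof -
  obtain c where sm: "summable (\<lambda>n. (norm (c n))\<^sup>2)"
    and Q: "\<And>N \<rho>. 0 < \<rho> \<Longrightarrow> \<rho> < 1 \<Longrightarrow>
      integral {0..2*pi} (\<lambda>t. (norm (f (complex_of_real \<rho> * cis t)
          - (\<Sum>n<N. (complex_of_real \<rho> * cis t) ^ n *\<^sub>C c n)))\<^sup>2)
        \<le> 2 * pi * (\<Sum>n. (norm (c (n + N)))\<^sup>2)"
    using taylor_square_summable[OF f B] by blast
  define p where "p N z = (\<Sum>n<N. z ^ n *\<^sub>C c n)" for N and z :: complex
  define g where "g N z = f z - p N z" for N z
  define K where "K = 240 * (4 * (1 + a))\<^sup>2 / pi * (2 * pi) / (s/4)\<^sup>2"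
  have pc: "continuous_on A (p N)" for N A unfolding p_def by (intro continuous_intros)
  have gh: "weakly_holomorphic (g N)" for N
    unfolding g_def p_def by (intro weakly_holomorphic_diff f weakly_holomorphic_polynomial)
  have gc: "continuous_on unit_disk (g N)" for N
    unfolding g_def by (intro continuous_intros pc weakly_holomorphic_continuous[OF f B])
  have meas: "measure lebesgue (nt_large a (g N) ((s/4)\<^sup>2)) \<le> K * (\<Sum>n. (norm (c (n + N)))\<^sup>2)" for N
  proof -
    have "measure lebesgue (nt_large a (g N) ((s/4)\<^sup>2)) \<le>
        240 * (4 * (1 + a))\<^sup>2 / pi * (2 * pi * (\<Sum>n. (norm (c (n + N)))\<^sup>2)) / (s/4)\<^sup>2"
      by (rule nt_maximal_weak_type[OF gh gc a]) (use s Q in \<open>auto simp: g_def p_def\<close>)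
    also have "\<dots> = K * (\<Sum>n. (norm (c (n + N)))\<^sup>2)" unfolding K_def by simp
    finally show ?thesis .
  qed
  have sub: "{t \<in> {0..2*pi}. oscillates a f s (cis t)} \<subseteq> nt_large a (g N) ((s/4)\<^sup>2)" for N
  proof
    fix t assume "t \<in> {t \<in> {0..2*pi}. oscillates a f s (cis t)}"
    then have t: "t \<in> {0..2*pi}" and osc: "oscillates a f s (cis t)" by auto
    have "isCont (p N) (cis t)" using pc[of UNIV N] by (simp add: continuous_on_eq_continuous_at)
    then obtain \<delta> where \<delta>: "\<delta> > 0" "\<And>z. dist z (cis t) < \<delta> \<Longrightarrow> dist (p N z) (p N (cis t)) < s/4"
      unfolding continuous_at_eps_delta using s by (metis zero_less_divide_iff zero_less_numeral)
    obtain z w where z: "z \<in> stolz_region a (cis t)" "dist z (cis t) < \<delta>"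
      and w: "w \<in> stolz_region a (cis t)" "dist w (cis t) < \<delta>" and zw: "s \<le> norm (f z - f w)"
      using osc \<delta>(1) unfolding oscillates_def by (auto simp: dist_commute)
    \<comment> \<open>The two polynomial terms contribute less than \<open>s/4\<close> each, so one
      of the two remainders must exceed \<open>s/4\<close>.\<close>
    have "f z - f w = (g N z - g N w) + ((p N z - p N (cis t)) - (p N w - p N (cis t)))"
      unfolding g_def by simp
    then have "s \<le> (norm (g N z) + norm (g N w)) + (norm (p N z - p N (cis t)) + norm (p N w - p N (cis t)))"
      using zw by (smt (verit) norm_triangle_ineq norm_triangle_ineq4)
    then have "s/4 < norm (g N z) \<or> s/4 < norm (g N w)"
      using \<delta>(2)[OF z(2)] \<delta>(2)[OF w(2)] s unfolding dist_norm by linarith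
    then obtain v where v: "v \<in> stolz_region a (cis t)" "s/4 < norm (g N v)" using z w by blast
    have "(s/4)\<^sup>2 < (norm (g N v))\<^sup>2" by (rule power_strict_mono) (use v s in auto)
    then show "t \<in> nt_large a (g N) ((s/4)\<^sup>2)" unfolding nt_large_def using t v by blast
  qed
  show ?thesis
    unfolding negligible_outer_le
  proof (intro allI impI)
    fix e :: real assume e: "0 < e"
    have "(\<lambda>N. K * (\<Sum>n. (norm (c (n + N)))\<^sup>2)) \<longlonglongrightarrow> K * 0"
      by (intro tendsto_intros suminf_exist_split2 sm)
    from order_tendstoD(2)[OF this, of e] e obtain N where "K * (\<Sum>n. (norm (c (n + N)))\<^sup>2) < e"
      unfolding eventually_sequentially by auto
    then show "\<exists>T. {t \<in> {0..2*pi}. oscillates a f s (cis t)} \<subseteq> T \<and> T \<in> lmeasurable \<and> measure lebesgue T \<le> e"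
      using sub meas[of N] nt_large_sets by (meson less_imp_le order_trans)
  qed
qed

lemma radial_stolz:
  assumes "cmod \<xi> = 1" "1 < a" "0 \<le> r" "r < 1"
  shows "complex_of_real r * \<xi> \<in> stolz_region a \<xi>"
proof -
  have "dist (complex_of_real r * \<xi>) \<xi> = cmod ((complex_of_real r - 1) * \<xi>)"
    by (simp add: dist_norm algebra_simps)
  also have "\<dots> = cmod (complex_of_real (r - 1))" using assms by (simp add: norm_mult)
  also have "\<dots> = 1 - r" using assms unfolding norm_of_real by simp
  finally show ?thesis using assms unfolding stolz_region_def by (simp add: norm_mult)
qed

text \<open>It lies in the Stolz regions of every aperture above 1, so one sequence computes every
  existing nontangential limit, independently of the aperture.\<close>

definition radial_seq :: "complex \<Rightarrow> nat \<Rightarrow> complex" where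
  "radial_seq \<xi> n = complex_of_real (1 - inverse (real (Suc n))) * \<xi>"

lemma radial_seq_props:
  assumes "cmod \<xi> = 1"
  shows radial_seq_stolz: "1 < a \<Longrightarrow> radial_seq \<xi> n \<in> stolz_region a \<xi>"
    and radial_seq_tendsto: "radial_seq \<xi> \<longlonglongrightarrow> \<xi>"
    and radial_seq_neq: "radial_seq \<xi> n \<noteq> \<xi>"
proof -
  have r: "0 \<le> 1 - inverse (real (Suc n))" "1 - inverse (real (Suc n)) < 1"
    by (auto simp: field_simps)
  show st: "1 < a \<Longrightarrow> radial_seq \<xi> n \<in> stolz_region a \<xi>" for a
    unfolding radial_seq_def by (rule radial_stolz[OF assms _ r])
  show "radial_seq \<xi> n \<noteq> \<xi>" using stolz_region_disk[OF st[of 2]] assms by auto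
  have "radial_seq \<xi> \<longlonglongrightarrow> complex_of_real (1 - 0) * \<xi>"
    unfolding radial_seq_def by (intro tendsto_intros LIMSEQ_inverse_real_of_nat)
  then show "radial_seq \<xi> \<longlonglongrightarrow> \<xi>" by simp
qed

lemma has_nt_limit_radial:
  assumes "cmod \<xi> = 1" "has_nt_limit f \<xi> l"
  shows "(\<lambda>n. f (radial_seq \<xi> n)) \<longlonglongrightarrow> l"
proof -
  have "(f \<longlongrightarrow> l) (at \<xi> within stolz_region 2 \<xi>)" using assms(2) unfolding has_nt_limit_def by simp
  then show ?thesis
    unfolding tendsto_at_iff_sequentially comp_def using radial_seq_props[OF assms(1)] by auto
qed

lemma has_nt_limit_unique:
  assumes "cmod \<xi> = 1" "has_nt_limit f \<xi> l" "has_nt_limit f \<xi> l'"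
  shows "l = l'"
  using has_nt_limit_radial[OF assms(1)] assms(2,3) LIMSEQ_unique by blast

text \<open>Apertures \<open>m + 2\<close> exhaust all apertures and levels
  \<open>1 / (j + 1)\<close> all positive levels, so one null set excludes every oscillation. The
  limit along \<open>radial_seq\<close> is common to all the apertures.\<close>

theorem fatou_nontangential:
  fixes f :: "complex \<Rightarrow> 'a::complex_hilbert"
  assumes f: "weakly_holomorphic f" and B: "\<And>z. z \<in> unit_disk \<Longrightarrow> norm (f z) \<le> B"
  shows "ae_circle (\<lambda>\<xi>. \<exists>l. has_nt_limit f \<xi> l)"
proof -
  let ?N = "\<Union>m j. {t \<in> {0..2*pi}. oscillates (real m + 2) f (inverse (real (Suc j))) (cis t)}"
  have neg: "negligible ?N"
    by (intro negligible_countable_Union[of "range _"] negligible_oscillates[OF f B]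
        negligible_Union_nat) auto
  have ok: "\<exists>l. has_nt_limit f (cis t) l" if t: "t \<in> {0..2*pi}" "t \<notin> ?N" for t
  proof -
    let ?\<xi> = "cis t"
    have \<xi>: "cmod ?\<xi> = 1" by simp
    have osc: "\<exists>\<delta>>0. \<forall>z\<in>stolz_region (real m + 2) ?\<xi> \<inter> ball ?\<xi> \<delta>.
        \<forall>w\<in>stolz_region (real m + 2) ?\<xi> \<inter> ball ?\<xi> \<delta>. norm (f z - f w) < e" if e: "e > 0" for m and e :: real
    proof -
      obtain j where j: "inverse (real (Suc j)) < e" using reals_Archimedean[OF e] by blast
      have "\<not> oscillates (real m + 2) f (inverse (real (Suc j))) ?\<xi>" using t by blast
      then show ?thesis unfolding oscillates_def using j by (meson less_trans not_less)
    qed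
    have near: "\<exists>M. \<forall>n\<ge>M. radial_seq ?\<xi> n \<in> stolz_region (real m + 2) ?\<xi> \<inter> ball ?\<xi> \<delta>"
      if d: "\<delta> > 0" for m \<delta>
    proof -
      obtain M where "\<forall>n\<ge>M. dist (radial_seq ?\<xi> n) ?\<xi> < \<delta>"
        using metric_LIMSEQ_D[OF radial_seq_tendsto[OF \<xi>] d] by blast
      then show ?thesis using radial_seq_stolz[OF \<xi>, of "real m + 2"]
        by (intro exI[of _ M]) (auto simp: dist_commute)
    qed
    have "Cauchy (\<lambda>n. f (radial_seq ?\<xi> n))"
    proof (rule CauchyI)
      fix e :: real assume "0 < e"
      from osc[OF this, of 0] near[of _ 0]
      show "\<exists>M. \<forall>m\<ge>M. \<forall>n\<ge>M. norm (f (radial_seq ?\<xi> m) - f (radial_seq ?\<xi> n)) < e"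
        by (metis)
    qed
    then obtain l where l: "(\<lambda>n. f (radial_seq ?\<xi> n)) \<longlonglongrightarrow> l"
      using Cauchy_convergent convergent_def by blast
    have "(f \<longlongrightarrow> l) (at ?\<xi> within stolz_region (real m + 2) ?\<xi>)" for m
      unfolding Lim_within
    proof (intro allI impI)
      fix e :: real assume e: "0 < e"
      then have "e/2 > 0" by simp
      from osc[OF this, of m] obtain \<delta> where \<delta>: "\<delta> > 0"
        and d: "\<And>z w. z \<in> stolz_region (real m + 2) ?\<xi> \<inter> ball ?\<xi> \<delta> \<Longrightarrow>
          w \<in> stolz_region (real m + 2) ?\<xi> \<inter> ball ?\<xi> \<delta> \<Longrightarrow> norm (f z - f w) < e/2" by blast
      obtain M where M: "\<And>n. n \<ge> M \<Longrightarrow> radial_seq ?\<xi> n \<in> stolz_region (real m + 2) ?\<xi> \<inter> ball ?\<xi> \<delta>"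
        using near[OF \<delta>, of m] by blast
      have "dist (f z) l < e" if z: "z \<in> stolz_region (real m + 2) ?\<xi>" "dist z ?\<xi> < \<delta>" for z
      proof -
        have zb: "z \<in> stolz_region (real m + 2) ?\<xi> \<inter> ball ?\<xi> \<delta>" using z by (simp add: dist_commute)
        have "(\<lambda>n. norm (f z - f (radial_seq ?\<xi> n))) \<longlonglongrightarrow> norm (f z - l)" by (intro tendsto_intros l)
        then have "norm (f z - l) \<le> e/2"
          by (rule LIMSEQ_le_const2) (use d[OF zb M] in \<open>auto intro!: exI[of _ M] less_imp_le\<close>)
        then show ?thesis using e unfolding dist_norm by simp
      qed
      then show "\<exists>d>0. \<forall>x\<in>stolz_region (real m + 2) ?\<xi>. 0 < dist x ?\<xi> \<and> dist x ?\<xi> < d \<longrightarrow> dist (f x) l < e"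
        using \<delta> by blast
    qed
    then have "has_nt_limit f ?\<xi> l" unfolding has_nt_limit_def
    proof (intro allI impI)
      fix a :: real assume lim: "\<And>m. (f \<longlongrightarrow> l) (at ?\<xi> within stolz_region (real m + 2) ?\<xi>)"
      obtain m where "a \<le> real m" using real_arch_simple by blast
      then have "stolz_region a ?\<xi> \<subseteq> stolz_region (real m + 2) ?\<xi>"
        unfolding stolz_region_def by (auto elim!: less_le_trans intro!: mult_right_mono)
      then show "(f \<longlongrightarrow> l) (at ?\<xi> within stolz_region a ?\<xi>)" using lim tendsto_within_subset by blast
    qed
    then show ?thesis by blast
  qed
  have "AE t in lebesgue. t \<in> {0..2*pi} \<longrightarrow> (\<exists>l. has_nt_limit f (cis t) l)"
  proof (rule AE_I')
    show "?N \<in> null_sets lebesgue" using neg by (simp add: negligible_iff_null_sets)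
  qed (use ok in blast)
  then show ?thesis unfolding ae_circle_def by (subst AE_restrict_space_iff) auto
qed

section \<open>Moving norm inequalities between the circle and the disk\<close>

section \<open>Boundary values of Schur class functions\<close>

lemma ae_circle_mono:
  assumes "ae_circle P" "\<And>\<xi>. cmod \<xi> = 1 \<Longrightarrow> P \<xi> \<Longrightarrow> Q \<xi>"
  shows "ae_circle Q"
  using assms(1) unfolding ae_circle_def by (rule eventually_mono) (rule assms(2), simp_all)

lemma ae_circle_conj: "ae_circle P \<Longrightarrow> ae_circle Q \<Longrightarrow> ae_circle (\<lambda>\<xi>. P \<xi> \<and> Q \<xi>)"
  unfolding ae_circle_def by (rule AE_conjI)

lemma ae_circle_all_countable:
  assumes "countable I" "\<And>i. i \<in> I \<Longrightarrow> ae_circle (P i)"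
  shows "ae_circle (\<lambda>\<xi>. \<forall>i\<in>I. P i \<xi>)"
  using assms unfolding ae_circle_def by (subst AE_ball_countable) auto

lemma ae_circle_negligible:
  assumes "ae_circle P"
  shows "negligible {t \<in> {0..2*pi}. \<not> P (cis t)}"
proof -
  have "AE t in lebesgue. t \<in> {0..2*pi} \<longrightarrow> P (cis t)"
    using assms unfolding ae_circle_def by (subst (asm) AE_restrict_space_iff) auto
  then obtain N where N: "{t \<in> space lebesgue. \<not> (t \<in> {0..2*pi} \<longrightarrow> P (cis t))} \<subseteq> N"
    "emeasure lebesgue N = 0" "N \<in> sets lebesgue" by (rule AE_E)
  then have "negligible N" by (simp add: negligible_iff_null_sets null_sets_def)
  then show ?thesis by (rule negligible_subset) (use N(1) in auto)
qed

text \<open>Poisson formula for the dilates of \<open>s\<close> by \<open>\<rho> n\<close>, followed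
  by dominated convergence with the majorant \<open>max B c\<close>.\<close>

lemma scalar_boundary_bound:
  fixes s :: "complex \<Rightarrow> complex"
  assumes s: "s holomorphic_on unit_disk" and B: "\<And>z. z \<in> unit_disk \<Longrightarrow> cmod (s z) \<le> B"
    and ae: "ae_circle (\<lambda>\<xi>. \<exists>l. (\<lambda>n. s (radial_seq \<xi> n)) \<longlonglongrightarrow> l \<and> cmod l \<le> c)"
    and c: "0 \<le> c" and z: "z \<in> unit_disk"
  shows "cmod (s z) \<le> c"
proof -
  define \<rho> where "\<rho> n = 1 - inverse (real (Suc (Suc n)))" for n
  have \<rho>: "0 < \<rho> n" "\<rho> n < 1" for n unfolding \<rho>_def by (auto simp: field_simps)
  have rad: "complex_of_real (\<rho> n) * \<xi> = radial_seq \<xi> (Suc n)" for n \<xi>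
    unfolding \<rho>_def radial_seq_def by simp
  have z1: "cmod z < 1" using z by simp
  let ?I = "{0..2*pi}"
  define N where "N = {t \<in> ?I. \<not> (\<exists>l. (\<lambda>n. s (radial_seq (cis t) n)) \<longlonglongrightarrow> l \<and> cmod l \<le> c)}"
  have N: "negligible N" unfolding N_def by (rule ae_circle_negligible[OF ae])
  have sc: "continuous_on unit_disk s" by (rule holomorphic_on_imp_continuous_on[OF s])
  have B0: "0 \<le> B" using B[OF z] norm_ge_zero order_trans by blast
  \<comment> \<open>Cutting the modulus off from below at \<open>c\<close> makes the integrands
    converge to exactly \<open>poisson_kernel z t * c\<close> off \<open>N\<close>; the unknown
    boundary modulus disappears from the limit.\<close>
  define m where "m n t = poisson_kernel z t * max (cmod (s (\<rho> n * cis t))) c" for n t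
  have mint: "m n integrable_on ?I" for n
    unfolding m_def using \<rho>[of n]
    by (intro integrable_continuous_interval continuous_intros z1 continuous_on_compose2[OF sc])
      (auto simp: norm_mult)
  have le: "2 * pi * cmod (s (\<rho> n * z)) \<le> integral ?I (m n)" for n
  proof -
    have "(\<lambda>w::complex. s (\<rho> n * w)) holomorphic_on ball 0 (1 / \<rho> n)"
      by (rule holomorphic_on_compose_gen[of "\<lambda>w::complex. \<rho> n * w" _ s unit_disk, unfolded o_def])
        (use \<rho>[of n] in \<open>auto intro!: holomorphic_intros s simp: norm_mult field_simps\<close>)
    from poisson_formula[OF this _ z1] \<rho>[of n]
    have I: "((\<lambda>t. complex_of_real (poisson_kernel z t) * s (\<rho> n * cis t)) has_integral 2 * pi * s (\<rho> n * z)) ?I"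
      by (simp add: field_simps)
    have "norm (integral ?I (\<lambda>t. complex_of_real (poisson_kernel z t) * s (\<rho> n * cis t))) \<le> integral ?I (m n)"
    proof (rule Henstock_Kurzweil_Integration.integral_norm_bound_integral[OF _ mint])
      show "(\<lambda>t. complex_of_real (poisson_kernel z t) * s (\<rho> n * cis t)) integrable_on ?I" using I by blast
      show "norm (complex_of_real (poisson_kernel z t) * s (\<rho> n * cis t)) \<le> m n t" for t
        unfolding m_def norm_mult norm_of_real abs_of_nonneg[OF poisson_kernel_nonneg[OF z1]]
        by (intro mult_left_mono poisson_kernel_nonneg[OF z1]) simp
    qed
    then show ?thesis unfolding integral_unique[OF I] by (simp add: norm_mult)
  qed
  \<comment> \<open>Both functions are set to 0 on the null set \<open>N\<close>, so that the
    convergence holds at every point.\<close>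
  let ?f = "\<lambda>n t. if t \<in> N then 0 else m n t" and ?g = "\<lambda>t. if t \<in> N then 0 else poisson_kernel z t * c"
  have fm: "integral ?I (?f n) = integral ?I (m n)" "?f n integrable_on ?I" for n
    by (rule integral_spike[OF N], simp) (rule integrable_spike[OF mint N], simp)
  have gm: "integral ?I ?g = 2 * pi * c"
  proof -
    have "integral ?I ?g = integral ?I (\<lambda>t. poisson_kernel z t * c)" by (rule integral_spike[OF N]) simp
    also have "\<dots> = 2 * pi * c"
      using has_integral_mult_left[OF poisson_kernel_integral[OF z1], of c] by (rule integral_unique)
    finally show ?thesis .
  qed
  have "(\<lambda>n. integral ?I (?f n)) \<longlonglongrightarrow> integral ?I ?g"
  proof (rule dominated_convergence(2)[where h = "\<lambda>t. poisson_kernel z t * max B c"])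
    show "?f n integrable_on ?I" for n by (rule fm)
    show "(\<lambda>t. poisson_kernel z t * max B c) integrable_on ?I"
      by (intro integrable_continuous_interval continuous_intros z1)
    fix n t
    have "max (cmod (s (\<rho> n * cis t))) c \<le> max B c"
      using B[of "\<rho> n * cis t"] \<rho>[of n] by (auto simp: norm_mult le_max_iff_disj)
    then have "m n t \<le> poisson_kernel z t * max B c"
      unfolding m_def by (intro mult_left_mono poisson_kernel_nonneg[OF z1])
    moreover have "0 \<le> m n t" unfolding m_def using c poisson_kernel_nonneg[OF z1] by simp
    ultimately show "norm (?f n t) \<le> poisson_kernel z t * max B c" by auto
  next
    fix t assume t: "t \<in> ?I"
    show "(\<lambda>n. ?f n t) \<longlonglongrightarrow> ?g t"
    proof (cases "t \<in> N")
      case False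
      then obtain l where l: "(\<lambda>n. s (radial_seq (cis t) n)) \<longlonglongrightarrow> l" "cmod l \<le> c"
        using t unfolding N_def by blast
      have "(\<lambda>n. s (\<rho> n * cis t)) \<longlonglongrightarrow> l" unfolding rad using LIMSEQ_Suc[OF l(1)] .
      then have "(\<lambda>n. m n t) \<longlonglongrightarrow> poisson_kernel z t * max (cmod l) c"
        unfolding m_def by (intro tendsto_intros)
      then show ?thesis using False l(2) by (simp add: max_def)
    qed simp
  qed
  then have lim: "(\<lambda>n. integral ?I (m n)) \<longlonglongrightarrow> 2 * pi * c" unfolding fm gm .
  have "\<rho> \<longlonglongrightarrow> 1 - 0" unfolding \<rho>_def
    by (intro tendsto_intros LIMSEQ_Suc[OF LIMSEQ_inverse_real_of_nat])
  then have "(\<lambda>n. complex_of_real (\<rho> n) * z) \<longlonglongrightarrow> of_real (1 - 0) * z" by (intro tendsto_intros)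
  moreover have "isCont s z" using sc z by (simp add: continuous_on_eq_continuous_at)
  ultimately have "(\<lambda>n. s (\<rho> n * z)) \<longlonglongrightarrow> s z"
    using isCont_tendsto_compose[of z s "\<lambda>n. of_real (\<rho> n) * z" sequentially] by simp
  then have "(\<lambda>n. 2 * pi * cmod (s (\<rho> n * z))) \<longlonglongrightarrow> 2 * pi * cmod (s z)" by (intro tendsto_intros)
  from LIMSEQ_le[OF this lim] le have "2 * pi * cmod (s z) \<le> 2 * pi * c" by blast
  then show ?thesis by simp
qed

text \<open>With \<open>z\<close> frozen, \<open>s\<close> pairs \<open>(f w, g w)\<close> with
  \<open>(f z, g z)\<close>. By Cauchy-Schwarz its boundary modulus is at most
  \<open>sqrt c * sqrt d\<close>, while \<open>s z = d\<close>; the scalar bound gives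
  \<open>d \<le> sqrt c * sqrt d\<close>, hence \<open>d \<le> c\<close>.\<close>

lemma boundary_to_disk:
  fixes f :: "complex \<Rightarrow> 'a::complex_hilbert" and g :: "complex \<Rightarrow> 'b::complex_hilbert"
  assumes f: "weakly_holomorphic f" "\<And>z. z \<in> unit_disk \<Longrightarrow> norm (f z) \<le> B"
    and g: "weakly_holomorphic g" "\<And>z. z \<in> unit_disk \<Longrightarrow> norm (g z) \<le> B"
    and ae: "ae_circle (\<lambda>\<xi>. \<exists>l k. has_nt_limit f \<xi> l \<and> has_nt_limit g \<xi> k \<and> (norm l)\<^sup>2 + (norm k)\<^sup>2 \<le> c)"
    and z: "z \<in> unit_disk" and c: "0 \<le> c"
  shows "(norm (f z))\<^sup>2 + (norm (g z))\<^sup>2 \<le> c"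
proof -
  define s where "s w = cinner (f w) (f z) + cinner (g w) (g z)" for w
  define d where "d = (norm (f z))\<^sup>2 + (norm (g z))\<^sup>2"
  have d0: "0 \<le> d" unfolding d_def by simp
  have cs: "cmod (cinner l (f z) + cinner k (g z)) \<le> sqrt e * sqrt d" if "(norm l)\<^sup>2 + (norm k)\<^sup>2 \<le> e" for l k e
  proof -
    have "cmod (cinner l (f z) + cinner k (g z)) \<le> norm l * norm (f z) + norm k * norm (g z)"
      using cinner_cauchy_schwarz[of l "f z"] cinner_cauchy_schwarz[of k "g z"]
      by (intro norm_triangle_le add_mono)
    also have "\<dots> \<le> norm (norm l, norm k) * norm (norm (f z), norm (g z))"
      using norm_cauchy_schwarz[of "(norm l, norm k)" "(norm (f z), norm (g z))"] by simp
    also have "\<dots> = sqrt ((norm l)\<^sup>2 + (norm k)\<^sup>2) * sqrt d" unfolding d_def by (simp add: norm_Pair)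
    also have "\<dots> \<le> sqrt e * sqrt d" using that d0 by (intro mult_right_mono) auto
    finally show ?thesis .
  qed
  have B0: "0 \<le> B" using f(2)[OF z] norm_ge_zero order_trans by blast
  have "cmod (s z) \<le> sqrt c * sqrt d"
  proof (rule scalar_boundary_bound[OF _ _ _ _ z])
    show "s holomorphic_on unit_disk" unfolding s_def
      by (intro holomorphic_intros weakly_holomorphicD f g)
    show "cmod (s w) \<le> sqrt (B\<^sup>2 + B\<^sup>2) * sqrt d" if "w \<in> unit_disk" for w
      unfolding s_def by (rule cs) (intro add_mono power_mono f g that norm_ge_zero)
    show "0 \<le> sqrt c * sqrt d" using c d0 by simp
    show "ae_circle (\<lambda>\<xi>. \<exists>l. (\<lambda>n. s (radial_seq \<xi> n)) \<longlonglongrightarrow> l \<and> cmod l \<le> sqrt c * sqrt d)"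
    proof (rule ae_circle_mono[OF ae])
      fix \<xi> :: complex assume \<xi>: "cmod \<xi> = 1"
      assume "\<exists>l k. has_nt_limit f \<xi> l \<and> has_nt_limit g \<xi> k \<and> (norm l)\<^sup>2 + (norm k)\<^sup>2 \<le> c"
      then obtain l k where lk: "has_nt_limit f \<xi> l" "has_nt_limit g \<xi> k" "(norm l)\<^sup>2 + (norm k)\<^sup>2 \<le> c"
        by blast
      have "(\<lambda>n. s (radial_seq \<xi> n)) \<longlonglongrightarrow> cinner l (f z) + cinner k (g z)"
        unfolding s_def by (intro tendsto_intros has_nt_limit_radial[OF \<xi>] lk)
      then show "\<exists>l. (\<lambda>n. s (radial_seq \<xi> n)) \<longlonglongrightarrow> l \<and> cmod l \<le> sqrt c * sqrt d"
        using cs[OF lk(3)] by blast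
    qed
  qed
  moreover have "s z = complex_of_real d" unfolding s_def d_def cinner_self by simp
  ultimately have ineq: "sqrt d * sqrt d \<le> sqrt c * sqrt d" using d0 by (simp add: norm_of_real)
  have "sqrt d \<le> sqrt c" if "d \<noteq> 0"
    by (rule mult_right_le_imp_le[OF ineq]) (use that d0 in simp)
  then show ?thesis unfolding d_def[symmetric] using c by auto
qed

subsection \<open>Strong boundary values\<close>

text \<open>The condition \<open>cmod \<xi> = 1\<close> is included because uniqueness of
  nontangential limits, hence the meaning of \<open>bdry\<close>, is proved on the circle.\<close>

definition strong_limits :: "'a set \<Rightarrow> (complex \<Rightarrow> 'a \<Rightarrow> 'b::complex_hilbert) \<Rightarrow> complex \<Rightarrow> bool" where
  "strong_limits U F \<xi> \<longleftrightarrow> cmod \<xi> = 1 \<and> (\<forall>x\<in>U. \<exists>y. has_nt_limit (\<lambda>z. F z x) \<xi> y)"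

text \<open>Separability of a subset rather than of a type: the auxiliary space of a left defect
  function lives in a type without countability assumptions.\<close>

definition separable_set :: "'a::topological_space set \<Rightarrow> bool" where
  "separable_set U \<longleftrightarrow> (\<exists>Q. countable Q \<and> Q \<subseteq> U \<and> U \<subseteq> closure Q)"

lemma separable_set_second_countable: "separable_set (U :: 'a::second_countable_topology set)"
proof -
  obtain B :: "'a set set" where B: "countable B" "topological_basis B" using ex_countable_basis by blast
  define Q where "Q = (\<lambda>b. SOME x. x \<in> b \<inter> U) ` {b\<in>B. b \<inter> U \<noteq> {}}"
  have pick: "(SOME x. x \<in> b \<inter> U) \<in> b \<inter> U" if "b \<inter> U \<noteq> {}" for b
    using that by (meson ex_in_conv someI_ex)
  have "x \<in> closure Q" if x: "x \<in> U" for x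
    unfolding closure_iff_nhds_not_empty
  proof (intro allI impI)
    fix A V assume "V \<subseteq> A" "open V" "x \<in> V"
    then obtain b where b: "b \<in> B" "x \<in> b" "b \<subseteq> V" using topological_basisE[OF B(2)] by metis
    have ne: "b \<inter> U \<noteq> {}" using b x by blast
    then have "(SOME x. x \<in> b \<inter> U) \<in> Q" unfolding Q_def using b by blast
    then show "Q \<inter> A \<noteq> {}" using pick[OF ne] b \<open>V \<subseteq> A\<close> by blast
  qed
  moreover have "countable Q" unfolding Q_def using B(1) by simp
  moreover have "Q \<subseteq> U" unfolding Q_def using pick by blast
  ultimately show ?thesis unfolding separable_set_def by blast
qed

lemma schur_classD:
  assumes "closed_csubspace U" "F \<in> schur_class U V"
  shows schur_class_bounded: "z \<in> unit_disk \<Longrightarrow> F z \<in> bounded_ops U V"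
    and schur_class_norm: "z \<in> unit_disk \<Longrightarrow> x \<in> U \<Longrightarrow> norm (F z x) \<le> norm x"
    and schur_class_weakly: "x \<in> U \<Longrightarrow> weakly_holomorphic (\<lambda>z. F z x)"
  using assms op_holomorphic_weakly[OF assms(1)] unfolding schur_class_def op_holomorphic_def by auto

text \<open>Countably many null sets serve a countable dense \<open>Q\<close>. Contractivity makes
  the limits on \<open>Q\<close> Lipschitz and extends the convergence to \<open>U\<close> by an
  \<open>e/3\<close> argument.\<close>

theorem fatou_operator:
  assumes U: "closed_csubspace U" "separable_set U" and F: "F \<in> schur_class U V"
  shows "ae_circle (strong_limits U F)"
proof -
  obtain Q where Q: "countable Q" "Q \<subseteq> U" "U \<subseteq> closure Q" using U(2) unfolding separable_set_def by blast
  have "ae_circle (\<lambda>\<xi>. \<exists>l. has_nt_limit (\<lambda>z. F z q) \<xi> l)" if "q \<in> Q" for q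
    by (rule fatou_nontangential[OF schur_class_weakly[OF U(1) F] schur_class_norm[OF U(1) F]])
      (use Q that in auto)
  from ae_circle_all_countable[OF Q(1) this]
  show ?thesis
  proof (rule ae_circle_mono)
    fix \<xi> :: complex assume \<xi>: "cmod \<xi> = 1"
    assume "\<forall>q\<in>Q. \<exists>l. has_nt_limit (\<lambda>z. F z q) \<xi> l"
    then obtain L where L: "\<And>q. q \<in> Q \<Longrightarrow> has_nt_limit (\<lambda>z. F z q) \<xi> (L q)" by metis
    have Ld: "norm (L p - L q) \<le> norm (p - q)" if "p \<in> Q" "q \<in> Q" for p q
    proof (rule LIMSEQ_le_const2)
      show "(\<lambda>n. norm (F (radial_seq \<xi> n) p - F (radial_seq \<xi> n) q)) \<longlonglongrightarrow> norm (L p - L q)"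
        by (intro tendsto_intros has_nt_limit_radial[OF \<xi> L] that)
      have r: "radial_seq \<xi> n \<in> unit_disk" for n
        using stolz_region_disk[OF radial_seq_stolz[OF \<xi>, of 2]] by simp
      have pq: "p \<in> U" "q \<in> U" using that Q by auto
      then have pq': "p - q \<in> U" by (rule csubspace_diff[OF U(1)])
      have "norm (F (radial_seq \<xi> n) p - F (radial_seq \<xi> n) q) \<le> norm (p - q)" for n
        using schur_class_norm[OF U(1) F r pq'] bounded_ops_diff[OF U(1) schur_class_bounded[OF U(1) F r] pq(1,2)]
        by simp
      then show "\<exists>N. \<forall>n\<ge>N. norm (F (radial_seq \<xi> n) p - F (radial_seq \<xi> n) q) \<le> norm (p - q)" by blast
    qed
    have "\<exists>y. has_nt_limit (\<lambda>z. F z x) \<xi> y" if x: "x \<in> U" for x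
    proof -
      from subsetD[OF Q(3) x] obtain q where q: "\<And>n. q n \<in> Q" "q \<longlonglongrightarrow> x"
        unfolding closure_sequential by blast
      have "Cauchy (\<lambda>n. L (q n))"
      proof (rule CauchyI)
        fix e :: real assume "0 < e"
        then obtain M where "\<forall>m\<ge>M. \<forall>n\<ge>M. norm (q m - q n) < e"
          using CauchyD[OF LIMSEQ_imp_Cauchy[OF q(2)]] by blast
        then show "\<exists>M. \<forall>m\<ge>M. \<forall>n\<ge>M. norm (L (q m) - L (q n)) < e"
          using Ld[OF q(1) q(1)] by (meson le_less_trans)
      qed
      then obtain y where y: "(\<lambda>n. L (q n)) \<longlonglongrightarrow> y" using Cauchy_convergent convergent_def by blast
      have "((\<lambda>z. F z x) \<longlongrightarrow> y) (at \<xi> within stolz_region a \<xi>)" if a: "1 < a" for a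
      proof (rule tendstoI)
        fix e :: real assume e: "0 < e"
        then have e3: "e/3 > 0" by simp
        obtain n where n: "norm (q n - x) < e/3" "norm (L (q n) - y) < e/3"
        proof -
          obtain M1 where M1: "\<forall>n\<ge>M1. norm (q n - x) < e/3" using LIMSEQ_D[OF q(2) e3] by blast
          obtain M2 where M2: "\<forall>n\<ge>M2. norm (L (q n) - y) < e/3" using LIMSEQ_D[OF y e3] by blast
          show ?thesis using that[of "max M1 M2"] M1 M2 by simp
        qed
        have "((\<lambda>z. F z (q n)) \<longlongrightarrow> L (q n)) (at \<xi> within stolz_region a \<xi>)"
          using L[OF q(1)] a unfolding has_nt_limit_def by blast
        then have "\<forall>\<^sub>F z in at \<xi> within stolz_region a \<xi>. dist (F z (q n)) (L (q n)) < e/3"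
          using e3 by (rule tendstoD)
        moreover have "\<forall>\<^sub>F z in at \<xi> within stolz_region a \<xi>. z \<in> unit_disk"
          unfolding eventually_at_filter by (intro always_eventually) (auto dest!: stolz_region_disk)
        ultimately show "\<forall>\<^sub>F z in at \<xi> within stolz_region a \<xi>. dist (F z x) y < e"
        proof eventually_elim
          fix z assume z: "dist (F z (q n)) (L (q n)) < e/3" "z \<in> unit_disk"
          have qU: "q n \<in> U" using q(1) Q(2) by blast
          have "norm (F z (q n) - F z x) \<le> norm (q n - x)"
            using schur_class_norm[OF U(1) F z(2) csubspace_diff[OF U(1) qU x]]
              bounded_ops_diff[OF U(1) schur_class_bounded[OF U(1) F z(2)] qU x] by simp
          then have "dist (F z (q n)) (F z x) < e/3" using n by (simp add: dist_norm)
          moreover have "dist (L (q n)) y < e/3" using n by (simp add: dist_norm)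
          ultimately show "dist (F z x) y < e"
            using z(1) dist_triangle[of "F z x" y "F z (q n)"] dist_triangle[of "F z (q n)" y "L (q n)"]
            by (simp add: dist_commute)
        qed
      qed
      then show ?thesis unfolding has_nt_limit_def by blast
    qed
    then show "strong_limits U F \<xi>" unfolding strong_limits_def using \<xi> by blast
  qed
qed

lemma bdry_nt_limit:
  assumes "strong_limits U F \<xi>" "x \<in> U"
  shows "has_nt_limit (\<lambda>z. F z x) \<xi> (bdry F \<xi> x)"
proof -
  have \<xi>: "cmod \<xi> = 1" using assms unfolding strong_limits_def by blast
  obtain y where y: "has_nt_limit (\<lambda>z. F z x) \<xi> y" using assms unfolding strong_limits_def by blast
  show ?thesis unfolding bdry_def
    by (rule theI[where P = "has_nt_limit (\<lambda>z. F z x) \<xi>", OF y]) (rule has_nt_limit_unique[OF \<xi> _ y])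
qed

lemma bdry_radial:
  assumes "strong_limits U F \<xi>" "x \<in> U"
  shows "(\<lambda>n. F (radial_seq \<xi> n) x) \<longlonglongrightarrow> bdry F \<xi> x"
  by (rule has_nt_limit_radial[OF _ bdry_nt_limit[OF assms]])
    (use assms in \<open>auto simp: strong_limits_def\<close>)

lemma radial_seq_disk: "cmod \<xi> = 1 \<Longrightarrow> radial_seq \<xi> n \<in> unit_disk"
  using stolz_region_disk[OF radial_seq_stolz[of \<xi> 2]] by simp

lemma bdry_bounded_ops:
  assumes U: "closed_csubspace U" and V: "closed_csubspace V" and F: "F \<in> schur_class U V"
    and lim: "strong_limits U F \<xi>"
  shows "bdry F \<xi> \<in> bounded_ops U V"
proof -
  have r: "radial_seq \<xi> n \<in> unit_disk" for n
    using lim radial_seq_disk unfolding strong_limits_def by blast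
  note Fr = schur_class_bounded[OF U F r]
  note lim = bdry_radial[OF lim]
  show ?thesis
  proof (rule bounded_opsI[where K = 1])
    fix x assume x: "x \<in> U"
    show "bdry F \<xi> x \<in> V"
      by (rule csubspace_lim[OF V lim[OF x]]) (auto intro!: always_eventually bounded_ops_mem[OF Fr] x)
    show "norm (bdry F \<xi> x) \<le> 1 * norm x"
      using LIMSEQ_le_const2[OF tendsto_norm[OF lim[OF x]]] schur_class_norm[OF U F r x] by auto
    show "bdry F \<xi> (c *\<^sub>C x) = c *\<^sub>C bdry F \<xi> x" for c
    proof (rule LIMSEQ_unique[OF lim[OF csubspace_scaleC[OF U x]]])
      show "(\<lambda>n. F (radial_seq \<xi> n) (c *\<^sub>C x)) \<longlonglongrightarrow> c *\<^sub>C bdry F \<xi> x"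
        unfolding bounded_ops_scaleC[OF Fr x] by (intro tendsto_intros lim x)
    qed
    show "bdry F \<xi> (x + y) = bdry F \<xi> x + bdry F \<xi> y" if y: "y \<in> U" for y
    proof (rule LIMSEQ_unique[OF lim[OF csubspace_add[OF U x y]]])
      show "(\<lambda>n. F (radial_seq \<xi> n) (x + y)) \<longlonglongrightarrow> bdry F \<xi> x + bdry F \<xi> y"
        unfolding bounded_ops_add[OF Fr x y] by (intro tendsto_intros lim x y)
    qed
  qed
qed

lemma cinner_gram:
  assumes "closed_csubspace U" "closed_csubspace V" "F \<in> schur_class U V" "strong_limits U F \<xi>" "x \<in> U"
  shows "cinner (gram U F \<xi> x) x = complex_of_real ((norm (bdry F \<xi> x))\<^sup>2)"
proof -
  have "cinner (gram U F \<xi> x) x = cinner (bdry F \<xi> x) (bdry F \<xi> x)"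
    unfolding gram_def by (rule cinner_adj'[OF assms(1) bdry_bounded_ops[OF assms(1-4)] assms(5), symmetric])
  then show ?thesis unfolding cinner_self .
qed

lemma cinner_cogram:
  assumes "closed_csubspace U" "closed_csubspace V" "F \<in> schur_class U V" "strong_limits U F \<xi>"
  shows "cinner (cogram U F \<xi> y) y = complex_of_real ((norm (adj U (bdry F \<xi>) y))\<^sup>2)"
proof -
  note b = bdry_bounded_ops[OF assms]
  have "cinner (cogram U F \<xi> y) y = cinner (adj U (bdry F \<xi>) y) (adj U (bdry F \<xi>) y)"
    unfolding cogram_def by (rule cinner_adj[OF assms(1) b adj_mem[OF assms(1) b]])
  then show ?thesis unfolding cinner_self .
qed

section \<open>Vanishing of a defect function in terms of scalar rows\<close>

section \<open>Defect functions and scalar rows\<close>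

text \<open>A defect function vanishes iff there is no nonzero scalar-valued competitor; these are
  \<open>row functions\<close> for \<open>N z x = \<parallel>F z x\<parallel>\<^sup>2\<close>, where the defining inequality has been moved into the disk.\<close>

definition row_function ::
    "'a::complex_hilbert set \<Rightarrow> (complex \<Rightarrow> 'a \<Rightarrow> real) \<Rightarrow> (complex \<Rightarrow> 'a \<Rightarrow> complex) \<Rightarrow> bool" where
  "row_function U N p \<longleftrightarrow>
     (\<forall>z\<in>unit_disk. \<forall>x\<in>U. (\<forall>y\<in>U. p z (x + y) = p z x + p z y) \<and> (\<forall>c. p z (c *\<^sub>C x) = c * p z x) \<and>
        (cmod (p z x))\<^sup>2 + N z x \<le> (norm x)\<^sup>2) \<and>
     (\<forall>x\<in>U. (\<lambda>z. p z x) holomorphic_on unit_disk)"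

definition has_row :: "'a::complex_hilbert set \<Rightarrow> (complex \<Rightarrow> 'a \<Rightarrow> real) \<Rightarrow> bool" where
  "has_row U N \<longleftrightarrow> (\<exists>p. row_function U N p \<and> (\<exists>z\<in>unit_disk. \<exists>x\<in>U. p z x \<noteq> 0))"

lemma row_functionD:
  assumes "row_function U N p"
  shows row_function_add: "z \<in> unit_disk \<Longrightarrow> x \<in> U \<Longrightarrow> y \<in> U \<Longrightarrow> p z (x + y) = p z x + p z y"
    and row_function_scale: "z \<in> unit_disk \<Longrightarrow> x \<in> U \<Longrightarrow> p z (c *\<^sub>C x) = c * p z x"
    and row_function_bound: "z \<in> unit_disk \<Longrightarrow> x \<in> U \<Longrightarrow> (cmod (p z x))\<^sup>2 + N z x \<le> (norm x)\<^sup>2"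
    and row_function_holomorphic: "x \<in> U \<Longrightarrow> (\<lambda>z. p z x) holomorphic_on unit_disk"
proof -
  note a = conjunct1[OF assms[unfolded row_function_def], THEN bspec, THEN bspec]
  show "z \<in> unit_disk \<Longrightarrow> x \<in> U \<Longrightarrow> y \<in> U \<Longrightarrow> p z (x + y) = p z x + p z y"
    by (rule conjunct1[OF a, THEN bspec])
  show "z \<in> unit_disk \<Longrightarrow> x \<in> U \<Longrightarrow> p z (c *\<^sub>C x) = c * p z x"
    by (rule conjunct1[OF conjunct2[OF a], THEN spec])
  show "z \<in> unit_disk \<Longrightarrow> x \<in> U \<Longrightarrow> (cmod (p z x))\<^sup>2 + N z x \<le> (norm x)\<^sup>2"
    by (rule conjunct2[OF conjunct2[OF a]])
  show "x \<in> U \<Longrightarrow> (\<lambda>z. p z x) holomorphic_on unit_disk"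
    by (rule conjunct2[OF assms[unfolded row_function_def], THEN bspec])
qed

lemma row_function_contraction:
  assumes "row_function U N p" "z \<in> unit_disk" "x \<in> U" "0 \<le> N z x"
  shows "cmod (p z x) \<le> norm x"
proof (rule power2_le_imp_le)
  show "(cmod (p z x))\<^sup>2 \<le> (norm x)\<^sup>2" using row_function_bound[OF assms(1-3)] assms(4) by linarith
qed simp

lemma schur_classI:
  assumes "closed_csubspace U" "closed_csubspace V" "\<And>z. z \<in> unit_disk \<Longrightarrow> F z \<in> bounded_ops U V"
    "\<And>z x. z \<in> unit_disk \<Longrightarrow> x \<in> U \<Longrightarrow> norm (F z x) \<le> norm x"
    "\<And>x. x \<in> U \<Longrightarrow> weakly_holomorphic (\<lambda>z. F z x)"
  shows "F \<in> schur_class U V"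
proof -
  have "norm (F z x) \<le> 1 * norm x" if "z \<in> unit_disk" "x \<in> U" for z x
    using assms(4)[OF that] by simp
  from op_holomorphicI[OF assms(1-3) this assms(5)] have "op_holomorphic U V F" .
  then show ?thesis using assms(4) unfolding schur_class_def by simp
qed

lemma op_le_gram_iff:
  assumes U: "closed_csubspace U" and V: "closed_csubspace V" and K: "closed_csubspace K"
    and F: "F \<in> schur_class U V" "strong_limits U F \<xi>"
    and G: "G \<in> schur_class U K" "strong_limits U G \<xi>"
  shows "op_le U (gram U G \<xi>) (\<lambda>x. x - gram U F \<xi> x) \<longleftrightarrow>
    (\<forall>x\<in>U. (norm (bdry F \<xi> x))\<^sup>2 + (norm (bdry G \<xi> x))\<^sup>2 \<le> (norm x)\<^sup>2)"
  unfolding op_le_def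
proof (rule ball_cong[OF refl])
  fix x assume x: "x \<in> U"
  have "cinner (x - gram U F \<xi> x - gram U G \<xi> x) x
      = complex_of_real ((norm x)\<^sup>2 - (norm (bdry F \<xi> x))\<^sup>2 - (norm (bdry G \<xi> x))\<^sup>2)"
    by (simp add: cinner_diff_left cinner_gram[OF U V F x] cinner_gram[OF U K G x] cinner_self)
  then show "cinner (x - gram U F \<xi> x - gram U G \<xi> x) x \<in> \<real>\<^sub>\<ge>\<^sub>0 \<longleftrightarrow>
      (norm (bdry F \<xi> x))\<^sup>2 + (norm (bdry G \<xi> x))\<^sup>2 \<le> (norm x)\<^sup>2"
    by (simp only: nonneg_Reals_of_real_iff) linarith
qed

lemma op_le_cogram_iff:
  assumes U: "closed_csubspace U" and V: "closed_csubspace V" and K: "closed_csubspace K"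
    and F: "F \<in> schur_class U V" "strong_limits U F \<xi>"
    and G: "G \<in> schur_class K V" "strong_limits K G \<xi>"
  shows "op_le V (cogram K G \<xi>) (\<lambda>y. y - cogram U F \<xi> y) \<longleftrightarrow>
    (\<forall>y\<in>V. (norm (adj U (bdry F \<xi>) y))\<^sup>2 + (norm (adj K (bdry G \<xi>) y))\<^sup>2 \<le> (norm y)\<^sup>2)"
  unfolding op_le_def
proof (rule ball_cong[OF refl])
  fix y assume "y \<in> V"
  have "cinner (y - cogram U F \<xi> y - cogram K G \<xi> y) y
      = complex_of_real ((norm y)\<^sup>2 - (norm (adj U (bdry F \<xi>) y))\<^sup>2 - (norm (adj K (bdry G \<xi>) y))\<^sup>2)"
    by (simp add: cinner_diff_left cinner_cogram[OF U V F] cinner_cogram[OF K V G] cinner_self)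
  then show "cinner (y - cogram U F \<xi> y - cogram K G \<xi> y) y \<in> \<real>\<^sub>\<ge>\<^sub>0 \<longleftrightarrow>
      (norm (adj U (bdry F \<xi>) y))\<^sup>2 + (norm (adj K (bdry G \<xi>) y))\<^sup>2 \<le> (norm y)\<^sup>2"
    by (simp only: nonneg_Reals_of_real_iff) linarith
qed

lemma strong_limitsD: "strong_limits U F \<xi> \<Longrightarrow> cmod \<xi> = 1"
  unfolding strong_limits_def by blast

text \<open>Inwards vector by vector with \<open>boundary_to_disk\<close>; outwards by radial
  limits.\<close>

lemma gram_disk_iff:
  assumes U: "closed_csubspace U" and V: "closed_csubspace V" and K: "closed_csubspace K"
    and F: "F \<in> schur_class U V" "ae_circle (strong_limits U F)"
    and G: "G \<in> schur_class U K" "ae_circle (strong_limits U G)"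
  shows "ae_circle (\<lambda>\<xi>. op_le U (gram U G \<xi>) (\<lambda>x. x - gram U F \<xi> x)) \<longleftrightarrow>
    (\<forall>z\<in>unit_disk. \<forall>x\<in>U. (norm (F z x))\<^sup>2 + (norm (G z x))\<^sup>2 \<le> (norm x)\<^sup>2)"
    (is "?L \<longleftrightarrow> ?R")
proof
  assume L: ?L
  show ?R
  proof (intro ballI)
    fix z x assume z: "z \<in> unit_disk" and x: "x \<in> U"
    show "(norm (F z x))\<^sup>2 + (norm (G z x))\<^sup>2 \<le> (norm x)\<^sup>2"
    proof (rule boundary_to_disk[OF schur_class_weakly[OF U F(1) x] schur_class_norm[OF U F(1) _ x]
          schur_class_weakly[OF U G(1) x] schur_class_norm[OF U G(1) _ x] _ z])
      show "ae_circle (\<lambda>\<xi>. \<exists>l k. has_nt_limit (\<lambda>z. F z x) \<xi> l \<and> has_nt_limit (\<lambda>z. G z x) \<xi> k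
          \<and> (norm l)\<^sup>2 + (norm k)\<^sup>2 \<le> (norm x)\<^sup>2)"
      proof (rule ae_circle_mono[OF ae_circle_conj[OF ae_circle_conj[OF F(2) G(2)] L]])
        fix \<xi> assume a: "(strong_limits U F \<xi> \<and> strong_limits U G \<xi>)
          \<and> op_le U (gram U G \<xi>) (\<lambda>x. x - gram U F \<xi> x)"
        then have sF: "strong_limits U F \<xi>" and sG: "strong_limits U G \<xi>" by simp_all
        have "(norm (bdry F \<xi> x))\<^sup>2 + (norm (bdry G \<xi> x))\<^sup>2 \<le> (norm x)\<^sup>2"
          using op_le_gram_iff[OF U V K F(1) sF G(1) sG] a x by simp
        then show "\<exists>l k. has_nt_limit (\<lambda>z. F z x) \<xi> l \<and> has_nt_limit (\<lambda>z. G z x) \<xi> k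
          \<and> (norm l)\<^sup>2 + (norm k)\<^sup>2 \<le> (norm x)\<^sup>2"
          by (intro exI conjI) (rule bdry_nt_limit[OF sF x], rule bdry_nt_limit[OF sG x])
      qed
    qed simp_all
  qed
next
  assume R: ?R
  show ?L
  proof (rule ae_circle_mono[OF ae_circle_conj[OF F(2) G(2)]])
    fix \<xi> assume a: "strong_limits U F \<xi> \<and> strong_limits U G \<xi>"
    have "(norm (bdry F \<xi> x))\<^sup>2 + (norm (bdry G \<xi> x))\<^sup>2 \<le> (norm x)\<^sup>2" if x: "x \<in> U" for x
    proof (rule LIMSEQ_le_const2)
      show "(\<lambda>n. (norm (F (radial_seq \<xi> n) x))\<^sup>2 + (norm (G (radial_seq \<xi> n) x))\<^sup>2)
          \<longlonglongrightarrow> (norm (bdry F \<xi> x))\<^sup>2 + (norm (bdry G \<xi> x))\<^sup>2"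
        using a x by (intro tendsto_intros bdry_radial) auto
      have "radial_seq \<xi> n \<in> unit_disk" for n
        using a strong_limitsD[of U F \<xi>] radial_seq_disk[of \<xi> n] by simp
      then show "\<exists>N. \<forall>n\<ge>N. (norm (F (radial_seq \<xi> n) x))\<^sup>2 + (norm (G (radial_seq \<xi> n) x))\<^sup>2 \<le> (norm x)\<^sup>2"
        using R x by blast
    qed
    then show "op_le U (gram U G \<xi>) (\<lambda>x. x - gram U F \<xi> x)"
      using op_le_gram_iff[OF U V K F(1) _ G(1), of \<xi>] a by simp
  qed
qed

text \<open>Duality: the column formed by the two adjoints is a contraction iff the row
  \<open>(u, k)\<close> to \<open>A u + B k\<close> is. The row form survives strong limits, whereas
  adjoints of strongly convergent operators need not converge strongly.\<close>

lemma row_contraction_iff: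
  assumes U: "closed_csubspace U" and V: "closed_csubspace V" and K: "closed_csubspace K"
    and A: "A \<in> bounded_ops U V" and B: "B \<in> bounded_ops K V"
  shows "(\<forall>y\<in>V. (norm (adj U A y))\<^sup>2 + (norm (adj K B y))\<^sup>2 \<le> (norm y)\<^sup>2) \<longleftrightarrow>
    (\<forall>u\<in>U. \<forall>k\<in>K. (norm (A u + B k))\<^sup>2 \<le> (norm u)\<^sup>2 + (norm k)\<^sup>2)" (is "?L \<longleftrightarrow> ?R")
proof
  have key: "cinner (A u + B k) y = cinner u (adj U A y) + cinner k (adj K B y)" if "u \<in> U" "k \<in> K" for u k y
    by (simp add: cinner_add_left cinner_adj[OF U A that(1)] cinner_adj[OF K B that(2)])
  {
    assume L: ?L
    show ?R
    proof (intro ballI)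
      fix u k assume u: "u \<in> U" and k: "k \<in> K"
      define y where "y = A u + B k"
      have y: "y \<in> V" unfolding y_def using bounded_ops_mem[OF A u] bounded_ops_mem[OF B k] csubspace_add[OF V] by blast
      have "(norm y)\<^sup>2 = cmod (cinner y y)" unfolding cinner_self norm_of_real by simp
      also have "cinner y y = cinner u (adj U A y) + cinner k (adj K B y)"
        using key[OF u k, of y] unfolding y_def .
      also have "cmod \<dots> \<le> norm u * norm (adj U A y) + norm k * norm (adj K B y)"
        using cinner_cauchy_schwarz[of u] cinner_cauchy_schwarz[of k] by (intro norm_triangle_le add_mono)
      also have "\<dots> \<le> norm (norm u, norm k) * norm (norm (adj U A y), norm (adj K B y))"
        using norm_cauchy_schwarz[of "(norm u, norm k)" "(norm (adj U A y), norm (adj K B y))"] by simp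
      also have "\<dots> = norm (norm u, norm k) * sqrt ((norm (adj U A y))\<^sup>2 + (norm (adj K B y))\<^sup>2)"
        by (simp add: norm_Pair)
      also have "\<dots> \<le> norm (norm u, norm k) * sqrt ((norm y)\<^sup>2)"
        using L y by (intro mult_left_mono real_sqrt_le_mono) auto
      finally have *: "norm y * norm y \<le> norm (norm u, norm k) * norm y" by (simp add: power2_eq_square)
      have "norm y \<le> norm (norm u, norm k)"
      proof (cases "norm y = 0")
        case False
        then have "0 < norm y" by simp
        then show ?thesis by (rule mult_right_le_imp_le[OF *])
      next
        case True
        then show ?thesis by (simp only: norm_ge_zero)
      qed
      then have "(norm y)\<^sup>2 \<le> (norm (norm u, norm k))\<^sup>2" by (intro power_mono) auto
      then show "(norm (A u + B k))\<^sup>2 \<le> (norm u)\<^sup>2 + (norm k)\<^sup>2" unfolding y_def by (simp add: norm_Pair)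
    qed
  next
    assume R: ?R
    show ?L
    proof
      fix y assume y: "y \<in> V"
      define u where "u = adj U A y"
      define k where "k = adj K B y"
      define d where "d = (norm u)\<^sup>2 + (norm k)\<^sup>2"
      have d0: "0 \<le> d" unfolding d_def by simp
      have u: "u \<in> U" unfolding u_def by (rule adj_mem[OF U A])
      have k: "k \<in> K" unfolding k_def by (rule adj_mem[OF K B])
      have "cinner (A u + B k) y = complex_of_real d"
        unfolding key[OF u k] u_def[symmetric] k_def[symmetric] cinner_self d_def by simp
      then have "d = cmod (cinner (A u + B k) y)" using d0 by simp
      also have "\<dots> \<le> norm (A u + B k) * norm y" by (rule cinner_cauchy_schwarz)
      finally have "d\<^sup>2 \<le> (norm (A u + B k) * norm y)\<^sup>2" using d0 by (intro power_mono)
      also have "\<dots> = (norm (A u + B k))\<^sup>2 * (norm y)\<^sup>2" by (rule power_mult_distrib)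
      also have "\<dots> \<le> d * (norm y)\<^sup>2" using R u k unfolding d_def by (intro mult_right_mono) auto
      finally have *: "d * d \<le> (norm y)\<^sup>2 * d" by (simp add: power2_eq_square mult.commute)
      have "d \<le> (norm y)\<^sup>2"
      proof (cases "d = 0")
        case False
        then have "0 < d" using d0 by simp
        then show ?thesis by (rule mult_right_le_imp_le[OF *])
      qed simp
      then show "(norm (adj U A y))\<^sup>2 + (norm (adj K B y))\<^sup>2 \<le> (norm y)\<^sup>2"
        unfolding d_def u_def k_def .
    qed
  }
qed

lemma cogram_disk_iff:
  assumes U: "closed_csubspace U" and V: "closed_csubspace V" and K: "closed_csubspace K"
    and F: "F \<in> schur_class U V" "ae_circle (strong_limits U F)"
    and G: "G \<in> schur_class K V" "ae_circle (strong_limits K G)"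
  shows "ae_circle (\<lambda>\<xi>. op_le V (cogram K G \<xi>) (\<lambda>y. y - cogram U F \<xi> y)) \<longleftrightarrow>
    (\<forall>z\<in>unit_disk. \<forall>y\<in>V. (norm (adj U (F z) y))\<^sup>2 + (norm (adj K (G z) y))\<^sup>2 \<le> (norm y)\<^sup>2)"
    (is "?L \<longleftrightarrow> ?R")
proof -
  have disk: "?R \<longleftrightarrow> (\<forall>z\<in>unit_disk. \<forall>u\<in>U. \<forall>k\<in>K. (norm (F z u + G z k))\<^sup>2 \<le> (norm u)\<^sup>2 + (norm k)\<^sup>2)"
    using row_contraction_iff[OF U V K schur_class_bounded[OF U F(1)] schur_class_bounded[OF K G(1)]] by auto
  have circ: "op_le V (cogram K G \<xi>) (\<lambda>y. y - cogram U F \<xi> y) \<longleftrightarrow>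
      (\<forall>u\<in>U. \<forall>k\<in>K. (norm (bdry F \<xi> u + bdry G \<xi> k))\<^sup>2 \<le> (norm u)\<^sup>2 + (norm k)\<^sup>2)"
    if "strong_limits U F \<xi>" "strong_limits K G \<xi>" for \<xi>
    using op_le_cogram_iff[OF U V K F(1) that(1) G(1) that(2)]
      row_contraction_iff[OF U V K bdry_bounded_ops[OF U V F(1) that(1)] bdry_bounded_ops[OF K V G(1) that(2)]]
    by simp
  show ?thesis
    unfolding disk
  proof
    assume L: ?L
    show "\<forall>z\<in>unit_disk. \<forall>u\<in>U. \<forall>k\<in>K. (norm (F z u + G z k))\<^sup>2 \<le> (norm u)\<^sup>2 + (norm k)\<^sup>2"
    proof (intro ballI)
      fix z u k assume z: "z \<in> unit_disk" and u: "u \<in> U" and k: "k \<in> K"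
      have n: "norm (F w u + G w k) \<le> norm u + norm k" if "w \<in> unit_disk" for w
        by (intro norm_triangle_le add_mono schur_class_norm[OF U F(1)] schur_class_norm[OF K G(1)] that u k)
      \<comment> \<open>The zero function in \<open>ell2\<close> fills the second slot of
        \<open>boundary_to_disk\<close>.\<close>
      have "(norm (F z u + G z k))\<^sup>2 + (norm (0 :: ell2))\<^sup>2 \<le> (norm u)\<^sup>2 + (norm k)\<^sup>2"
      proof (rule boundary_to_disk[OF weakly_holomorphic_add[OF schur_class_weakly[OF U F(1) u] schur_class_weakly[OF K G(1) k]]
            n, where g = "\<lambda>_. 0 :: ell2"])
        show "weakly_holomorphic (\<lambda>_. 0 :: ell2)" unfolding weakly_holomorphic_def by simp
        show "ae_circle (\<lambda>\<xi>. \<exists>l k'. has_nt_limit (\<lambda>z. F z u + G z k) \<xi> l \<and> has_nt_limit (\<lambda>_. 0 :: ell2) \<xi> k'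
          \<and> (norm l)\<^sup>2 + (norm k')\<^sup>2 \<le> (norm u)\<^sup>2 + (norm k)\<^sup>2)"
        proof (rule ae_circle_mono[OF ae_circle_conj[OF ae_circle_conj[OF F(2) G(2)] L]])
          fix \<xi> assume a: "(strong_limits U F \<xi> \<and> strong_limits K G \<xi>)
            \<and> op_le V (cogram K G \<xi>) (\<lambda>y. y - cogram U F \<xi> y)"
          then have "(norm (bdry F \<xi> u + bdry G \<xi> k))\<^sup>2 \<le> (norm u)\<^sup>2 + (norm k)\<^sup>2"
            using circ[of \<xi>] u k by simp
          moreover have "has_nt_limit (\<lambda>z. F z u + G z k) \<xi> (bdry F \<xi> u + bdry G \<xi> k)"
            using bdry_nt_limit[of U F \<xi> u] bdry_nt_limit[of K G \<xi> k] a u k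
            unfolding has_nt_limit_def by (auto intro!: tendsto_add)
          moreover have "has_nt_limit (\<lambda>_. 0 :: ell2) \<xi> 0" unfolding has_nt_limit_def by simp
          ultimately show "\<exists>l k'. has_nt_limit (\<lambda>z. F z u + G z k) \<xi> l \<and> has_nt_limit (\<lambda>_. 0 :: ell2) \<xi> k'
            \<and> (norm l)\<^sup>2 + (norm k')\<^sup>2 \<le> (norm u)\<^sup>2 + (norm k)\<^sup>2"
            by (intro exI[of _ "bdry F \<xi> u + bdry G \<xi> k"] exI[of _ "0 :: ell2"]) simp
        qed
      qed (use z in simp_all)
      then show "(norm (F z u + G z k))\<^sup>2 \<le> (norm u)\<^sup>2 + (norm k)\<^sup>2" by simp
    qed
  next
    assume R: "\<forall>z\<in>unit_disk. \<forall>u\<in>U. \<forall>k\<in>K. (norm (F z u + G z k))\<^sup>2 \<le> (norm u)\<^sup>2 + (norm k)\<^sup>2"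
    show ?L
    proof (rule ae_circle_mono[OF ae_circle_conj[OF F(2) G(2)]])
      fix \<xi> assume a: "strong_limits U F \<xi> \<and> strong_limits K G \<xi>"
      have "(norm (bdry F \<xi> u + bdry G \<xi> k))\<^sup>2 \<le> (norm u)\<^sup>2 + (norm k)\<^sup>2" if uk: "u \<in> U" "k \<in> K" for u k
      proof (rule LIMSEQ_le_const2)
        show "(\<lambda>n. (norm (F (radial_seq \<xi> n) u + G (radial_seq \<xi> n) k))\<^sup>2)
            \<longlonglongrightarrow> (norm (bdry F \<xi> u + bdry G \<xi> k))\<^sup>2"
          using a uk by (intro tendsto_intros bdry_radial[of U F] bdry_radial[of K G]) auto
        have "radial_seq \<xi> n \<in> unit_disk" for n
        using a strong_limitsD[of U F \<xi>] radial_seq_disk[of \<xi> n] by simp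
        then show "\<exists>N. \<forall>n\<ge>N. (norm (F (radial_seq \<xi> n) u + G (radial_seq \<xi> n) k))\<^sup>2 \<le> (norm u)\<^sup>2 + (norm k)\<^sup>2"
          using R uk by blast
      qed
      then show "op_le V (cogram K G \<xi>) (\<lambda>y. y - cogram U F \<xi> y)" using circ[of \<xi>] a by simp
    qed
  qed
qed

lemma holomorphic_cnj_cnj:
  assumes "f holomorphic_on unit_disk"
  shows "(\<lambda>z. cnj (f (cnj z))) holomorphic_on unit_disk"
proof -
  have "cnj ` unit_disk = unit_disk"
  proof (intro equalityI subsetI)
    fix z assume "z \<in> unit_disk"
    then show "z \<in> cnj ` unit_disk" by (intro image_eqI[of _ _ "cnj z"]) auto
  qed auto
  then have "cnj \<circ> f \<circ> cnj holomorphic_on unit_disk"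
    using assms by (intro holomorphic_on_compose_cnj_cnj) auto
  then show ?thesis by (simp add: o_def)
qed

lemma has_nt_limit_zero:
  assumes "\<And>z. z \<in> unit_disk \<Longrightarrow> f z = 0"
  shows "has_nt_limit f \<xi> 0"
  unfolding has_nt_limit_def
proof (intro allI impI)
  fix a :: real
  have ev: "\<forall>\<^sub>F z in at \<xi> within stolz_region a \<xi>. 0 = f z"
    unfolding eventually_at_filter
    by (intro always_eventually allI impI) (use assms stolz_region_disk in metis)
  show "(f \<longlongrightarrow> 0) (at \<xi> within stolz_region a \<xi>)"
    by (rule Lim_transform_eventually[OF tendsto_const ev])
qed

lemma bdry_zero:
  assumes "strong_limits U \<phi> \<xi>" "x \<in> U" "\<And>z. z \<in> unit_disk \<Longrightarrow> \<phi> z x = 0"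
  shows "bdry \<phi> \<xi> x = 0"
proof (rule has_nt_limit_unique[OF strong_limitsD[OF assms(1)] bdry_nt_limit[OF assms(1,2)]])
  show "has_nt_limit (\<lambda>z. \<phi> z x) \<xi> 0" by (rule has_nt_limit_zero) (rule assms(3))
qed

lemma zero_of_boundary_zero:
  fixes f :: "complex \<Rightarrow> 'a::complex_hilbert"
  assumes f: "weakly_holomorphic f" "\<And>z. z \<in> unit_disk \<Longrightarrow> norm (f z) \<le> B"
    and ae: "ae_circle (\<lambda>\<xi>. has_nt_limit f \<xi> 0)" and z: "z \<in> unit_disk"
  shows "f z = 0"
proof -
  have "ae_circle (\<lambda>\<xi>. \<exists>l k. has_nt_limit f \<xi> l \<and> has_nt_limit f \<xi> k \<and> (norm l)\<^sup>2 + (norm k)\<^sup>2 \<le> 0)"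
    by (rule ae_circle_mono[OF ae]) (intro exI[of _ 0], simp)
  from boundary_to_disk[OF f f this z] have "(norm (f z))\<^sup>2 + (norm (f z))\<^sup>2 \<le> 0" by simp
  moreover have "0 \<le> (norm (f z))\<^sup>2" by simp
  ultimately have "(norm (f z))\<^sup>2 = 0" by linarith
  then show ?thesis by simp
qed

subsection \<open>Right defect functions\<close>

text \<open>First basis vector; it embeds the scalars isometrically in \<open>ell2\<close>, from
  which the maximality conditions draw their competitors.\<close>

lift_definition ell2_unit :: ell2 is "\<lambda>n. if n = 0 then 1 else 0"
  by (rule summable_finite[of "{0}"]) auto

lemma norm_ell2_unit: "norm ell2_unit = 1"
proof -
  have "(norm ell2_unit)\<^sup>2 = (\<Sum>n\<in>{0}. (cmod (Rep_ell2 ell2_unit n))\<^sup>2)"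
    unfolding ell2_norm_sq by (rule suminf_finite) (auto simp: ell2_unit.rep_eq)
  also have "\<dots> = 1" by (simp add: ell2_unit.rep_eq)
  finally show ?thesis by (metis norm_ge_zero one_power2 power2_eq_imp_eq zero_le_one)
qed

text \<open>A row \<open>p\<close> becomes the competitor \<open>p\<close> times
  \<open>ell2_unit\<close>, and maximality of \<open>\<phi> = 0\<close> forces its boundary values
  to vanish, hence \<open>p\<close> itself. Conversely a nonzero value of \<open>\<phi>\<close>,
  normalized to \<open>k\<close>, gives the row that pairs \<open>\<phi>\<close> with
  \<open>k\<close>.\<close>

lemma right_defect_zero_iff:
  fixes F :: "complex \<Rightarrow> 'a::complex_hilbert \<Rightarrow> 'b::complex_hilbert"
  assumes U: "closed_csubspace U" "separable_set U" and V: "closed_csubspace V"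
    and F: "F \<in> schur_class U V" and D: "right_defect_function U F K \<phi>"
  shows "(\<forall>z\<in>unit_disk. \<forall>x\<in>U. \<phi> z x = 0) \<longleftrightarrow> \<not> has_row U (\<lambda>z x. (norm (F z x))\<^sup>2)"
proof -
  have K: "closed_csubspace K" and \<phi>: "\<phi> \<in> schur_class U K"
    and le: "ae_circle (\<lambda>\<xi>. op_le U (gram U \<phi> \<xi>) (\<lambda>x. x - gram U F \<xi> x))"
    using D unfolding right_defect_function_def by blast+
  have maxi: "ae_circle (\<lambda>\<xi>. op_le U (gram U \<phi>' \<xi>) (gram U \<phi> \<xi>))"
    if "closed_csubspace K'" "\<phi>' \<in> schur_class U K'"
      "ae_circle (\<lambda>\<xi>. op_le U (gram U \<phi>' \<xi>) (\<lambda>x. x - gram U F \<xi> x))" for K' :: "ell2 set" and \<phi>'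
    using conjunct2[OF conjunct2[OF conjunct2[OF conjunct2[OF D[unfolded right_defect_function_def]]]],
        rule_format, of K' \<phi>'] that by blast
  note sF = fatou_operator[OF U F] and s\<phi> = fatou_operator[OF U \<phi>]
  have disk: "\<forall>z\<in>unit_disk. \<forall>x\<in>U. (norm (F z x))\<^sup>2 + (norm (\<phi> z x))\<^sup>2 \<le> (norm x)\<^sup>2"
    using gram_disk_iff[OF U(1) V K F sF \<phi> s\<phi>] le by simp
  show ?thesis
  proof (intro iffI notI)
    assume zero: "\<forall>z\<in>unit_disk. \<forall>x\<in>U. \<phi> z x = 0" and "has_row U (\<lambda>z x. (norm (F z x))\<^sup>2)"
    then obtain p z0 x0 where p: "row_function U (\<lambda>z x. (norm (F z x))\<^sup>2) p"
      and nz: "z0 \<in> unit_disk" "x0 \<in> U" "p z0 x0 \<noteq> 0" unfolding has_row_def by blast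
    define \<phi>' where "\<phi>' z x = p z x *\<^sub>C ell2_unit" for z x
    have n\<phi>': "norm (\<phi>' z x) = cmod (p z x)" for z x
      unfolding \<phi>'_def norm_scaleC norm_ell2_unit by simp
    have pc: "cmod (p z x) \<le> norm x" if "z \<in> unit_disk" "x \<in> U" for z x
      by (rule row_function_contraction[OF p that]) simp
    have \<phi>': "\<phi>' \<in> schur_class U UNIV"
    proof (rule schur_classI[OF U(1)])
      show "\<phi>' z \<in> bounded_ops U UNIV" if z: "z \<in> unit_disk" for z
        by (rule bounded_opsI[where K = 1])
          (use pc[OF z] n\<phi>' in \<open>simp_all add: \<phi>'_def row_function_add[OF p z] row_function_scale[OF p z]
            scaleC_add_left scaleC_scaleC\<close>)
      show "norm (\<phi>' z x) \<le> norm x" if "z \<in> unit_disk" "x \<in> U" for z x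
        unfolding n\<phi>' by (rule pc[OF that])
      show "weakly_holomorphic (\<lambda>z. \<phi>' z x)" if "x \<in> U" for x
        unfolding weakly_holomorphic_def \<phi>'_def cinner_scaleC_left
        by (intro allI holomorphic_intros row_function_holomorphic[OF p that])
    qed simp
    note s\<phi>' = fatou_operator[OF U \<phi>']
    have "\<forall>z\<in>unit_disk. \<forall>x\<in>U. (norm (F z x))\<^sup>2 + (norm (\<phi>' z x))\<^sup>2 \<le> (norm x)\<^sup>2"
    proof (intro ballI)
      fix z x assume "z \<in> unit_disk" "x \<in> U"
      from row_function_bound[OF p this] show "(norm (F z x))\<^sup>2 + (norm (\<phi>' z x))\<^sup>2 \<le> (norm x)\<^sup>2"
        unfolding n\<phi>' by simp
    qed
    then have "ae_circle (\<lambda>\<xi>. op_le U (gram U \<phi>' \<xi>) (\<lambda>x. x - gram U F \<xi> x))"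
      using gram_disk_iff[OF U(1) V closed_csubspace_UNIV F sF \<phi>' s\<phi>'] by simp
    from maxi[OF closed_csubspace_UNIV \<phi>' this]
    have ae: "ae_circle (\<lambda>\<xi>. op_le U (gram U \<phi>' \<xi>) (gram U \<phi> \<xi>))" .
    have "\<phi>' z0 x0 = 0"
    proof (rule zero_of_boundary_zero[OF schur_class_weakly[OF U(1) \<phi>' nz(2)] schur_class_norm[OF U(1) \<phi>' _ nz(2)] _ nz(1)])
      show "ae_circle (\<lambda>\<xi>. has_nt_limit (\<lambda>z. \<phi>' z x0) \<xi> 0)"
      proof (rule ae_circle_mono[OF ae_circle_conj[OF ae_circle_conj[OF s\<phi> s\<phi>'] ae]])
        fix \<xi> assume a: "(strong_limits U \<phi> \<xi> \<and> strong_limits U \<phi>' \<xi>) \<and> op_le U (gram U \<phi>' \<xi>) (gram U \<phi> \<xi>)"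
        then have s: "strong_limits U \<phi> \<xi>" "strong_limits U \<phi>' \<xi>" by simp_all
        have "bdry \<phi> \<xi> x0 = 0" by (rule bdry_zero[OF s(1) nz(2)]) (use zero nz(2) in blast)
        then have "cinner (gram U \<phi> \<xi> x0 - gram U \<phi>' \<xi> x0) x0 = complex_of_real (- (norm (bdry \<phi>' \<xi> x0))\<^sup>2)"
          by (simp add: cinner_diff_left cinner_gram[OF U(1) K \<phi> s(1) nz(2)]
              cinner_gram[OF U(1) closed_csubspace_UNIV \<phi>' s(2) nz(2)])
        moreover have "cinner (gram U \<phi> \<xi> x0 - gram U \<phi>' \<xi> x0) x0 \<in> \<real>\<^sub>\<ge>\<^sub>0"
          using a nz(2) unfolding op_le_def by blast
        ultimately have "0 \<le> - (norm (bdry \<phi>' \<xi> x0))\<^sup>2" by (simp only: nonneg_Reals_of_real_iff)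
        then have "bdry \<phi>' \<xi> x0 = 0" by simp
        then show "has_nt_limit (\<lambda>z. \<phi>' z x0) \<xi> 0" using bdry_nt_limit[OF s(2) nz(2)] by simp
      qed
    qed simp_all
    then show False using nz(3) n\<phi>'[of z0 x0] by simp
  next
    assume no: "\<not> has_row U (\<lambda>z x. (norm (F z x))\<^sup>2)"
    show "\<forall>z\<in>unit_disk. \<forall>x\<in>U. \<phi> z x = 0"
    proof (rule ccontr)
      assume "\<not> ?thesis"
      then obtain z0 x0 where nz: "z0 \<in> unit_disk" "x0 \<in> U" "\<phi> z0 x0 \<noteq> 0" by blast
      define k where "k = complex_of_real (inverse (norm (\<phi> z0 x0))) *\<^sub>C \<phi> z0 x0"
      have k1: "norm k = 1" unfolding k_def norm_scaleC norm_of_real using nz by simp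
      have "row_function U (\<lambda>z x. (norm (F z x))\<^sup>2) (\<lambda>z x. cinner (\<phi> z x) k)"
        unfolding row_function_def
      proof (intro conjI ballI allI)
        fix z x assume z: "z \<in> unit_disk" and x: "x \<in> U"
        note b = schur_class_bounded[OF U(1) \<phi> z]
        show "cinner (\<phi> z (x + y)) k = cinner (\<phi> z x) k + cinner (\<phi> z y) k" if "y \<in> U" for y
          by (simp add: bounded_ops_add[OF b x that] cinner_add_left)
        show "cinner (\<phi> z (c *\<^sub>C x)) k = c * cinner (\<phi> z x) k" for c
          by (simp add: bounded_ops_scaleC[OF b x] cinner_scaleC_left)
        have "(cmod (cinner (\<phi> z x) k))\<^sup>2 \<le> (norm (\<phi> z x))\<^sup>2"
          using cinner_cauchy_schwarz[of "\<phi> z x" k] k1 by (intro power_mono) auto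
        moreover have "(norm (F z x))\<^sup>2 + (norm (\<phi> z x))\<^sup>2 \<le> (norm x)\<^sup>2" using disk z x by blast
        ultimately show "(cmod (cinner (\<phi> z x) k))\<^sup>2 + (norm (F z x))\<^sup>2 \<le> (norm x)\<^sup>2" by linarith
      next
        fix x assume "x \<in> U"
        show "(\<lambda>z. cinner (\<phi> z x) k) holomorphic_on unit_disk"
          by (rule weakly_holomorphicD[OF schur_class_weakly[OF U(1) \<phi> \<open>x \<in> U\<close>]])
      qed
      moreover have "cinner (\<phi> z0 x0) k \<noteq> 0"
        unfolding k_def cinner_scaleC_right cinner_self using nz(3) by simp
      ultimately show False using no nz(1,2) unfolding has_row_def by blast
    qed
  qed
qed

subsection \<open>Left defect functions\<close>

text \<open>The supremum in \<open>hardy2_norm\<close> includes the radius 0, whose circle mean is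
  the squared norm of \<open>h 0\<close>; boundedness lets the supremum dominate it.\<close>

lemma hardy2_norm_at_zero:
  assumes "bdd_above (circle_mean h ` {0..<1})"
  shows "norm (h 0) \<le> hardy2_norm h"
proof -
  have "circle_mean h 0 = (norm (h 0))\<^sup>2" unfolding circle_mean_def by simp
  moreover have "circle_mean h 0 \<le> (SUP r\<in>{0..<1}. circle_mean h r)"
    by (rule cSUP_upper[OF _ assms]) simp
  ultimately show ?thesis unfolding hardy2_norm_def using real_le_rsqrt by auto
qed

text \<open>Constants in \<open>K\<close> are approximated by \<open>z \<mapsto> G(cnj z)\<^sup>* f(z)\<close>; at the origin this shows that
  \<open>G(0)\<^sup>*\<close> has dense range.\<close>

lemma co_outer_separable:
  assumes K: "closed_csubspace K" and V: "closed_csubspace V" "separable_set V"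
    and G: "G \<in> schur_class K V" and co: "co_outer K V G"
  shows "separable_set K"
proof -
  obtain Q where Q: "countable Q" "Q \<subseteq> V" "V \<subseteq> closure Q" using V(2) unfolding separable_set_def by blast
  have adj1: "norm (adj K (G z) y) \<le> norm y" if "z \<in> unit_disk" for z y
    using norm_adj_le[OF K schur_class_bounded[OF K G that], of 1 y] schur_class_norm[OF K G that] by simp
  have z0: "(0::complex) \<in> unit_disk" by simp
  have adjb: "adj K (G 0) \<in> bounded_ops V K" by (rule adj_bounded_ops[OF K schur_class_bounded[OF K G z0]])
  have approx: "\<exists>q\<in>adj K (G 0) ` Q. dist q k < e" if k: "k \<in> K" and e: "0 < e" for k e
  proof -
    have "(\<lambda>_. k) \<in> hardy2 K" unfolding hardy2_def
    proof (intro CollectI conjI ballI)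
      have "(\<lambda>h. h *\<^sub>C (0 :: 'a)) = (\<lambda>h. 0)" by simp
      then have "((\<lambda>_. k) has_derivative (\<lambda>h. h *\<^sub>C 0)) (at z)" for z by simp
      then show "\<exists>f'. ((\<lambda>_. k) has_derivative (\<lambda>h. h *\<^sub>C f')) (at z)" for z by blast
      show "bdd_above (circle_mean (\<lambda>_. k) ` {0..<1})"
        by (rule bdd_aboveI2[of _ _ "(norm k)\<^sup>2"]) (simp add: circle_mean_def)
    qed (rule k)
    from bspec[OF co[unfolded co_outer_def outer_def] this, rule_format, OF half_gt_zero[OF e]]
    obtain f where f: "f \<in> hardy2 V" and close: "hardy2_norm (\<lambda>z. k - adj K (G (cnj z)) (f z)) < e/2"
      by (rule bexE)
    have f1: "\<forall>z\<in>unit_disk. f z \<in> V" and f2: "\<forall>z\<in>unit_disk. \<exists>f'. (f has_derivative (\<lambda>h. h *\<^sub>C f')) (at z)"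
      and f3: "bdd_above (circle_mean f ` {0..<1})"
      using f unfolding hardy2_def by simp_all
    define h where "h z = k - adj K (G (cnj z)) (f z)" for z
    have fV: "f z \<in> V" if "z \<in> unit_disk" for z by (rule bspec[OF f1 that])
    have fc: "continuous_on unit_disk f"
    proof (intro continuous_at_imp_continuous_on ballI)
      fix z assume "z \<in> unit_disk"
      from bspec[OF f2 this] obtain f' where "(f has_derivative (\<lambda>h. h *\<^sub>C f')) (at z)" by (rule exE)
      then show "isCont f z" by (rule has_derivative_continuous)
    qed
    from f3 obtain M where "\<forall>m\<in>circle_mean f ` {0..<1}. m \<le> M" unfolding bdd_above_def by (rule exE)
    note M = bspec[OF this imageI]
    have M0: "0 \<le> M" using M[of 0] unfolding circle_mean_def by (simp add: order_trans[OF zero_le_power2])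
    \<comment> \<open>Boundedness of these means is what turns \<open>hardy2_norm h < e/2\<close>
      into a bound for \<open>norm (h 0)\<close>.\<close>
    have "circle_mean h r \<le> 2 * (norm k)\<^sup>2 + 2 * M" if r: "r \<in> {0..<1}" for r
    proof -
      let ?w = "\<lambda>t. complex_of_real r * cis t"
      have w: "?w t \<in> unit_disk" for t using r by (simp add: norm_mult)
      have w': "cnj (?w t) \<in> unit_disk" for t using r by (simp add: norm_mult)
      have fi: "(\<lambda>t. (norm (f (?w t)))\<^sup>2) integrable_on {0..2*pi}"
        by (intro integrable_continuous_interval continuous_intros continuous_on_compose2[OF fc]) (use w in auto)
      have ub: "(norm (h (?w t)))\<^sup>2 \<le> 2 * (norm k)\<^sup>2 + 2 * (norm (f (?w t)))\<^sup>2" for t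
      proof -
        have "norm (h (?w t)) \<le> norm k + norm (f (?w t))"
          unfolding h_def using norm_triangle_ineq4[of k "adj K (G (cnj (?w t))) (f (?w t))"] adj1[OF w', of t "f (?w t)"] by linarith
        then have "(norm (h (?w t)))\<^sup>2 \<le> (norm k + norm (f (?w t)))\<^sup>2" by (intro power_mono) auto
        also have "\<dots> \<le> 2 * (norm k)\<^sup>2 + 2 * (norm (f (?w t)))\<^sup>2"
          using sum_squares_bound[of "norm k" "norm (f (?w t))"] by (simp add: power2_sum)
        finally show ?thesis .
      qed
      have "integral {0..2*pi} (\<lambda>t. (norm (h (?w t)))\<^sup>2) \<le> 2 * pi * (2 * (norm k)\<^sup>2 + 2 * M)"
      proof (cases "(\<lambda>t. (norm (h (?w t)))\<^sup>2) integrable_on {0..2*pi}")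
        case True
        have "integral {0..2*pi} (\<lambda>t. (norm (h (?w t)))\<^sup>2)
            \<le> integral {0..2*pi} (\<lambda>t. 2 * (norm k)\<^sup>2 + 2 * (norm (f (?w t)))\<^sup>2)"
          by (rule integral_le[OF True]) (intro integrable_add integrable_const_ivl integrable_on_mult_right fi, rule ub)
        also have "\<dots> = integral {0..2*pi} (\<lambda>t. 2 * (norm k)\<^sup>2) + integral {0..2*pi} (\<lambda>t. 2 * (norm (f (?w t)))\<^sup>2)"
          by (intro Henstock_Kurzweil_Integration.integral_add integrable_const_ivl integrable_on_mult_right fi)
        also have "\<dots> = 2 * pi * (2 * (norm k)\<^sup>2 + 2 * circle_mean f r)"
          unfolding circle_mean_def by (simp add: algebra_simps)
        also have "\<dots> \<le> 2 * pi * (2 * (norm k)\<^sup>2 + 2 * M)" using M[OF r] by simp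
        finally show ?thesis .
      next
        \<comment> \<open>\<open>integral\<close> is 0 on functions that are not integrable, so the
          bound reduces to \<open>0 \<le> M\<close>.\<close>
        case False
        then show ?thesis using M0 by (simp add: not_integrable_integral)
      qed
      then show ?thesis unfolding circle_mean_def by (simp add: divide_le_eq mult.commute)
    qed
    then have "bdd_above (circle_mean h ` {0..<1})" by (rule bdd_aboveI2)
    from hardy2_norm_at_zero[OF this] close have hk: "norm (k - adj K (G 0) (f 0)) < e/2"
      unfolding h_def by simp
    from subsetD[OF Q(3) fV[OF z0]] half_gt_zero[OF e] obtain q where q: "q \<in> Q" "dist q (f 0) < e/2"
      unfolding closure_approachable by blast
    have "norm (adj K (G 0) (q - f 0)) \<le> norm (q - f 0)" by (rule adj1[OF z0])
    then have "norm (adj K (G 0) q - adj K (G 0) (f 0)) < e/2"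
      using bounded_ops_diff[OF V(1) adjb, of q "f 0"] q Q(2) fV[OF z0] by (auto simp: dist_norm)
    then have "dist (adj K (G 0) q) k < e"
      using hk norm_triangle_ineq4[of "adj K (G 0) q - adj K (G 0) (f 0)" "k - adj K (G 0) (f 0)"]
      by (simp add: dist_norm)
    then show ?thesis using q(1) by blast
  qed
  have "K \<subseteq> closure (adj K (G 0) ` Q)"
    unfolding closure_approachable subset_iff mem_Collect_eq by (intro allI impI approx)
  moreover have "adj K (G 0) ` Q \<subseteq> K"
    by (rule image_subsetI) (rule adj_mem[OF K schur_class_bounded[OF K G z0]])
  ultimately show ?thesis
    unfolding separable_set_def by (intro exI[of _ "adj K (G 0) ` Q"] conjI countable_image[OF Q(1)])
qed

text \<open>Rows on \<open>V\<close> are governed by adjoints, so \<open>cnj z\<close> appears to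
  restore holomorphy. By Riesz a row is the pairing with a vector \<open>v\<close>, and
  \<open>v\<close>, taken as a column, is the competitor of \<open>\<psi>\<close>.\<close>

lemma left_defect_zero_iff:
  fixes F :: "complex \<Rightarrow> 'a::complex_hilbert \<Rightarrow> 'b::complex_hilbert"
  assumes U: "closed_csubspace U" "separable_set U" and V: "closed_csubspace V" "separable_set V"
    and F: "F \<in> schur_class U V" and D: "left_defect_function U V F K \<psi>"
  shows "(\<forall>z\<in>unit_disk. \<forall>k\<in>K. \<psi> z k = 0) \<longleftrightarrow> \<not> has_row V (\<lambda>z y. (norm (adj U (F (cnj z)) y))\<^sup>2)"
proof -
  have K: "closed_csubspace K" and \<psi>: "\<psi> \<in> schur_class K V" and co: "co_outer K V \<psi>"
    and le: "ae_circle (\<lambda>\<xi>. op_le V (cogram K \<psi> \<xi>) (\<lambda>y. y - cogram U F \<xi> y))"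
    using D unfolding left_defect_function_def by blast+
  have maxi: "ae_circle (\<lambda>\<xi>. op_le V (cogram K' \<psi>' \<xi>) (cogram K \<psi> \<xi>))"
    if "closed_csubspace K'" "\<psi>' \<in> schur_class K' V"
      "ae_circle (\<lambda>\<xi>. op_le V (cogram K' \<psi>' \<xi>) (\<lambda>y. y - cogram U F \<xi> y))" for K' :: "ell2 set" and \<psi>'
    using conjunct2[OF conjunct2[OF conjunct2[OF conjunct2[OF D[unfolded left_defect_function_def]]]],
        rule_format, of K' \<psi>'] that by blast
  \<comment> \<open>\<open>K\<close> lies in an arbitrary type; \<open>co_outer_separable\<close>
    supplies the countable dense subset on which the boundary values of \<open>\<psi>\<close> are
    built.\<close>
  note sF = fatou_operator[OF U F]
    and s\<psi> = fatou_operator[OF K co_outer_separable[OF K V \<psi> co] \<psi>]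
  have cnjd: "cnj z \<in> unit_disk" if "z \<in> unit_disk" for z using that by simp
  have disk: "(norm (adj U (F z) y))\<^sup>2 + (norm (adj K (\<psi> z) y))\<^sup>2 \<le> (norm y)\<^sup>2"
    if "z \<in> unit_disk" "y \<in> V" for z y
    using cogram_disk_iff[OF U(1) V(1) K F sF \<psi> s\<psi>] le that by simp
  show ?thesis
  proof (intro iffI notI)
    assume zero: "\<forall>z\<in>unit_disk. \<forall>k\<in>K. \<psi> z k = 0"
      and "has_row V (\<lambda>z y. (norm (adj U (F (cnj z)) y))\<^sup>2)"
    then obtain p z0 y0 where p: "row_function V (\<lambda>z y. (norm (adj U (F (cnj z)) y))\<^sup>2) p"
      and nz: "z0 \<in> unit_disk" "y0 \<in> V" "p z0 y0 \<noteq> 0" unfolding has_row_def by blast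
    have "\<forall>z\<in>unit_disk. \<exists>v. v \<in> V \<and> (\<forall>y\<in>V. p (cnj z) y = cinner y v)"
    proof
      fix z :: complex assume z: "z \<in> unit_disk"
      obtain v where "v \<in> closure ((\<lambda>y. y) ` V)" "\<And>y. y \<in> V \<Longrightarrow> p (cnj z) y = cinner y v"
      proof (rule functional_factorization[of V "\<lambda>y. y" "p (cnj z)" 1])
        show "cmod (p (cnj z) y) \<le> 1 * norm y" if "y \<in> V" for y
          using row_function_contraction[OF p cnjd[OF z] that] by simp
      qed (use V(1) row_function_add[OF p cnjd[OF z]] row_function_scale[OF p cnjd[OF z]] in
          \<open>simp_all add: csubspaceD\<close>)
      then show "\<exists>v. v \<in> V \<and> (\<forall>y\<in>V. p (cnj z) y = cinner y v)"
        using csubspace_closed[OF V(1)] by (intro exI[of _ v]) simp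
    qed
    from bchoice[OF this] obtain v where v: "\<forall>z\<in>unit_disk. v z \<in> V \<and> (\<forall>y\<in>V. p (cnj z) y = cinner y (v z))"
      by (rule exE)
    note vV = conjunct1[OF bspec[OF v]] and pv = bspec[OF conjunct2[OF bspec[OF v]]]
    have vb: "(cmod (cinner y (v z)))\<^sup>2 + (norm (adj U (F z) y))\<^sup>2 \<le> (norm y)\<^sup>2"
      if "z \<in> unit_disk" "y \<in> V" for z y
      using row_function_bound[OF p cnjd[OF that(1)] that(2)] pv[OF that] by simp
    have v1: "norm (v z) \<le> 1" if z: "z \<in> unit_disk" for z
    proof -
      have "cmod (p (cnj z) (v z)) \<le> norm (v z)"
        by (rule row_function_contraction[OF p cnjd[OF z] vV[OF z]]) simp
      then have "norm (v z) * norm (v z) \<le> 1 * norm (v z)"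
        unfolding pv[OF z vV[OF z]] cinner_self norm_of_real by (simp add: power2_eq_square)
      then show ?thesis by (cases "norm (v z) = 0") auto
    qed
    have idb: "(\<lambda>x. x) \<in> bounded_ops V UNIV" by (rule bounded_opsI[where K = 1]) auto
    have vhol: "weakly_holomorphic v"
      unfolding weakly_holomorphic_def
    proof
      fix c
      \<comment> \<open>The adjoint of the inclusion is the orthogonal projection onto
        \<open>V\<close>, the only place where \<open>p\<close> is controlled.\<close>
      let ?c = "adj V (\<lambda>x. x) c"
      have cV: "?c \<in> V" by (rule adj_mem[OF V(1) idb])
      have "(\<lambda>z. cnj (p (cnj z) ?c)) holomorphic_on unit_disk"
        by (rule holomorphic_cnj_cnj[OF row_function_holomorphic[OF p cV]])
      moreover have "cnj (p (cnj z) ?c) = cinner (v z) c" if z: "z \<in> unit_disk" for z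
      proof -
        have "cnj (p (cnj z) ?c) = cinner (v z) ?c"
          unfolding pv[OF z cV] by (rule cinner_commute[symmetric])
        also have "\<dots> = cinner (v z) c" by (rule cinner_adj[OF V(1) idb vV[OF z], symmetric])
        finally show ?thesis .
      qed
      ultimately show "(\<lambda>z. cinner (v z) c) holomorphic_on unit_disk"
        by (rule holomorphic_transform)
    qed
    \<comment> \<open>Only coordinate 0 of \<open>e\<close> enters, so the competitor has rank at
      most one and its adjoint at \<open>y\<close> is no larger than the row at
      \<open>y\<close>.\<close>
    define \<psi>' where "\<psi>' z e = Rep_ell2 e 0 *\<^sub>C v z" for z e
    have n\<psi>': "norm (\<psi>' z e) \<le> norm e" if z: "z \<in> unit_disk" for z e
    proof -
      have "norm (\<psi>' z e) \<le> norm e * 1"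
        unfolding \<psi>'_def norm_scaleC by (intro mult_mono ell2_coord_le v1 z) auto
      then show ?thesis by simp
    qed
    have \<psi>': "\<psi>' \<in> schur_class UNIV V"
    proof (rule schur_classI[OF closed_csubspace_UNIV V(1)])
      show "\<psi>' z \<in> bounded_ops UNIV V" if z: "z \<in> unit_disk" for z
      proof (rule bounded_opsI[where K = 1])
        fix e e' c
        show "\<psi>' z e \<in> V" unfolding \<psi>'_def by (rule csubspace_scaleC[OF V(1) vV[OF z]])
        show "\<psi>' z (e + e') = \<psi>' z e + \<psi>' z e'" unfolding \<psi>'_def plus_ell2.rep_eq by (rule scaleC_add_left)
        show "\<psi>' z (c *\<^sub>C e) = c *\<^sub>C \<psi>' z e" unfolding \<psi>'_def scaleC_ell2.rep_eq scaleC_scaleC ..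
        show "norm (\<psi>' z e) \<le> 1 * norm e" using n\<psi>'[OF z] by simp
      qed
      show "norm (\<psi>' z e) \<le> norm e" if "z \<in> unit_disk" for z e by (rule n\<psi>'[OF that])
      show "weakly_holomorphic (\<lambda>z. \<psi>' z e)" for e
        unfolding weakly_holomorphic_def \<psi>'_def cinner_scaleC_left
        by (intro allI holomorphic_intros weakly_holomorphicD[OF vhol])
    qed
    have s\<psi>': "ae_circle (strong_limits UNIV \<psi>')"
    proof (rule ae_circle_mono[OF fatou_nontangential[OF vhol v1]])
      fix \<xi> :: complex assume \<xi>: "cmod \<xi> = 1" and "\<exists>l. has_nt_limit v \<xi> l"
      then obtain l where l: "has_nt_limit v \<xi> l" by blast
      have "has_nt_limit (\<lambda>z. \<psi>' z e) \<xi> (Rep_ell2 e 0 *\<^sub>C l)" for e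
        using l unfolding has_nt_limit_def \<psi>'_def by (auto intro!: tendsto_scaleC)
      then show "strong_limits UNIV \<psi>' \<xi>" unfolding strong_limits_def using \<xi> by blast
    qed
    have "\<forall>z\<in>unit_disk. \<forall>y\<in>V. (norm (adj U (F z) y))\<^sup>2 + (norm (adj UNIV (\<psi>' z) y))\<^sup>2 \<le> (norm y)\<^sup>2"
    proof (intro ballI)
      fix z y assume z: "z \<in> unit_disk" and y: "y \<in> V"
      let ?a = "adj UNIV (\<psi>' z) y"
      have "cinner ?a ?a = cinner (\<psi>' z ?a) y"
        by (rule cinner_adj[OF closed_csubspace_UNIV schur_class_bounded[OF closed_csubspace_UNIV \<psi>' z], symmetric]) simp
      also have "\<dots> = Rep_ell2 ?a 0 * cinner (v z) y" unfolding \<psi>'_def cinner_scaleC_left ..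
      finally have c: "cinner ?a ?a = Rep_ell2 ?a 0 * cinner (v z) y" .
      have "(norm ?a)\<^sup>2 = cmod (cinner ?a ?a)" unfolding cinner_self norm_of_real by simp
      also have "\<dots> = cmod (Rep_ell2 ?a 0) * cmod (cinner (v z) y)" unfolding c norm_mult ..
      also have "\<dots> \<le> norm ?a * cmod (cinner (v z) y)" by (intro mult_right_mono ell2_coord_le) simp
      finally have "norm ?a * norm ?a \<le> cmod (cinner (v z) y) * norm ?a"
        by (simp add: power2_eq_square mult.commute)
      then have "norm ?a \<le> cmod (cinner (v z) y)" by (cases "norm ?a = 0") auto
      also have "cmod (cinner (v z) y) = cmod (cinner y (v z))"
        unfolding cinner_commute[of "v z" y] complex_mod_cnj ..
      finally have "(norm ?a)\<^sup>2 \<le> (cmod (cinner y (v z)))\<^sup>2" by (intro power_mono) auto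
      then show "(norm (adj U (F z) y))\<^sup>2 + (norm ?a)\<^sup>2 \<le> (norm y)\<^sup>2" using vb[OF z y] by linarith
    qed
    then have "ae_circle (\<lambda>\<xi>. op_le V (cogram UNIV \<psi>' \<xi>) (\<lambda>y. y - cogram U F \<xi> y))"
      using cogram_disk_iff[OF U(1) V(1) closed_csubspace_UNIV F sF \<psi>' s\<psi>'] by simp
    from maxi[OF closed_csubspace_UNIV \<psi>' this]
    have ae: "ae_circle (\<lambda>\<xi>. op_le V (cogram UNIV \<psi>' \<xi>) (cogram K \<psi> \<xi>))" .
    have zz: "v z = 0" if z: "z \<in> unit_disk" for z
    proof -
      have "\<psi>' z ell2_unit = 0"
      proof (rule zero_of_boundary_zero[OF schur_class_weakly[OF closed_csubspace_UNIV \<psi>'] n\<psi>' _ z])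
        show "ae_circle (\<lambda>\<xi>. has_nt_limit (\<lambda>z. \<psi>' z ell2_unit) \<xi> 0)"
        proof (rule ae_circle_mono[OF ae_circle_conj[OF ae_circle_conj[OF s\<psi> s\<psi>'] ae]])
          fix \<xi> assume a: "(strong_limits K \<psi> \<xi> \<and> strong_limits UNIV \<psi>' \<xi>)
            \<and> op_le V (cogram UNIV \<psi>' \<xi>) (cogram K \<psi> \<xi>)"
          then have s: "strong_limits K \<psi> \<xi>" "strong_limits UNIV \<psi>' \<xi>" by simp_all
          note b = bdry_bounded_ops[OF K V(1) \<psi> s(1)]
            and b' = bdry_bounded_ops[OF closed_csubspace_UNIV V(1) \<psi>' s(2)]
          \<comment> \<open>The operator inequality is tested at the boundary vector itself: the
            adjoint image of \<open>y\<close> vanishes, so \<open>y\<close> is orthogonal to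
            itself.\<close>
          define y where "y = bdry \<psi>' \<xi> ell2_unit"
          have y: "y \<in> V" unfolding y_def by (rule bounded_ops_mem[OF b']) simp
          have "adj K (bdry \<psi> \<xi>) y = 0"
          proof (rule adj_eqI[OF K b csubspace_zero[OF K]])
            fix u assume u: "u \<in> K"
            have "bdry \<psi> \<xi> u = 0" by (rule bdry_zero[OF s(1) u]) (use zero u in blast)
            then show "cinner (bdry \<psi> \<xi> u) y = cinner u 0" by simp
          qed
          then have "cinner (cogram K \<psi> \<xi> y - cogram UNIV \<psi>' \<xi> y) y
              = complex_of_real (- (norm (adj UNIV (bdry \<psi>' \<xi>) y))\<^sup>2)"
            by (simp add: cinner_diff_left cinner_cogram[OF K V(1) \<psi> s(1)]
                cinner_cogram[OF closed_csubspace_UNIV V(1) \<psi>' s(2)])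
          moreover have "cinner (cogram K \<psi> \<xi> y - cogram UNIV \<psi>' \<xi> y) y \<in> \<real>\<^sub>\<ge>\<^sub>0"
            using a y unfolding op_le_def by blast
          ultimately have "0 \<le> - (norm (adj UNIV (bdry \<psi>' \<xi>) y))\<^sup>2" by (simp only: nonneg_Reals_of_real_iff)
          then have "adj UNIV (bdry \<psi>' \<xi>) y = 0" by simp
          then have "cinner y y = 0"
            using cinner_adj[OF closed_csubspace_UNIV b', of ell2_unit y] unfolding y_def by simp
          then have "bdry \<psi>' \<xi> ell2_unit = 0" unfolding y_def cinner_self by simp
          then show "has_nt_limit (\<lambda>z. \<psi>' z ell2_unit) \<xi> 0"
            using bdry_nt_limit[OF s(2), of ell2_unit] by simp
        qed
      qed simp_all
      then show ?thesis unfolding \<psi>'_def by (simp add: ell2_unit.rep_eq)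
    qed
    have "p z0 y0 = cinner y0 (v (cnj z0))" using pv[OF cnjd[OF nz(1)] nz(2)] by simp
    then show False using nz(3) zz[OF cnjd[OF nz(1)]] by simp
  next
    assume no: "\<not> has_row V (\<lambda>z y. (norm (adj U (F (cnj z)) y))\<^sup>2)"
    show "\<forall>z\<in>unit_disk. \<forall>k\<in>K. \<psi> z k = 0"
    proof (rule ccontr)
      assume "\<not> ?thesis"
      then obtain z0 k0 where nz: "z0 \<in> unit_disk" "k0 \<in> K" "\<psi> z0 k0 \<noteq> 0" by blast
      have k00: "k0 \<noteq> 0" using nz bounded_ops_zero[OF K schur_class_bounded[OF K \<psi> nz(1)]] by auto
      define k where "k = complex_of_real (inverse (norm k0)) *\<^sub>C k0"
      have k1: "norm k = 1" unfolding k_def norm_scaleC norm_of_real using k00 by simp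
      have k: "k \<in> K" unfolding k_def by (rule csubspace_scaleC[OF K nz(2)])
      have "row_function V (\<lambda>z y. (norm (adj U (F (cnj z)) y))\<^sup>2) (\<lambda>z y. cinner y (\<psi> (cnj z) k))"
        unfolding row_function_def
      proof (intro conjI ballI allI)
        fix z y assume z: "z \<in> unit_disk" and y: "y \<in> V"
        show "cinner (y + y') (\<psi> (cnj z) k) = cinner y (\<psi> (cnj z) k) + cinner y' (\<psi> (cnj z) k)" for y'
          by (rule cinner_add_left)
        show "cinner (c *\<^sub>C y) (\<psi> (cnj z) k) = c * cinner y (\<psi> (cnj z) k)" for c
          by (rule cinner_scaleC_left)
        note b = schur_class_bounded[OF K \<psi> cnjd[OF z]]
        have "cmod (cinner y (\<psi> (cnj z) k)) \<le> norm (adj K (\<psi> (cnj z)) y) * norm k"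
          unfolding cinner_adj'[OF K b k] by (rule cinner_cauchy_schwarz)
        then have "(cmod (cinner y (\<psi> (cnj z) k)))\<^sup>2 \<le> (norm (adj K (\<psi> (cnj z)) y))\<^sup>2"
          using k1 by (intro power_mono) auto
        then show "(cmod (cinner y (\<psi> (cnj z) k)))\<^sup>2 + (norm (adj U (F (cnj z)) y))\<^sup>2 \<le> (norm y)\<^sup>2"
          using disk[OF cnjd[OF z] y] by linarith
      next
        fix y assume "y \<in> V"
        have "(\<lambda>z. cnj (cinner (\<psi> (cnj z) k) y)) holomorphic_on unit_disk"
          by (rule holomorphic_cnj_cnj[OF weakly_holomorphicD[OF schur_class_weakly[OF K \<psi> k]]])
        moreover have "cnj (cinner (\<psi> (cnj z) k) y) = cinner y (\<psi> (cnj z) k)" for z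
          by (rule cinner_commute[symmetric])
        ultimately show "(\<lambda>z. cinner y (\<psi> (cnj z) k)) holomorphic_on unit_disk" by (simp only:)
      qed
      \<comment> \<open>The row is nonzero at the point \<open>cnj z0\<close> and the vector
        \<open>\<psi> z0 k0\<close>, where it pairs that vector with a multiple of itself.\<close>
      moreover have "cinner (\<psi> z0 k0) (\<psi> (cnj (cnj z0)) k) \<noteq> 0"
        unfolding k_def complex_cnj_cnj bounded_ops_scaleC[OF schur_class_bounded[OF K \<psi> nz(1)] nz(2)]
          cinner_scaleC_right cinner_self using nz(3) k00 by simp
      moreover have "\<psi> z0 k0 \<in> V" by (rule bounded_ops_mem[OF schur_class_bounded[OF K \<psi> nz(1)] nz(2)])
      ultimately show False using no cnjd[OF nz(1)] unfolding has_row_def by blast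
    qed
  qed
qed

section \<open>Holomorphic inverses and the passage of rows through them\<close>

section \<open>Transfer of rows along a linear fractional transformation\<close>

text \<open>In the application \<open>D\<close> is the defect operator of \<open>\<Theta>(0)\<close> and \<open>S(z) = I + \<Theta>(0)\<^sup>* Z(z)\<close>; then
  \<open>u = S(z)\<inverse> D x\<close> satisfies \<open>\<parallel>x\<parallel>\<^sup>2 - \<parallel>\<Theta>(z) x\<parallel>\<^sup>2 = \<parallel>u\<parallel>\<^sup>2 - \<parallel>Z(z) u\<parallel>\<^sup>2\<close>.\<close>

context
  fixes U :: "'a::complex_hilbert set" and D :: "'a \<Rightarrow> 'a" and S :: "complex \<Rightarrow> 'a \<Rightarrow> 'a"
    and N M :: "complex \<Rightarrow> 'a \<Rightarrow> real" and R :: "complex \<Rightarrow> 'a \<Rightarrow> 'a"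
  assumes U: "closed_csubspace U"
    and D: "D \<in> bounded_ops UNIV U" and dense: "U \<subseteq> closure (range D)"
    and S: "op_holomorphic U U S"
    and low: "\<And>z u. z \<in> unit_disk \<Longrightarrow> u \<in> U \<Longrightarrow> (1 - cmod z) * norm u \<le> norm (S z u)"
    and RU: "\<And>z y. z \<in> unit_disk \<Longrightarrow> y \<in> U \<Longrightarrow> R z y \<in> U"
    and SR: "\<And>z y. z \<in> unit_disk \<Longrightarrow> y \<in> U \<Longrightarrow> S z (R z y) = y"
    and NM: "\<And>z x u. z \<in> unit_disk \<Longrightarrow> u \<in> U \<Longrightarrow> S z u = D x \<Longrightarrow>
      (norm x)\<^sup>2 - N z x = (norm u)\<^sup>2 - M z u"
    and Mcont: "\<And>z. z \<in> unit_disk \<Longrightarrow> continuous_on U (M z)"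
    and M0: "\<And>z u. 0 \<le> M z u"
begin

lemma S_ops: "z \<in> unit_disk \<Longrightarrow> S z \<in> bounded_ops U U"
  using S unfolding op_holomorphic_def by simp

lemma D_mem: "D x \<in> U"
  using bounded_ops_mem[OF D] by simp

lemma S_inj:
  assumes z: "z \<in> unit_disk" and u: "u \<in> U" "v \<in> U" and eq: "S z u = S z v"
  shows "u = v"
proof -
  have "S z (u - v) = 0" using bounded_ops_diff[OF U S_ops[OF z] u] eq by simp
  then have "(1 - cmod z) * norm (u - v) \<le> 0"
    using low[OF z csubspace_diff[OF U u]] by simp
  then have "norm (u - v) \<le> 0" using z by (simp add: mult_le_0_iff)
  then show ?thesis by simp
qed

lemma R_S:
  assumes z: "z \<in> unit_disk" and u: "u \<in> U"
  shows "R z (S z u) = u"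
proof -
  note m = bounded_ops_mem[OF S_ops[OF z] u]
  show ?thesis by (rule S_inj[OF z RU[OF z m] u SR[OF z m]])
qed

lemma R_norm:
  assumes z: "z \<in> unit_disk" and y: "y \<in> U"
  shows "norm (R z y) \<le> 1 / (1 - cmod z) * norm y"
  using low[OF z RU[OF z y]] z unfolding SR[OF z y] by (simp add: field_simps)

lemma R_add:
  assumes z: "z \<in> unit_disk" and xy: "x \<in> U" "y \<in> U"
  shows "R z (x + y) = R z x + R z y"
proof (rule S_inj[OF z RU[OF z csubspace_add[OF U xy]] csubspace_add[OF U RU[OF z xy(1)] RU[OF z xy(2)]]])
  show "S z (R z (x + y)) = S z (R z x + R z y)"
    unfolding bounded_ops_add[OF S_ops[OF z] RU[OF z xy(1)] RU[OF z xy(2)]]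
      SR[OF z xy(1)] SR[OF z xy(2)] by (rule SR[OF z csubspace_add[OF U xy]])
qed

lemma R_scale:
  assumes z: "z \<in> unit_disk" and x: "x \<in> U"
  shows "R z (c *\<^sub>C x) = c *\<^sub>C R z x"
proof (rule S_inj[OF z RU[OF z csubspace_scaleC[OF U x]] csubspace_scaleC[OF U RU[OF z x]]])
  show "S z (R z (c *\<^sub>C x)) = S z (c *\<^sub>C R z x)"
    unfolding bounded_ops_scaleC[OF S_ops[OF z] RU[OF z x]] SR[OF z x]
    by (rule SR[OF z csubspace_scaleC[OF U x]])
qed

lemma R_diff:
  assumes "z \<in> unit_disk" "x \<in> U" "y \<in> U"
  shows "R z (x - y) = R z x - R z y"
  using R_add[OF assms(1,2) csubspace_minus[OF U assms(3)]] R_scale[OF assms(1,3), of "-1"]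
  by (simp add: scaleC_minus_one)

text \<open>Second resolvent identity, with \<open>R\<close> the inverse of \<open>S\<close>;
  continuity and differentiability of the inverse follow from it.\<close>

lemma R_resolvent:
  assumes z: "z \<in> unit_disk" and w: "w \<in> unit_disk" and y: "y \<in> U"
  shows "R w y - R z y = - R w (S w (R z y) - S z (R z y))"
  using R_diff[OF w bounded_ops_mem[OF S_ops[OF w] RU[OF z y]] y] R_S[OF w RU[OF z y]] SR[OF z y] by simp

lemma eventually_disk: "z \<in> unit_disk \<Longrightarrow> \<forall>\<^sub>F w in at z. w \<in> unit_disk"
  by (rule eventually_at_in_open'[OF open_ball])

text \<open>The bound \<open>1 / (1 - cmod w)\<close> on \<open>R w\<close> is locally uniform in
  the disk.\<close>

lemma R_tendsto_zero:
  assumes z: "z \<in> unit_disk" and g: "\<And>w. w \<in> unit_disk \<Longrightarrow> g w \<in> U" and lim: "(g \<longlongrightarrow> 0) (at z)"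
  shows "((\<lambda>w. R w (g w)) \<longlongrightarrow> 0) (at z)"
proof (rule Lim_null_comparison)
  show "\<forall>\<^sub>F w in at z. norm (R w (g w)) \<le> 1 / (1 - cmod w) * norm (g w)"
    by (rule eventually_mono[OF eventually_disk[OF z]]) (rule R_norm[OF _ g])
  have "((\<lambda>w. 1 / (1 - cmod w) * norm (g w)) \<longlongrightarrow> 1 / (1 - cmod z) * norm (0::'a)) (at z)"
    by (intro tendsto_intros lim) (use z in auto)
  then show "((\<lambda>w. 1 / (1 - cmod w) * norm (g w)) \<longlongrightarrow> 0) (at z)" by simp
qed

lemma R_tendsto:
  assumes z: "z \<in> unit_disk" and y: "y \<in> U"
  shows "((\<lambda>w. R w y) \<longlongrightarrow> R z y) (at z)"
proof -
  note r = RU[OF z y]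
  have "isCont (\<lambda>w. S w (R z y)) z"
    by (rule bspec[OF iffD1[OF continuous_on_eq_continuous_at[OF open_ball] op_holomorphic_continuous[OF U S r]] z])
  then have "((\<lambda>w. S w (R z y) - S z (R z y)) \<longlongrightarrow> 0) (at z)"
    unfolding isCont_def by (rule LIM_zero)
  then have "((\<lambda>w. - R w (S w (R z y) - S z (R z y))) \<longlongrightarrow> - 0) (at z)"
    by (intro tendsto_minus R_tendsto_zero[OF z] csubspace_diff[OF U] bounded_ops_mem[OF S_ops _] r z)
  then have "((\<lambda>w. R w y - R z y) \<longlongrightarrow> 0) (at z)"
    unfolding minus_zero
    by (rule Lim_transform_eventually)
      (rule eventually_mono[OF eventually_disk[OF z]], rule R_resolvent[OF z _ y, symmetric])
  then show ?thesis by (rule LIM_zero_cancel)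
qed

text \<open>The derivative is \<open>- R z (A (R z y))\<close> with \<open>A\<close> the derivative
  of \<open>S\<close>, read off the resolvent identity.\<close>

lemma R_cderiv:
  assumes z: "z \<in> unit_disk" and y: "y \<in> U"
  shows "\<exists>d\<in>U. has_cderiv (\<lambda>w. R w y) d z"
proof -
  note r = RU[OF z y]
  obtain A where A: "A \<in> bounded_ops U U" and A': "has_cderiv (\<lambda>w. S w (R z y)) (A (R z y)) z"
    using op_holomorphic_cderiv[OF U S z] r by blast
  let ?b = "A (R z y)"
  have b: "?b \<in> U" by (rule bounded_ops_mem[OF A r])
  let ?Q = "\<lambda>w. inverse (w - z) *\<^sub>C (S w (R z y) - S z (R z y))"
  have Su: "S w (R z y) \<in> U" if "w \<in> unit_disk" for w by (rule bounded_ops_mem[OF S_ops[OF that] r])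
  have QU: "?Q w \<in> U" if "w \<in> unit_disk" for w
    by (intro csubspace_scaleC[OF U] csubspace_diff[OF U] Su that z)
  have "((\<lambda>w. ?Q w - ?b) \<longlongrightarrow> 0) (at z)"
    using A' unfolding has_cderiv_def by (rule LIM_zero)
  then have "((\<lambda>w. R w (?Q w - ?b)) \<longlongrightarrow> 0) (at z)"
    by (intro R_tendsto_zero[OF z] csubspace_diff[OF U] QU b)
  then have "((\<lambda>w. - (R w (?Q w - ?b) + R w ?b)) \<longlongrightarrow> - (0 + R z ?b)) (at z)"
    by (intro tendsto_intros R_tendsto[OF z b])
  then have "((\<lambda>w. inverse (w - z) *\<^sub>C (R w y - R z y)) \<longlongrightarrow> - (0 + R z ?b)) (at z)"
  proof (rule Lim_transform_eventually)
    show "\<forall>\<^sub>F w in at z. - (R w (?Q w - ?b) + R w ?b) = inverse (w - z) *\<^sub>C (R w y - R z y)"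
    proof (rule eventually_mono[OF eventually_disk[OF z]])
      fix w assume w: "w \<in> unit_disk"
      have "R w (?Q w) = inverse (w - z) *\<^sub>C R w (S w (R z y) - S z (R z y))"
        by (rule R_scale[OF w csubspace_diff[OF U Su[OF w] Su[OF z]]])
      then have "inverse (w - z) *\<^sub>C (R w y - R z y) = - R w (?Q w)"
        unfolding R_resolvent[OF z w y] scaleC_minus_right by simp
      then show "- (R w (?Q w - ?b) + R w ?b) = inverse (w - z) *\<^sub>C (R w y - R z y)"
        unfolding R_diff[OF w QU[OF w] b] by simp
    qed
  qed
  then have "has_cderiv (\<lambda>w. R w y) (- R z ?b) z" unfolding has_cderiv_def by simp
  then show ?thesis using csubspace_minus[OF U RU[OF z b]] by blast
qed

text \<open>\<open>S z\<close> maps \<open>U\<close> onto \<open>U\<close> with bounded inverse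
  \<open>R z\<close>, so density of the range of \<open>D\<close> passes to the vectors
  \<open>R z (D x)\<close>.\<close>

lemma range_approx:
  assumes z: "z \<in> unit_disk" and u: "u \<in> U"
  obtains x where "(\<lambda>n. R z (D (x n))) \<longlonglongrightarrow> u"
proof -
  from subsetD[OF dense bounded_ops_mem[OF S_ops[OF z] u]]
  obtain g where g: "\<And>n. g n \<in> range D" "g \<longlonglongrightarrow> S z u" unfolding closure_sequential by blast
  from g(1) have "\<forall>n. \<exists>x. g n = D x" by blast
  from choice[OF this] obtain x where x: "\<And>n. g n = D (x n)" by blast
  have "(\<lambda>n. norm (R z (D (x n)) - u)) \<longlonglongrightarrow> 0"
  proof (rule Lim_null_comparison)
    show "\<forall>\<^sub>F n in sequentially. norm (norm (R z (D (x n)) - u)) \<le> 1 / (1 - cmod z) * norm (g n - S z u)"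
    proof (intro always_eventually allI)
      fix n
      have "R z (D (x n)) - u = R z (D (x n) - S z u)"
        unfolding R_diff[OF z D_mem bounded_ops_mem[OF S_ops[OF z] u]] R_S[OF z u] ..
      then show "norm (norm (R z (D (x n)) - u)) \<le> 1 / (1 - cmod z) * norm (g n - S z u)"
        using R_norm[OF z csubspace_diff[OF U D_mem bounded_ops_mem[OF S_ops[OF z] u]], of "x n"]
        unfolding x real_norm_def abs_norm_cancel by (simp only:)
    qed
    have "(\<lambda>n. 1 / (1 - cmod z) * norm (g n - S z u)) \<longlonglongrightarrow> 1 / (1 - cmod z) * norm (S z u - S z u)"
      by (intro tendsto_mult tendsto_const tendsto_norm tendsto_diff g(2))
    then show "(\<lambda>n. 1 / (1 - cmod z) * norm (g n - S z u)) \<longlonglongrightarrow> 0" by simp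
  qed
  then have "(\<lambda>n. R z (D (x n)) - u) \<longlonglongrightarrow> 0" by (rule tendsto_norm_zero_cancel)
  then have "(\<lambda>n. R z (D (x n))) \<longlonglongrightarrow> u" by (rule LIM_zero_cancel)
  then show ?thesis by (rule that)
qed

text \<open>With \<open>u = R z (D x)\<close>, the identity \<open>NM\<close> turns the row
  inequality for \<open>M\<close> at \<open>u\<close> into the one for \<open>N\<close> at
  \<open>x\<close>.\<close>

lemma has_row_pull:
  assumes "has_row U M"
  shows "has_row UNIV N"
proof -
  obtain q z0 u0 where q: "row_function U M q" and nz: "z0 \<in> unit_disk" "u0 \<in> U" "q z0 u0 \<noteq> 0"
    using assms unfolding has_row_def by blast
  define p where "p z x = q z (R z (D x))" for z x
  have qc: "cmod (q z u) \<le> norm u" if "z \<in> unit_disk" "u \<in> U" for z u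
    by (rule row_function_contraction[OF q that M0])
  have "row_function UNIV N p"
    unfolding row_function_def
  proof (intro conjI ballI allI)
    fix z x assume z: "z \<in> unit_disk"
    note r = RU[OF z D_mem]
    show "p z (x + y) = p z x + p z y" for y
      unfolding p_def bounded_ops_add[OF D UNIV_I UNIV_I] R_add[OF z D_mem D_mem]
      by (rule row_function_add[OF q z r r])
    show "p z (c *\<^sub>C x) = c * p z x" for c
      unfolding p_def bounded_ops_scaleC[OF D UNIV_I] R_scale[OF z D_mem]
      by (rule row_function_scale[OF q z r])
    show "(cmod (p z x))\<^sup>2 + N z x \<le> (norm x)\<^sup>2"
      using row_function_bound[OF q z r, of x] NM[OF z r SR[OF z D_mem], of x] unfolding p_def by linarith
  next
    fix x
    show "(\<lambda>z. p z x) holomorphic_on unit_disk"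
      unfolding p_def
    proof (rule holomorphic_eval[OF U row_function_holomorphic[OF q] row_function_add[OF q]
          row_function_scale[OF q], where C = 1])
      show "cmod (q z u) \<le> 1 / (1 - cmod z) * norm u" if "z \<in> unit_disk" "u \<in> U" for z u
      proof -
        have "1 \<le> 1 / (1 - cmod z)" using that(1) by simp
        then have "1 * norm u \<le> 1 / (1 - cmod z) * norm u" by (rule mult_right_mono) simp
        then show ?thesis using qc[OF that] by simp
      qed
      show "R z (D x) \<in> U" if "z \<in> unit_disk" for z by (rule RU[OF that D_mem])
      show "\<exists>d\<in>U. has_cderiv (\<lambda>z. R z (D x)) d z" if "z \<in> unit_disk" for z by (rule R_cderiv[OF that D_mem])
    qed
  qed
  \<comment> \<open>Density of the vectors \<open>R z0 (D x)\<close> and contractivity of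
    \<open>q z0\<close> keep the pulled back row from vanishing.\<close>
  moreover have "\<exists>x. p z0 x \<noteq> 0"
  proof (rule ccontr)
    assume "\<not> ?thesis"
    then have zero: "q z0 (R z0 (D x)) = 0" for x unfolding p_def by blast
    obtain x where x: "(\<lambda>n. R z0 (D (x n))) \<longlonglongrightarrow> u0" by (rule range_approx[OF nz(1,2)])
    have "q z0 u0 = q z0 (u0 - R z0 (D (x n)))" for n
      using row_function_add[OF q nz(1) csubspace_diff[OF U nz(2) RU[OF nz(1) D_mem]] RU[OF nz(1) D_mem], of "x n" "x n"]
        zero[of "x n"] by simp
    then have "cmod (q z0 u0) \<le> norm (u0 - R z0 (D (x n)))" for n
      using qc[OF nz(1) csubspace_diff[OF U nz(2) RU[OF nz(1) D_mem]], of "x n"] by simp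
    moreover have "(\<lambda>n. norm (u0 - R z0 (D (x n)))) \<longlonglongrightarrow> norm (u0 - u0)"
      by (intro tendsto_norm tendsto_diff tendsto_const x)
    ultimately have "cmod (q z0 u0) \<le> norm (u0 - u0)" by (intro LIMSEQ_le_const) auto
    then show False using nz(3) by simp
  qed
  ultimately show ?thesis unfolding has_row_def using nz(1) by blast
qed

text \<open>The way back without inverting \<open>D\<close>: \<open>NM\<close> and
  \<open>0 \<le> M\<close> bound \<open>p z x\<close> by a multiple of \<open>norm (D x)\<close>, so
  \<open>p z\<close> is \<open>D\<close> followed by pairing with some \<open>w z\<close>. The new
  row is \<open>S z\<close> followed by that pairing.\<close>

lemma has_row_push:
  assumes "has_row UNIV N"
  shows "has_row U M"
proof -
  obtain p z0 x0 where p: "row_function UNIV N p" and nz: "z0 \<in> unit_disk" "p z0 x0 \<noteq> 0"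
    using assms unfolding has_row_def by blast
  have pb: "(cmod (p z x))\<^sup>2 \<le> (norm (R z (D x)))\<^sup>2 - M z (R z (D x))" if z: "z \<in> unit_disk" for z x
    using row_function_bound[OF p z UNIV_I, of x] NM[OF z RU[OF z D_mem] SR[OF z D_mem], of x] by linarith
  have pD: "cmod (p z x) \<le> 1 / (1 - cmod z) * norm (D x)" if z: "z \<in> unit_disk" for z x
  proof -
    have "(cmod (p z x))\<^sup>2 \<le> (norm (R z (D x)))\<^sup>2" using pb[OF z, of x] M0[of z "R z (D x)"] by linarith
    then have "cmod (p z x) \<le> norm (R z (D x))" by (rule power2_le_imp_le) simp
    then show ?thesis using R_norm[OF z D_mem, of x] by linarith
  qed
  have "\<exists>w\<in>U. \<forall>x. p z x = cinner (D x) w" if z: "z \<in> unit_disk" for z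
  proof -
    obtain w where w: "w \<in> closure (D ` UNIV)" "\<And>x. x \<in> UNIV \<Longrightarrow> p z x = cinner (D x) w"
      by (rule functional_factorization[of UNIV D "p z" "1 / (1 - cmod z)"])
        (simp_all only: UNIV_I bounded_ops_add[OF D] bounded_ops_scaleC[OF D] row_function_add[OF p z]
          row_function_scale[OF p z] pD[OF z])
    have "closure (range D) \<subseteq> U"
      by (rule closure_minimal) (use D_mem csubspace_closed[OF U] in auto)
    then show ?thesis using w by auto
  qed
  then obtain w where wU: "\<And>z. z \<in> unit_disk \<Longrightarrow> w z \<in> U"
    and pw: "\<And>z x. z \<in> unit_disk \<Longrightarrow> p z x = cinner (D x) (w z)" by metis
  have wb: "cmod (cinner y (w z)) \<le> 1 / (1 - cmod z) * norm y" if z: "z \<in> unit_disk" and y: "y \<in> U" for z y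
  proof -
    from subsetD[OF dense y] obtain g where g: "\<And>n. g n \<in> range D" "g \<longlonglongrightarrow> y"
      unfolding closure_sequential by blast
    have "cmod (cinner (g n) (w z)) \<le> 1 / (1 - cmod z) * norm (g n)" for n
      using g(1)[of n] pD[OF z] pw[OF z] by auto
    moreover have "(\<lambda>n. cmod (cinner (g n) (w z))) \<longlonglongrightarrow> cmod (cinner y (w z))" by (intro tendsto_intros g)
    moreover have "(\<lambda>n. 1 / (1 - cmod z) * norm (g n)) \<longlonglongrightarrow> 1 / (1 - cmod z) * norm y"
      by (intro tendsto_mult tendsto_const tendsto_norm g)
    ultimately show ?thesis by (intro LIMSEQ_le) auto
  qed
  \<comment> \<open>For \<open>y\<close> in the range of \<open>D\<close> the function is a value of
    \<open>p\<close>; other \<open>y\<close> are limits of such vectors, and \<open>wb\<close> makes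
    the convergence uniform on small disks.\<close>
  have whol: "(\<lambda>z. cinner y (w z)) holomorphic_on unit_disk" if y: "y \<in> U" for y
  proof -
    from subsetD[OF dense y] obtain g where g: "\<And>n. g n \<in> range D" "g \<longlonglongrightarrow> y"
      unfolding closure_sequential by blast
    have gU: "g n \<in> U" for n using g(1)[of n] D_mem by auto
    show ?thesis
    proof (rule holomorphic_uniform_sequence[OF open_ball, where f = "\<lambda>n z. cinner (g n) (w z)"])
      fix n
      obtain x where x: "g n = D x" using g(1)[of n] by blast
      have "(\<lambda>z. p z x) holomorphic_on unit_disk" by (rule row_function_holomorphic[OF p UNIV_I])
      then show "(\<lambda>z. cinner (g n) (w z)) holomorphic_on unit_disk"
        unfolding x by (rule holomorphic_transform) (rule pw)
    next
      fix z :: complex assume z: "z \<in> unit_disk"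
      define d where "d = (1 - cmod z) / 2"
      have d: "0 < d" using z unfolding d_def by simp
      have cd: "d \<le> 1 - cmod v" if "v \<in> cball z d" for v
        using that norm_triangle_ineq[of z "v - z"] unfolding d_def by (simp add: dist_norm norm_minus_commute)
      have sub: "cball z d \<subseteq> unit_disk" using cd d by (force simp: dist_norm)
      have "uniform_limit (cball z d) (\<lambda>n z. cinner (g n) (w z)) (\<lambda>z. cinner y (w z)) sequentially"
      proof (rule uniform_limitI)
        fix e :: real assume e: "0 < e"
        then have "d * e > 0" using d by simp
        from metric_LIMSEQ_D[OF g(2) this] obtain m where m: "\<And>n. n \<ge> m \<Longrightarrow> dist (g n) y < d * e" by blast
        show "\<forall>\<^sub>F n in sequentially. \<forall>v\<in>cball z d. dist (cinner (g n) (w v)) (cinner y (w v)) < e"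
          unfolding eventually_sequentially
        proof (intro exI allI impI ballI)
          fix n v assume n: "n \<ge> m" and v: "v \<in> cball z d"
          have "dist (cinner (g n) (w v)) (cinner y (w v)) = cmod (cinner (g n - y) (w v))"
            by (simp add: dist_norm cinner_diff_left)
          also have "\<dots> \<le> 1 / (1 - cmod v) * norm (g n - y)"
            by (rule wb[OF subsetD[OF sub v] csubspace_diff[OF U gU y]])
          also have "\<dots> \<le> 1 / d * norm (g n - y)"
            using cd[OF v] d by (intro mult_right_mono divide_left_mono mult_pos_pos) auto
          also have "\<dots> < e" using m[OF n] d by (simp add: dist_norm field_simps)
          finally show "dist (cinner (g n) (w v)) (cinner y (w v)) < e" .
        qed
      qed
      then show "\<exists>d>0. cball z d \<subseteq> unit_disk \<and>
          uniform_limit (cball z d) (\<lambda>n z. cinner (g n) (w z)) (\<lambda>z. cinner y (w z)) sequentially"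
        using d sub by blast
    qed
  qed
  define q where "q z u = cinner (S z u) (w z)" for z u
  have "row_function U M q"
    unfolding row_function_def
  proof (intro conjI ballI allI)
    fix z u assume z: "z \<in> unit_disk" and u: "u \<in> U"
    show "q z (u + v) = q z u + q z v" if "v \<in> U" for v
      unfolding q_def bounded_ops_add[OF S_ops[OF z] u that] by (rule cinner_add_left)
    show "q z (c *\<^sub>C u) = c * q z u" for c
      unfolding q_def bounded_ops_scaleC[OF S_ops[OF z] u] by (rule cinner_scaleC_left)
    \<comment> \<open>The inequality is inherited from \<open>p\<close> on the dense set of vectors
      \<open>R z (D x)\<close> and extends to \<open>u\<close> by continuity, which is where
      \<open>Mcont\<close> enters.\<close>
    obtain x where x: "(\<lambda>n. R z (D (x n))) \<longlonglongrightarrow> u" by (rule range_approx[OF z u])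
    have rn: "\<forall>\<^sub>F n in sequentially. R z (D (x n)) \<in> U" using RU[OF z D_mem] by simp
    have Sc: "(\<lambda>n. S z (R z (D (x n)))) \<longlonglongrightarrow> S z u"
      by (rule continuous_on_tendsto_compose[OF bounded_ops_continuous_on[OF U S_ops[OF z]] x u rn])
    have Mc: "(\<lambda>n. M z (R z (D (x n)))) \<longlonglongrightarrow> M z u"
      by (rule continuous_on_tendsto_compose[OF Mcont[OF z] x u rn])
    show "(cmod (q z u))\<^sup>2 + M z u \<le> (norm u)\<^sup>2"
    proof (rule LIMSEQ_le)
      show "(\<lambda>n. (cmod (cinner (S z (R z (D (x n)))) (w z)))\<^sup>2 + M z (R z (D (x n)))) \<longlonglongrightarrow> (cmod (q z u))\<^sup>2 + M z u"
        unfolding q_def by (intro tendsto_intros Sc Mc)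
      show "(\<lambda>n. (norm (R z (D (x n))))\<^sup>2) \<longlonglongrightarrow> (norm u)\<^sup>2" by (intro tendsto_intros x)
      show "\<exists>N. \<forall>n\<ge>N. (cmod (cinner (S z (R z (D (x n)))) (w z)))\<^sup>2 + M z (R z (D (x n))) \<le> (norm (R z (D (x n))))\<^sup>2"
      proof (intro exI allI impI)
        fix n
        show "(cmod (cinner (S z (R z (D (x n)))) (w z)))\<^sup>2 + M z (R z (D (x n))) \<le> (norm (R z (D (x n))))\<^sup>2"
          using pb[OF z, of "x n"] unfolding SR[OF z D_mem] pw[OF z] by linarith
      qed
    qed
  next
    fix u assume u: "u \<in> U"
    show "(\<lambda>z. q z u) holomorphic_on unit_disk"
      unfolding q_def
    proof (rule holomorphic_eval[OF U whol cinner_add_left cinner_scaleC_left wb])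
      show "S z u \<in> U" if "z \<in> unit_disk" for z by (rule bounded_ops_mem[OF S_ops[OF that] u])
      show "\<exists>d\<in>U. has_cderiv (\<lambda>z. S z u) d z" if z: "z \<in> unit_disk" for z
      proof -
        obtain A where "A \<in> bounded_ops U U" "\<And>x. x \<in> U \<Longrightarrow> has_cderiv (\<lambda>w. S w x) (A x) z"
          using op_holomorphic_cderiv[OF U S z] by blast
        then show ?thesis using bounded_ops_mem[of A U U u] u by auto
      qed
    qed
  qed
  moreover have "q z0 (R z0 (D x0)) \<noteq> 0"
    unfolding q_def SR[OF nz(1) D_mem] pw[OF nz(1), symmetric] by (rule nz(2))
  ultimately show ?thesis unfolding has_row_def using nz(1) RU[OF nz(1) D_mem] by blast
qed

end

section \<open>Schwarz bound, defect identity, and the application to \<open>Z\<close> and its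
  adjoint\<close>

section \<open>The Moebius parameter\<close>

text \<open>The solution is the Banach fixed point of \<open>u\<close> to \<open>y - P u\<close> on
  the complete set \<open>U\<close>.\<close>

lemma contraction_perturbation_surj:
  fixes P :: "'a::complex_hilbert \<Rightarrow> 'a"
  assumes U: "closed_csubspace U" and P: "P \<in> bounded_ops U U"
    and c: "0 \<le> c" "c < 1" "\<And>u. u \<in> U \<Longrightarrow> norm (P u) \<le> c * norm u" and y: "y \<in> U"
  shows "\<exists>u\<in>U. u + P u = y"
proof -
  have "\<exists>!u. u \<in> U \<and> y - P u = u"
  proof (rule Banach_fix[OF _ _ c(1,2)])
    show "complete U" using csubspace_closed[OF U] by (simp add: complete_eq_closed)
    show "U \<noteq> {}" using y by blast
    show "(\<lambda>u. y - P u) ` U \<subseteq> U"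
      by (rule image_subsetI) (intro csubspace_diff[OF U y] bounded_ops_mem[OF P])
    fix u v assume uv: "u \<in> U" "v \<in> U"
    have "dist (y - P u) (y - P v) = norm (P (u - v))"
      unfolding bounded_ops_diff[OF U P uv] by (simp add: dist_norm norm_minus_commute)
    also have "\<dots> \<le> c * norm (u - v)" by (rule c(3)[OF csubspace_diff[OF U uv]])
    finally show "dist (y - P u) (y - P v) \<le> c * dist u v" unfolding dist_norm .
  qed
  then obtain u where "u \<in> U" "y - P u = u" by blast
  then show ?thesis by (intro bexI[of _ u]) (simp_all add: algebra_simps)
qed

lemma schwarz_operator:
  assumes U: "closed_csubspace U" and V: "closed_csubspace V" and Z: "Z \<in> schur_class U V"
    and Z0: "\<And>u. u \<in> U \<Longrightarrow> Z 0 u = 0" and z: "z \<in> unit_disk" and u: "u \<in> U"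
  shows "norm (Z z u) \<le> cmod z * norm u"
proof (rule norm_le_of_cinner)
  fix y
  have "cmod (cinner (Z z u) y) \<le> cmod z * (norm u * norm y) + e" if e: "0 < e" for e
  proof -
    \<comment> \<open>The summand \<open>e\<close> keeps \<open>d\<close> positive and makes the
      normalized function map strictly into the unit disk, as the scalar Schwarz lemma asks; it
      tends to 0 at the end.\<close>
    define d where "d = norm u * norm y + e"
    have d: "d > 0" unfolding d_def using e by (simp add: add_nonneg_pos)
    have "cmod (cinner (Z z u) y / d) \<le> cmod z"
    proof (rule Schwarz_Lemma(1))
      show "(\<lambda>z. cinner (Z z u) y / d) holomorphic_on ball 0 1"
        using d by (intro holomorphic_intros weakly_holomorphicD[OF schur_class_weakly[OF U Z u]]) auto
      show "cinner (Z 0 u) y / d = 0" using Z0[OF u] by simp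
      show "cmod z < 1" using z by simp
      fix w :: complex assume "cmod w < 1"
      then have "norm (Z w u) \<le> norm u" using schur_class_norm[OF U Z _ u, of w] by simp
      then have "cmod (cinner (Z w u) y) \<le> norm u * norm y"
        using cinner_cauchy_schwarz[of "Z w u" y] by (meson mult_right_mono norm_ge_zero order_trans)
      then have "cmod (cinner (Z w u) y) < d" unfolding d_def using e by linarith
      then show "cmod (cinner (Z w u) y / d) < 1" using d by (simp add: norm_divide)
    qed
    then have "cmod (cinner (Z z u) y) \<le> cmod z * d" using d by (simp add: norm_divide divide_le_eq)
    also have "\<dots> \<le> cmod z * (norm u * norm y) + e"
      using z e by (simp add: d_def distrib_left mult_left_le_one_le)
    finally show ?thesis .
  qed
  then show "cmod (cinner (Z z u) y) \<le> cmod z * norm u * norm y"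
    unfolding mult.assoc by (rule field_le_epsilon)
qed simp

text \<open>After expanding squares, only the cross term of \<open>T x\<close> with
  \<open>defect_op (adj UNIV T) v\<close> is not elementary; the intertwining relation turns it into
  the pairing of \<open>defect_op T x\<close>, that is \<open>u + adj UNIV T v\<close>, with
  \<open>adj UNIV T v\<close>.\<close>

lemma defect_identity:
  assumes T: "T \<in> bounded_ops UNIV UNIV" "\<And>x. norm (T x) \<le> norm x"
    and eq: "u + adj UNIV T v = defect_op T x"
  shows "(norm x)\<^sup>2 - (norm (T x + defect_op (adj UNIV T) v))\<^sup>2 = (norm u)\<^sup>2 - (norm v)\<^sup>2"
proof -
  note a = contraction_adj[OF T]
  let ?q = "adj UNIV T v"
  have c: "cinner (T x) (defect_op (adj UNIV T) v) = cinner (u + ?q) ?q"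
    unfolding eq defect_op_selfadjoint[OF a(1,2), symmetric] defect_op_intertwine[OF T, symmetric]
    by (rule a(3))
  have 1: "(norm (T x + defect_op (adj UNIV T) v))\<^sup>2
      = (norm (T x))\<^sup>2 + 2 * Re (cinner (u + ?q) ?q) + ((norm v)\<^sup>2 - (norm ?q)\<^sup>2)"
    unfolding norm_plus_sq c defect_op_norm[OF a(1,2)] ..
  have 2: "(norm x)\<^sup>2 - (norm (T x))\<^sup>2 = (norm u)\<^sup>2 + 2 * Re (cinner u ?q) + (norm ?q)\<^sup>2"
    unfolding defect_op_norm[OF T, symmetric] eq[symmetric] norm_plus_sq ..
  have 3: "Re (cinner (u + ?q) ?q) = Re (cinner u ?q) + (norm ?q)\<^sup>2"
    by (simp add: cinner_add_left cinner_self)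
  show ?thesis using 1 2 3 by linarith
qed

text \<open>The intertwining relation gives this on the range of the defect operator, continuity on
  its closure. Applied to the adjoint it makes \<open>I + T* Z(z)\<close> act on
  \<open>U\<close>.\<close>

lemma contraction_maps_defect_space:
  assumes T: "T \<in> bounded_ops UNIV UNIV" "\<And>x. norm (T x) \<le> norm x" and x: "x \<in> defect_space T"
  shows "T x \<in> defect_space (adj UNIV T)"
proof -
  note a = contraction_adj[OF T]
  obtain g where g: "\<And>n. g n \<in> range (defect_op T)" "g \<longlonglongrightarrow> x"
    using x unfolding defect_space_def closure_sequential by blast
  have "T (g n) \<in> defect_space (adj UNIV T)" for n
    using g(1)[of n] by (auto simp: defect_op_intertwine[OF T] intro!: defect_op_mem[OF a(1,2)])
  moreover have "(\<lambda>n. T (g n)) \<longlonglongrightarrow> T x"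
    by (rule bounded_linear.tendsto[OF bounded_ops_linear[OF T(1)] g(2)])
  ultimately show ?thesis
    by (intro csubspace_lim[OF defect_space_csubspace[OF a(1,2)]]) auto
qed

text \<open>The kernel of a selfadjoint operator is orthogonal to its range, hence to
  \<open>defect_space T\<close>.\<close>

lemma defect_op_inj:
  assumes T: "T \<in> bounded_ops UNIV UNIV" "\<And>x. norm (T x) \<le> norm x"
    and x: "x \<in> defect_space T" "defect_op T x = 0"
  shows "x = 0"
proof -
  obtain g where g: "\<And>n. g n \<in> range (defect_op T)" "g \<longlonglongrightarrow> x"
    using x(1) unfolding defect_space_def closure_sequential by blast
  have "cinner (g n) x = 0" for n
    using g(1)[of n] x(2) by (auto simp: defect_op_selfadjoint[OF T])
  moreover have "(\<lambda>n. cinner (g n) x) \<longlonglongrightarrow> cinner x x" by (intro tendsto_intros g)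
  ultimately have "cinner x x = 0" by (simp add: LIMSEQ_const_iff)
  then show ?thesis by (simp add: cinner_self)
qed

text \<open>The transfer between \<open>\<Theta>\<close> and \<open>Z\<close>, stated so that it applies both to a function and its Moebius
  parameter, and to their adjoints \<open>z \<mapsto> \<Theta>(cnj z)\<^sup>*\<close> and \<open>z \<mapsto> Z(cnj z)\<^sup>*\<close>.\<close>

lemma has_row_moebius:
  fixes T :: "'a::complex_hilbert \<Rightarrow> 'b::complex_hilbert"
  assumes T: "T \<in> bounded_ops UNIV UNIV" "\<And>x. norm (T x) \<le> norm x"
    and U_def: "U = defect_space T" and V_def: "V = defect_space (adj UNIV T)"
    and Z: "\<And>z. z \<in> unit_disk \<Longrightarrow> Z z \<in> bounded_ops U V"
    and Zn: "\<And>z u. z \<in> unit_disk \<Longrightarrow> u \<in> U \<Longrightarrow> norm (Z z u) \<le> cmod z * norm u"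
    and Zh: "\<And>u y. u \<in> U \<Longrightarrow> y \<in> V \<Longrightarrow> (\<lambda>z. cinner (Z z u) y) holomorphic_on unit_disk"
    and \<Theta>: "\<And>z x u. z \<in> unit_disk \<Longrightarrow> u \<in> U \<Longrightarrow> u + adj UNIV T (Z z u) = defect_op T x \<Longrightarrow>
      \<Theta> z x = T x + defect_op (adj UNIV T) (Z z u)"
  shows "has_row UNIV (\<lambda>z x. (norm (\<Theta> z x))\<^sup>2) \<longleftrightarrow> has_row U (\<lambda>z u. (norm (Z z u))\<^sup>2)"
proof -
  note a = contraction_adj[OF T]
  have U: "closed_csubspace U" unfolding U_def by (rule defect_space_csubspace[OF T])
  have V: "closed_csubspace V" unfolding V_def by (rule defect_space_csubspace[OF a(1,2)])
  have TV: "adj UNIV T v \<in> U" if "v \<in> V" for v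
    using contraction_maps_defect_space[OF a(1,2)] that unfolding a(4) U_def V_def by blast
  define P where "P z u = adj UNIV T (Z z u)" for z u
  define S where "S z u = u + P z u" for z u
  have Pn: "norm (P z u) \<le> cmod z * norm u" if "z \<in> unit_disk" "u \<in> U" for z u
    unfolding P_def using a(2)[of "Z z u"] Zn[OF that] by linarith
  have P: "P z \<in> bounded_ops U U" if z: "z \<in> unit_disk" for z
  proof (rule bounded_opsI[where K = "cmod z"])
    fix u assume u: "u \<in> U"
    show "P z u \<in> U" unfolding P_def by (rule TV[OF bounded_ops_mem[OF Z[OF z] u]])
    show "P z (c *\<^sub>C u) = c *\<^sub>C P z u" for c
      unfolding P_def bounded_ops_scaleC[OF Z[OF z] u] by (rule bounded_ops_scaleC[OF a(1) UNIV_I])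
    show "P z (u + v) = P z u + P z v" if "v \<in> U" for v
      unfolding P_def bounded_ops_add[OF Z[OF z] u that] by (rule bounded_ops_add[OF a(1) UNIV_I UNIV_I])
    show "norm (P z u) \<le> cmod z * norm u" by (rule Pn[OF z u])
  qed
  have Sops: "S z \<in> bounded_ops U U" and Sn: "\<And>u. u \<in> U \<Longrightarrow> norm (S z u) \<le> 2 * norm u" if z: "z \<in> unit_disk" for z
  proof -
    show n: "norm (S z u) \<le> 2 * norm u" if u: "u \<in> U" for u
    proof -
      have "cmod z * norm u \<le> 1 * norm u" using z by (intro mult_right_mono) auto
      then show ?thesis using norm_triangle_ineq[of u "P z u"] Pn[OF z u] unfolding S_def by linarith
    qed
    show "S z \<in> bounded_ops U U"
      by (rule bounded_opsI[where K = 2]) (auto simp: S_def bounded_ops_add[OF P[OF z]]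
        bounded_ops_scaleC[OF P[OF z]] scaleC_add_right intro!: csubspace_add[OF U] bounded_ops_mem[OF P[OF z]] n[unfolded S_def])
  qed
  have S: "op_holomorphic U U S"
  proof (rule op_holomorphicI[OF U U Sops Sn])
    fix u assume u: "u \<in> U"
    have idb: "(\<lambda>x. x) \<in> bounded_ops V UNIV" by (rule bounded_opsI[where K = 1]) auto
    show "weakly_holomorphic (\<lambda>z. S z u)"
      unfolding weakly_holomorphic_def
    proof
      fix c
      \<comment> \<open>Orthogonal projection of \<open>T c\<close> onto \<open>V\<close>, since
        holomorphy of \<open>Z\<close> is assumed only against vectors of \<open>V\<close>.\<close>
      let ?y = "adj V (\<lambda>x. x) (T c)"
      have "(\<lambda>z. cinner u c + cinner (Z z u) ?y) holomorphic_on unit_disk"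
        by (intro holomorphic_intros Zh u adj_mem[OF V idb])
      moreover have "cinner u c + cinner (Z z u) ?y = cinner (S z u) c" if z: "z \<in> unit_disk" for z
      proof -
        have "cinner (P z u) c = cinner (Z z u) (T c)"
          unfolding P_def contraction_adj(3)[OF a(1,2)] a(4) ..
        also have "\<dots> = cinner (Z z u) ?y" by (rule cinner_adj[OF V idb bounded_ops_mem[OF Z[OF z] u]])
        finally show ?thesis unfolding S_def cinner_add_left by simp
      qed
      ultimately show "(\<lambda>z. cinner (S z u) c) holomorphic_on unit_disk" by (rule holomorphic_transform)
    qed
  qed
  have low: "(1 - cmod z) * norm u \<le> norm (S z u)" if "z \<in> unit_disk" "u \<in> U" for z u
    using norm_diff_ineq[of u "P z u"] Pn[OF that] unfolding S_def by (simp add: left_diff_distrib)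
  define R where "R z y = (SOME u. u \<in> U \<and> S z u = y)" for z y
  have R: "R z y \<in> U \<and> S z (R z y) = y" if z: "z \<in> unit_disk" and y: "y \<in> U" for z y
  proof -
    have "\<exists>u\<in>U. u + P z u = y"
      by (rule contraction_perturbation_surj[OF U P[OF z] norm_ge_zero _ Pn[OF z] y]) (use z in simp_all)
    then show ?thesis unfolding R_def S_def Bex_def by (rule someI_ex)
  qed
  have D: "defect_op T \<in> bounded_ops UNIV U"
    by (rule bounded_ops_weaken[OF defect_op_bounded[OF T]]) (simp add: U_def defect_op_mem[OF T])
  have dense: "U \<subseteq> closure (range (defect_op T))" unfolding U_def defect_space_def ..
  have NM: "(norm x)\<^sup>2 - (norm (\<Theta> z x))\<^sup>2 = (norm u)\<^sup>2 - (norm (Z z u))\<^sup>2"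
    if "z \<in> unit_disk" "u \<in> U" "S z u = defect_op T x" for z x u
    using defect_identity[OF T, of u "Z z u" x] \<Theta>[OF that(1,2), of x] that(3) unfolding S_def P_def by simp
  have Mcont: "continuous_on U (\<lambda>u. (norm (Z z u))\<^sup>2)" if z: "z \<in> unit_disk" for z
    by (intro continuous_intros bounded_ops_continuous_on[OF U Z[OF z]])
  note core = U D dense S low conjunct1[OF R] conjunct2[OF R] NM Mcont zero_le_power2
  show ?thesis
    using has_row_pull[where M = "\<lambda>z u. (norm (Z z u))\<^sup>2", OF core]
      has_row_push[where M = "\<lambda>z u. (norm (Z z u))\<^sup>2", OF core] by blast
qed

theorem corollary4p5:
  fixes \<Theta> Z :: "complex \<Rightarrow> 'm::{complex_hilbert, second_countable_topology}
                        \<Rightarrow> 'n::{complex_hilbert, second_countable_topology}"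
    and \<phi>\<Theta> :: "complex \<Rightarrow> 'm \<Rightarrow> 'k1::complex_hilbert"
    and \<phi>Z :: "complex \<Rightarrow> 'm \<Rightarrow> 'k2::complex_hilbert"
    and \<psi>\<Theta> :: "complex \<Rightarrow> 'k3::complex_hilbert \<Rightarrow> 'n"
    and \<psi>Z :: "complex \<Rightarrow> 'k4::complex_hilbert \<Rightarrow> 'n"
    and U :: "'m set" and V :: "'n set"
    and K1 :: "'k1 set" and K2 :: "'k2 set" and K3 :: "'k3 set" and K4 :: "'k4 set"
  assumes "U = defect_space (\<Theta> 0)"
    and "V = defect_space (adj UNIV (\<Theta> 0))"
    and "\<Theta> \<in> schur_class UNIV UNIV"
    and "moebius_parameter \<Theta> Z"
    and "right_defect_function UNIV \<Theta> K1 \<phi>\<Theta>"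
    and "right_defect_function U Z K2 \<phi>Z"
    and "left_defect_function UNIV UNIV \<Theta> K3 \<psi>\<Theta>"
    and "left_defect_function U V Z K4 \<psi>Z"
  shows "((\<forall>z\<in>unit_disk. \<forall>x. \<phi>\<Theta> z x = 0) \<longleftrightarrow> (\<forall>z\<in>unit_disk. \<forall>x\<in>U. \<phi>Z z x = 0)) \<and>
         ((\<forall>z\<in>unit_disk. \<forall>k\<in>K3. \<psi>\<Theta> z k = 0) \<longleftrightarrow> (\<forall>z\<in>unit_disk. \<forall>k\<in>K4. \<psi>Z z k = 0))"
proof -
  define T where "T = \<Theta> 0"
  note \<Theta> = assms(3)
  have z0: "(0::complex) \<in> unit_disk" by simp
  have T: "T \<in> bounded_ops UNIV UNIV" "norm (T x) \<le> norm x" for x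
    unfolding T_def by (rule schur_class_bounded[OF closed_csubspace_UNIV \<Theta> z0])
      (rule schur_class_norm[OF closed_csubspace_UNIV \<Theta> z0 UNIV_I])
  note a = contraction_adj[OF T]
  have U_def: "U = defect_space T" and V_def: "V = defect_space (adj UNIV T)"
    unfolding T_def by (rule assms(1)) (rule assms(2))
  have U: "closed_csubspace U" unfolding U_def by (rule defect_space_csubspace[OF T])
  have V: "closed_csubspace V" unfolding V_def by (rule defect_space_csubspace[OF a(1,2)])
  have Z: "Z \<in> schur_class U V"
    and bij: "\<And>z. z \<in> unit_disk \<Longrightarrow> bij_betw (\<lambda>u. u + adj UNIV T (Z z u)) U U"
    and \<Theta>Z: "\<And>z x. z \<in> unit_disk \<Longrightarrow> \<Theta> z x = T x + defect_op (adj UNIV T)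
        (Z z (inv_into U (\<lambda>u. u + adj UNIV T (Z z u)) (defect_op T x)))"
    using assms(4) unfolding moebius_parameter_def Let_def T_def[symmetric] U_def[symmetric] V_def[symmetric]
    by simp_all
  note Zops = schur_class_bounded[OF U Z]
  \<comment> \<open>Injectivity replaces \<open>inv_into\<close> by an arbitrary solution
    \<open>u\<close> of the equation, a form that can also be checked for the adjoint
    functions.\<close>
  have param: "\<Theta> z x = T x + defect_op (adj UNIV T) (Z z u)"
    if z: "z \<in> unit_disk" and u: "u \<in> U" and eq: "u + adj UNIV T (Z z u) = defect_op T x" for z x u
    using \<Theta>Z[OF z, of x] inv_into_f_f[OF bij_betw_imp_inj_on[OF bij[OF z]] u] unfolding eq by simp
  have solve: "\<exists>u\<in>U. u + adj UNIV T (Z z u) = defect_op T x" if z: "z \<in> unit_disk" for z x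
  proof -
    have "defect_op T x \<in> (\<lambda>u. u + adj UNIV T (Z z u)) ` U"
      by (subst bij_betw_imp_surj_on[OF bij[OF z]]) (simp add: U_def defect_op_mem[OF T])
    then show ?thesis by auto
  qed
  \<comment> \<open>At 0 the formula returns \<open>T x\<close> itself, so the defect operator of
    the adjoint annihilates \<open>Z 0 u\<close>; it is injective on \<open>V\<close>, hence
    \<open>Z 0 u = 0\<close>, and then \<open>u = defect_op T x\<close>.\<close>
  have Z0D: "Z 0 (defect_op T x) = 0" for x
  proof -
    from solve[OF z0, of x] obtain u where u: "u \<in> U" "u + adj UNIV T (Z 0 u) = defect_op T x" by (rule bexE)
    have "defect_op (adj UNIV T) (Z 0 u) = 0" using param[OF z0 u] unfolding T_def by simp
    then have "Z 0 u = 0"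
      by (rule defect_op_inj[OF a(1,2) bounded_ops_mem[OF Zops[OF z0] u(1), unfolded V_def]])
    then show ?thesis using u(2) bounded_ops_zero[OF closed_csubspace_UNIV a(1)] by simp
  qed
  have Z0: "Z 0 u = 0" if u: "u \<in> U" for u
  proof -
    obtain g where g: "\<And>n. g n \<in> range (defect_op T)" "g \<longlonglongrightarrow> u"
      using u unfolding U_def defect_space_def closure_sequential by blast
    have gU: "g n \<in> U" for n using g(1)[of n] defect_op_mem[OF T] unfolding U_def by auto
    have "Z 0 (g n) = 0" for n using g(1)[of n] Z0D by auto
    moreover have "(\<lambda>n. Z 0 (g n)) \<longlonglongrightarrow> Z 0 u"
      by (rule continuous_on_tendsto_compose[OF bounded_ops_continuous_on[OF U Zops[OF z0]] g(2) u])
        (use gU in simp)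
    ultimately show ?thesis by (simp add: LIMSEQ_const_iff)
  qed
  have Zn: "norm (Z z u) \<le> cmod z * norm u" if "z \<in> unit_disk" "u \<in> U" for z u
    by (rule schwarz_operator[OF U V Z _ that]) (rule Z0)
  have right: "has_row UNIV (\<lambda>z x. (norm (\<Theta> z x))\<^sup>2) \<longleftrightarrow> has_row U (\<lambda>z u. (norm (Z z u))\<^sup>2)"
    by (rule has_row_moebius[OF T U_def V_def Zops Zn weakly_holomorphicD[OF schur_class_weakly[OF U Z]] param])
  \<comment> \<open>\<open>W\<close> will act as Moebius parameter of the function with values
    \<open>adj UNIV (\<Theta> (cnj z))\<close>: \<open>T\<close> is replaced by its adjoint, and
    \<open>U\<close> and \<open>V\<close> change places.\<close>
  define W where "W z = adj U (Z (cnj z))" for z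
  have cnjd: "cnj z \<in> unit_disk" if "z \<in> unit_disk" for z using that by simp
  have W: "W z \<in> bounded_ops V U" if "z \<in> unit_disk" for z
    unfolding W_def by (rule adj_bounded_ops[OF U Zops[OF cnjd[OF that]]])
  have Wn: "norm (W z v) \<le> cmod z * norm v" if z: "z \<in> unit_disk" for z v
    using norm_adj_le[OF U Zops[OF cnjd[OF z]] norm_ge_zero Zn[OF cnjd[OF z]]] unfolding W_def by simp
  have Wh: "(\<lambda>z. cinner (W z v) u) holomorphic_on unit_disk" if v: "v \<in> V" and u: "u \<in> U" for v u
  proof -
    have "(\<lambda>z. cnj (cinner (Z (cnj z) u) v)) holomorphic_on unit_disk"
      by (rule holomorphic_cnj_cnj[OF weakly_holomorphicD[OF schur_class_weakly[OF U Z u]]])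
    moreover have "cnj (cinner (Z (cnj z) u) v) = cinner (W z v) u" if "z \<in> unit_disk" for z
      unfolding W_def cinner_adj'[OF U Zops[OF cnjd[OF that]] u, symmetric] by (rule cinner_commute[symmetric])
    ultimately show ?thesis by (rule holomorphic_transform)
  qed
  \<comment> \<open>Verified by pairing with an arbitrary \<open>x\<close>: the equations that
    define \<open>u\<close> from \<open>x\<close> and \<open>v\<close> from \<open>y\<close> are
    substituted, and the selfadjoint defect operators are moved across the inner product. No inverse
    has to be transposed.\<close>
  have tilde: "adj UNIV (\<Theta> (cnj z)) y = adj UNIV T y + defect_op (adj UNIV (adj UNIV T)) (W z v)"
    if z: "z \<in> unit_disk" and v: "v \<in> V"
      and eq: "v + adj UNIV (adj UNIV T) (W z v) = defect_op (adj UNIV T) y" for z y v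
    unfolding a(4)
  proof (rule adj_eqI[OF closed_csubspace_UNIV schur_class_bounded[OF closed_csubspace_UNIV \<Theta> cnjd[OF z]] UNIV_I])
    fix x
    from solve[OF cnjd[OF z], of x] obtain u
      where u: "u \<in> U" and Du: "u + adj UNIV T (Z (cnj z) u) = defect_op T x" by (rule bexE)
    let ?\<zeta> = "Z (cnj z) u"
    note adjZ = cinner_adj[OF U Zops[OF cnjd[OF z]] u, folded W_def]
    have "cinner (defect_op (adj UNIV T) ?\<zeta>) y = cinner ?\<zeta> (v + T (W z v))"
      unfolding defect_op_selfadjoint[OF a(1,2)] eq[symmetric] a(4) ..
    also have "\<dots> = cinner u (W z v) + cinner (adj UNIV T ?\<zeta>) (W z v)"
      unfolding cinner_add_right adjZ contraction_adj(3)[OF a(1,2)] a(4) ..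
    also have "\<dots> = cinner x (defect_op T (W z v))"
      unfolding cinner_add_left[symmetric] Du by (rule defect_op_selfadjoint[OF T])
    finally show "cinner (\<Theta> (cnj z) x) y = cinner x (adj UNIV T y + defect_op T (W z v))"
      unfolding param[OF cnjd[OF z] u Du] cinner_add_left cinner_add_right a(3) by simp
  qed
  have U_def': "U = defect_space (adj UNIV (adj UNIV T))" unfolding a(4) by (rule U_def)
  have left: "has_row UNIV (\<lambda>z y. (norm (adj UNIV (\<Theta> (cnj z)) y))\<^sup>2) \<longleftrightarrow>
      has_row V (\<lambda>z v. (norm (adj U (Z (cnj z)) v))\<^sup>2)"
    unfolding W_def[symmetric] by (rule has_row_moebius[OF a(1,2) V_def U_def' W Wn Wh tilde])
  note sep = separable_set_second_countable
  have "(\<forall>z\<in>unit_disk. \<forall>x. \<phi>\<Theta> z x = 0) \<longleftrightarrow> \<not> has_row UNIV (\<lambda>z x. (norm (\<Theta> z x))\<^sup>2)"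
    using right_defect_zero_iff[OF closed_csubspace_UNIV sep closed_csubspace_UNIV \<Theta> assms(5)]
    by (simp only: ball_UNIV)
  also have "\<dots> \<longleftrightarrow> (\<forall>z\<in>unit_disk. \<forall>x\<in>U. \<phi>Z z x = 0)"
    unfolding right right_defect_zero_iff[OF U sep V Z assms(6)] ..
  finally have 1: "(\<forall>z\<in>unit_disk. \<forall>x. \<phi>\<Theta> z x = 0) \<longleftrightarrow> (\<forall>z\<in>unit_disk. \<forall>x\<in>U. \<phi>Z z x = 0)" .
  have 2: "(\<forall>z\<in>unit_disk. \<forall>k\<in>K3. \<psi>\<Theta> z k = 0) \<longleftrightarrow> (\<forall>z\<in>unit_disk. \<forall>k\<in>K4. \<psi>Z z k = 0)"
    unfolding left_defect_zero_iff[OF closed_csubspace_UNIV sep closed_csubspace_UNIV sep \<Theta> assms(7)]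
      left_defect_zero_iff[OF U sep V sep Z assms(8)] left ..
  show ?thesis using 1 2 by (rule conjI)
qed

end
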